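(* Let $(e_1,\dots,e_n)$ be an adapted basis of $T_p(H)$ and $\mathcal A$ the corresponding apartment of $\mathcal I(V)$. Let $(b_{ij})_{1\le i<j\le n}$, $b_{ij}\in\mathbb N$, be such that $$\forall i<j:\quad \lambda_i^{(b_{ij}+1)}\ \ge\ \lambda_j\ >\ \lambda_i^{(b_{ij}+2)} .$$ Then $(b_{ij})_{1\le i<j\le n}$ defines a maximal simplex of $\mathcal A$, and $S$ is a facet (face) of this maximal simplex, equal to the intersection of this maximal simplex with the walls $$\{x:\ \alpha_{ij}(x)=b_{ij}\}\quad\text{for all } i<j \text{ such that } \lambda_i^{(b_{ij}+1)}=\lambda_j .$$
   Context: $F/\mathbb{Q}_p$ is a finite extension, $\mathcal O=\mathcal O_F$, $\pi$ a uniformizer, $q$ the residue cardinality. $K$ is an algebraically closed field containing $F$, complete for a valuation $v:K\to\mathbb{R}\cup\{+\infty\}$ extending the valuation of $F$ normalized by $v(\pi)=1$. $H$ is a $\pi$-divisible $\mathcal O$-module over $\mathrm{Spec}(\mathcal O_K)$ of dimension $1$ and $\mathcal O$-height $n$ ($\mathcal O$ acting on the Lie algebra through $\mathcal O\to\mathcal O_K$) with formal special fibre; $\widehat H$ is the associated formal group. An isomorphism of pointed formal schemes $\widehat H\simeq\mathrm{Spf}(\mathcal O_K[[T]])$ identifies $\widehat H(\mathcal O_K)$ with $\{a\in\mathcal O_K: v(a)>0\}$; $v(y)$ is the valuation of the coordinate of $y$ (independent of choices; $v(0)=+\infty$). $V=V_p(H)$ is identified with sequences $(x_i)_{i\in\mathbb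 Z}$, $x_i\in\widehat H(\mathcal O_K)$, $\pi x_{i+1}=x_i$, $x_i=0$ for $i\ll0$; $v((x_i)_i)=v(x_0)$; $\mathrm{Fil}_\lambda V=\{x\in V: v(x)\ge\lambda\}$, lattices with $\mathrm{Fil}_\infty V=T_p(H)$. Slopes: $\lambda_1\ge\dots\ge\lambda_n>0$ are the valuations of the non-zero points of $H[\pi](\mathcal O_K)$, $\lambda_i$ being counted for $q^i-q^{i-1}$ points. Let $\eta(s)=s+\sum_{i=1}^n(q^i-q^{i-1})\min(s,\lambda_i)$, an increasing bijection of $[0,+\infty[$. For $\lambda\in\,]0,+\infty[$ put $\lambda^{(1)}=\lambda$, $\lambda^{(k+1)}=\eta^{-1}(\lambda^{(k)})$ (equivalently $\lambda^{(k+1)}$ is the largest slope, in absolute value, of the convex hull of $(0,\lambda^{(k)})$ and the polygon on $[1,q^n]$ going from $(1,1)$ to $(q^n,0)$ with slope $-\lambda_i$ on $[q^{i-1},q^i]$). An adapted basis of $T_p(H)$ is a basis $(e_1,\dots,e_n)$ of the $\mathcal O$-module $T_p(H)$ with $v(\pi^{-k}e_i)=\lambda_i^{(k)}$ for all $1\le i\le n$, $k\ge1$ (such bases exist). $\mathcal I(V)$ is the building of $\mathrm{PGL}(V)$ (vertices: homothety classes of lattices; simplices: finite sets of vertices having representatives $\pi\Lambda_1\subsetneq\Lambda_d\subsetneq\dots\subsetneq\Lambda_1$). The apartment $\mathcal A$ has vertices $[\bigoplus_i\mathcal O\pi^{-a_i}e_i]$, $a\in\mathbb Z^n$; for $i<j$,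 $\alpha_{ij}([\bigoplus_l\mathcal O\pi^{-a_l}e_l])=a_i-a_j$. A family of integers $(b_{ij})_{i<j}$ "defines a maximal simplex of $\mathcal A$" if $b_{ik}\in\{b_{ij}+b_{jk},\,b_{ij}+b_{jk}+1\}$ for all $i<j<k$; the maximal simplex is then the one with vertex set $\{x\in\mathcal A:\forall i<j,\ \alpha_{ij}(x)\in\{b_{ij},b_{ij}+1\}\}$. $S$ is the simplex of $\mathcal I(V)$ with vertices $\{[\mathrm{Fil}_\lambda V]: 0<\lambda\le\varepsilon\}$ for any $0<\varepsilon\le\lambda_n$ (this is a simplex, independent of $\varepsilon$, since $\mathrm{Fil}_{\lambda/q^n}V=\pi^{-1}\mathrm{Fil}_\lambda V$ for $0<\lambda\le\varepsilon$). *)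

theory Defs
  imports
    "HOL-Algebra.Algebraic_Closure_Type"
    "HOL-Algebra.Embedded_Algebras"
    "HOL-Algebra.Module"
    "HOL-Library.Extended_Real"
    "HOL-Library.Multiset"
    "HOL-Library.FuncSet"
begin

section \<open>The valued field\<close>

definition valuation :: "('k::field \<Rightarrow> ereal) \<Rightarrow> bool" where
  "valuation v \<longleftrightarrow>
     (\<forall>x. v x \<noteq> -\<infinity>) \<and> (\<forall>x. v x = \<infinity> \<longleftrightarrow> x = 0) \<and>
     (\<forall>x y. v (x * y) = v x + v y) \<and> (\<forall>x y. min (v x) (v y) \<le> v (x + y))"

definition vtendsto :: "('k::field \<Rightarrow> ereal) \<Rightarrow> (nat \<Rightarrow> 'k) \<Rightarrow> 'k \<Rightarrow> bool" where
  "vtendsto v u l \<longleftrightarrow> (\<lambda>N. v (u N - l)) \<longlonglongrightarrow> \<infinity>"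

definition vlim :: "('k::field \<Rightarrow> ereal) \<Rightarrow> (nat \<Rightarrow> 'k) \<Rightarrow> 'k" where
  "vlim v u = (THE l. vtendsto v u l)"

definition vcauchy :: "('k::field \<Rightarrow> ereal) \<Rightarrow> (nat \<Rightarrow> 'k) \<Rightarrow> bool" where
  "vcauchy v u \<longleftrightarrow> (\<forall>M::real. \<exists>N. \<forall>i\<ge>N. \<forall>j\<ge>N. ereal M < v (u i - u j))"

definition vcomplete :: "('k::field \<Rightarrow> ereal) \<Rightarrow> bool" where
  "vcomplete v \<longleftrightarrow> (\<forall>u. vcauchy v u \<longrightarrow> (\<exists>l. vtendsto v u l))"

text \<open>
  The copy of \<open>\<rat>\<^sub>p\<close> inside a complete field: the closure of \<open>\<rat>\<close>.  When \<open>v\<close> is a valuation with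
  \<open>v p > 0\<close> its restriction to \<open>\<rat>\<close> is a positive multiple of the \<open>p\<close>-adic valuation, so this closure is
  the \<open>p\<close>-adic completion of \<open>\<rat>\<close>.
\<close>
definition padic_closure :: "('k::field_char_0 \<Rightarrow> ereal) \<Rightarrow> 'k set" where
  "padic_closure v = {x. \<exists>r::nat \<Rightarrow> rat. vtendsto v (\<lambda>N. of_rat (r N)) x}"


section \<open>Formal power series in three variables\<close>

type_synonym 'k mps = "'k fps fps fps"

definition varX :: "'k::field mps" where "varX = fps_const (fps_const fps_X)"
definition varY :: "'k::field mps" where "varY = fps_const fps_X"
definition varZ :: "'k::field mps" where "varZ = fps_X"

text \<open>
  \<open>subst1 f A\<close> is \<open>f(A)\<close> and \<open>subst2 c A B\<close> is \<open>\<Sum> c\<^sub>i\<^sub>j A\<^sup>i B\<^sup>j\<close>, for \<open>A\<close>, \<open>B\<close> without constant term.  The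
  coefficient of \<open>X\<^sup>a Y\<^sup>b Z\<^sup>d\<close> in \<open>A\<^sup>i B\<^sup>j\<close> then vanishes if \<open>i + j > a + b + d\<close>, so the sums below lose
  nothing.
\<close>
definition subst1 :: "'k::field fps \<Rightarrow> 'k mps \<Rightarrow> 'k mps" where
  "subst1 f A = Abs_fps (\<lambda>d. Abs_fps (\<lambda>b. Abs_fps (\<lambda>a.
     \<Sum>i\<le>a + b + d. fps_nth f i * fps_nth (fps_nth (fps_nth (A ^ i) d) b) a)))"

definition subst2 :: "(nat \<Rightarrow> nat \<Rightarrow> 'k::field) \<Rightarrow> 'k mps \<Rightarrow> 'k mps \<Rightarrow> 'k mps" where
  "subst2 c A B = Abs_fps (\<lambda>d. Abs_fps (\<lambda>b. Abs_fps (\<lambda>a.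
     \<Sum>i\<le>a + b + d. \<Sum>j\<le>a + b + d.
       c i j * fps_nth (fps_nth (fps_nth (A ^ i * B ^ j) d) b) a)))"


section \<open>Formal modules\<close>

text \<open>
  A \<open>\<pi>\<close>-divisible \<open>\<O>\<close>-module of dimension 1 over \<open>\<O>\<^sub>K\<close> with formal special fibre is given by its
  formal group in a coordinate \<open>T\<close>.  The record collects \<open>v\<close>, the subfield \<open>F\<close>, \<open>\<pi>\<close>, the coefficients
  of the group law \<open>\<Sum> c\<^sub>i\<^sub>j X\<^sup>i Y\<^sup>j\<close>, and the series \<open>[a](T)\<close> for \<open>a \<in> \<O>\<close>.
\<close>
record 'k formal_module =
  val :: "'k \<Rightarrow> ereal"
  base :: "'k set"
  unif :: "'k"
  law :: "nat \<Rightarrow> nat \<Rightarrow> 'k"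
  act :: "'k \<Rightarrow> 'k fps"

definition OF_ring :: "('k::field) formal_module \<Rightarrow> 'k set" where
  "OF_ring H = {a \<in> base H. 0 \<le> val H a}"

definition residue_card :: "('k::field) formal_module \<Rightarrow> nat" where
  "residue_card H =
     card (OF_ring H // {(x, y). x \<in> OF_ring H \<and> y \<in> OF_ring H \<and> 0 < val H (x - y)})"

locale pi_divisible_module =
  fixes p n :: nat and H :: "('k::{alg_closed_field, field_char_0}) formal_module"
  assumes prime_p: "prime p"
    and val_valuation: "valuation (val H)"
    and val_complete: "vcomplete (val H)"
    and val_p: "0 < val H (of_nat p)"
    and base_subfield: "subfield (base H) ring_of_type_algebra"
    and base_finite: "ring.finite_dimension ring_of_type_algebra (padic_closure (val H)) (base H)"
    and unif_base: "unif H \<in> base H"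
    and val_unif: "val H (unif H) = 1"
    and val_base: "\<And>x. x \<in> base H \<Longrightarrow> x \<noteq> 0 \<Longrightarrow> \<exists>m::int. val H x = ereal (of_int m)"
    and law_integral: "\<And>i j. 0 \<le> val H (law H i j)"
    and law_zero_right: "subst2 (law H) varX 0 = varX"
    and law_zero_left: "subst2 (law H) 0 varX = varX"
    and law_comm: "subst2 (law H) varX varY = subst2 (law H) varY varX"
    and law_assoc: "subst2 (law H) (subst2 (law H) varX varY) varZ =
                    subst2 (law H) varX (subst2 (law H) varY varZ)"
    and act_integral: "\<And>a i. a \<in> OF_ring H \<Longrightarrow> 0 \<le> val H (fps_nth (act H a) i)"
    and act_const: "\<And>a. a \<in> OF_ring H \<Longrightarrow> fps_nth (act H a) 0 = 0"
    and act_hom: "\<And>a. a \<in> OF_ring H \<Longrightarrow> subst1 (act H a) (subst2 (law H) varX varY) =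
                    subst2 (law H) (subst1 (act H a) varX) (subst1 (act H a) varY)"
    and act_add: "\<And>a b. a \<in> OF_ring H \<Longrightarrow> b \<in> OF_ring H \<Longrightarrow> subst1 (act H (a + b)) varX =
                    subst2 (law H) (subst1 (act H a) varX) (subst1 (act H b) varX)"
    and act_mult: "\<And>a b. a \<in> OF_ring H \<Longrightarrow> b \<in> OF_ring H \<Longrightarrow> subst1 (act H (a * b)) varX =
                    subst1 (act H a) (subst1 (act H b) varX)"
    and act_one: "subst1 (act H 1) varX = varX"
    and act_Lie: "\<And>a. a \<in> OF_ring H \<Longrightarrow> fps_nth (act H a) 1 = a"
    and height_pos: "1 \<le> n"
    \<comment> \<open>height \<open>n\<close>: modulo the maximal ideal, \<open>[\<pi>](T)\<close> is \<open>T\<close> to the power \<open>q\<^sup>n\<close> times a unit\<close>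
    and height_below: "\<And>i. i < residue_card H ^ n \<Longrightarrow> 0 < val H (fps_nth (act H (unif H)) i)"
    and height_unit: "val H (fps_nth (act H (unif H)) (residue_card H ^ n)) = 0"


section \<open>Points, Tate module, filtration\<close>

definition points :: "('k::field) formal_module \<Rightarrow> 'k set" where
  "points H = {x. 0 < val H x}"

definition padd :: "('k::field) formal_module \<Rightarrow> 'k \<Rightarrow> 'k \<Rightarrow> 'k" where
  "padd H x y = vlim (val H) (\<lambda>N. \<Sum>i<N. \<Sum>j<N. law H i j * x ^ i * y ^ j)"

definition pact :: "('k::field) formal_module \<Rightarrow> 'k \<Rightarrow> 'k \<Rightarrow> 'k" where
  "pact H a x = vlim (val H) (\<lambda>N. \<Sum>i<N. fps_nth (act H a) i * x ^ i)"

text \<open>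
  \<open>V\<^sub>p(H)\<close> as an \<open>F\<close>-vector space.  Since \<open>\<pi> x\<^sub>i\<^sub>+\<^sub>1 = x\<^sub>i\<close>, for \<open>a \<in> F\<close> and any \<open>m\<close> with \<open>\<pi>\<^sup>m a \<in> \<O>\<close> one has
  \<open>(a x)\<^sub>i = [\<pi>\<^sup>m a](x\<^sub>i\<^sub>+\<^sub>m)\<close>; the least such \<open>m\<close> is used.  The ring multiplication fields of the
  record play no role.
\<close>
definition VH :: "('k::field) formal_module \<Rightarrow> ('k, int \<Rightarrow> 'k) module" where
  "VH H = \<lparr>
     carrier = {x. (\<forall>i. x i \<in> points H) \<and> (\<forall>i. pact H (unif H) (x (i + 1)) = x i) \<and>
                   (\<exists>N. \<forall>i<N. x i = 0)},
     monoid.mult = undefined, one = undefined,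
     ring.zero = (\<lambda>i. 0),
     add = (\<lambda>x y i. padd H (x i) (y i)),
     module.smult = (\<lambda>a x i. let m = (LEAST m::nat. 0 \<le> val H (unif H ^ m * a))
                      in pact H (unif H ^ m * a) (x (i + int m))) \<rparr>"

definition Fil :: "('k::field) formal_module \<Rightarrow> ereal \<Rightarrow> (int \<Rightarrow> 'k) set" where
  "Fil H l = {x \<in> carrier (VH H). l \<le> val H (x 0)}"

definition Tate :: "('k::field) formal_module \<Rightarrow> (int \<Rightarrow> 'k) set" where
  "Tate H = Fil H \<infinity>"

definition lincomb ::
    "('k::field) formal_module \<Rightarrow> nat \<Rightarrow> (nat \<Rightarrow> 'k) \<Rightarrow> (nat \<Rightarrow> int \<Rightarrow> 'k) \<Rightarrow> (int \<Rightarrow> 'k)" where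
  "lincomb H m c f = (\<Oplus>\<^bsub>VH H\<^esub>i\<in>{1..m}. c i \<odot>\<^bsub>VH H\<^esub> f i)"

definition O_span :: "('k::field) formal_module \<Rightarrow> nat \<Rightarrow> (nat \<Rightarrow> int \<Rightarrow> 'k) \<Rightarrow> (int \<Rightarrow> 'k) set" where
  "O_span H m f = {lincomb H m c f |c. c \<in> {1..m} \<rightarrow> OF_ring H}"


section \<open>Slopes and adapted bases\<close>

definition is_slopes :: "('k::field) formal_module \<Rightarrow> nat \<Rightarrow> (nat \<Rightarrow> real) \<Rightarrow> bool" where
  "is_slopes H n lam \<longleftrightarrow>
     (\<forall>i j. 1 \<le> i \<longrightarrow> i \<le> j \<longrightarrow> j \<le> n \<longrightarrow> lam j \<le> lam i) \<and> 0 < lam n \<and>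
     image_mset (val H) (mset_set {x \<in> points H. pact H (unif H) x = 0 \<and> x \<noteq> 0}) =
       (\<Sum>i\<in>{1..n}. replicate_mset (residue_card H ^ i - residue_card H ^ (i - 1)) (ereal (lam i)))"

definition eta :: "('k::field) formal_module \<Rightarrow> nat \<Rightarrow> (nat \<Rightarrow> real) \<Rightarrow> real \<Rightarrow> real" where
  "eta H n lam s =
     s + (\<Sum>i = 1..n. (real (residue_card H) ^ i - real (residue_card H) ^ (i - 1)) * min s (lam i))"

text \<open>\<open>iter H n lam k s\<close> is \<open>s\<^sup>(\<^sup>k\<^sup>)\<close>, for \<open>k \<ge> 1\<close>.\<close>
definition iter :: "('k::field) formal_module \<Rightarrow> nat \<Rightarrow> (nat \<Rightarrow> real) \<Rightarrow> nat \<Rightarrow> real \<Rightarrow> real" where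
  "iter H n lam k s = (the_inv_into {0..} (eta H n lam) ^^ (k - 1)) s"

definition adapted_basis ::
    "('k::field) formal_module \<Rightarrow> nat \<Rightarrow> (nat \<Rightarrow> real) \<Rightarrow> (nat \<Rightarrow> int \<Rightarrow> 'k) \<Rightarrow> bool" where
  "adapted_basis H n lam e \<longleftrightarrow>
     (\<forall>i\<in>{1..n}. e i \<in> Tate H) \<and>
     (\<forall>x\<in>Tate H. \<exists>!c. c \<in> {1..n} \<rightarrow>\<^sub>E OF_ring H \<and> x = lincomb H n c e) \<and>
     (\<forall>i\<in>{1..n}. \<forall>k\<ge>1. val H ((inverse (unif H) ^ k \<odot>\<^bsub>VH H\<^esub> e i) 0) = ereal (iter H n lam k (lam i)))"


section \<open>The building of PGL(V)\<close>

text \<open>A lattice is a finitely generated \<open>\<O>\<close>-submodule of \<open>V\<close> that generates \<open>V\<close> over \<open>F\<close>.\<close>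
definition lattice :: "('k::field) formal_module \<Rightarrow> (int \<Rightarrow> 'k) set \<Rightarrow> bool" where
  "lattice H L \<longleftrightarrow>
     (\<exists>m f. f \<in> {1..m} \<rightarrow> carrier (VH H) \<and> L = O_span H m f) \<and>
     (\<forall>x\<in>carrier (VH H). \<exists>a\<in>base H - {0}. a \<odot>\<^bsub>VH H\<^esub> x \<in> L)"

definition homothety ::
    "('k::field) formal_module \<Rightarrow> 'k \<Rightarrow> (int \<Rightarrow> 'k) set \<Rightarrow> (int \<Rightarrow> 'k) set" where
  "homothety H a L = (\<lambda>x. a \<odot>\<^bsub>VH H\<^esub> x) ` L"

definition hclass :: "('k::field) formal_module \<Rightarrow> (int \<Rightarrow> 'k) set \<Rightarrow> (int \<Rightarrow> 'k) set set" where
  "hclass H L = {homothety H a L |a. a \<in> base H - {0}}"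

text \<open>Simplices are nonempty and are identified with their sets of vertices.\<close>
definition simplex :: "('k::field) formal_module \<Rightarrow> (int \<Rightarrow> 'k) set set set \<Rightarrow> bool" where
  "simplex H s \<longleftrightarrow>
     (\<exists>d L. 1 \<le> d \<and> (\<forall>k\<in>{1..d}. lattice H (L k)) \<and>
        (\<forall>k\<in>{1..<d}. L (k + 1) \<subset> L k) \<and> homothety H (unif H) (L 1) \<subset> L (d::nat) \<and>
        s = (\<lambda>k. hclass H (L k)) ` {1..d})"

definition face ::
    "('k::field) formal_module \<Rightarrow> (int \<Rightarrow> 'k) set set set \<Rightarrow> (int \<Rightarrow> 'k) set set set \<Rightarrow> bool" where
  "face H s t \<longleftrightarrow> simplex H s \<and> simplex H t \<and> s \<subseteq> t"

definition apt_vertex ::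
    "('k::field) formal_module \<Rightarrow> nat \<Rightarrow> (nat \<Rightarrow> int \<Rightarrow> 'k) \<Rightarrow> (nat \<Rightarrow> int) \<Rightarrow> (int \<Rightarrow> 'k) set set" where
  "apt_vertex H n e a = hclass H (O_span H n (\<lambda>i. (unif H powi (- a i)) \<odot>\<^bsub>VH H\<^esub> e i))"

definition apartment ::
    "('k::field) formal_module \<Rightarrow> nat \<Rightarrow> (nat \<Rightarrow> int \<Rightarrow> 'k) \<Rightarrow> (int \<Rightarrow> 'k) set set set" where
  "apartment H n e = range (apt_vertex H n e)"

definition alpha ::
    "('k::field) formal_module \<Rightarrow> nat \<Rightarrow> (nat \<Rightarrow> int \<Rightarrow> 'k) \<Rightarrow> nat \<Rightarrow> nat \<Rightarrow> (int \<Rightarrow> 'k) set set \<Rightarrow> int"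
  where "alpha H n e i j x = (THE m. \<exists>a. x = apt_vertex H n e a \<and> m = a i - a j)"

definition alcove_family :: "nat \<Rightarrow> (nat \<Rightarrow> nat \<Rightarrow> int) \<Rightarrow> bool" where
  "alcove_family n b \<longleftrightarrow>
     (\<forall>i j k. 1 \<le> i \<longrightarrow> i < j \<longrightarrow> j < k \<longrightarrow> k \<le> n \<longrightarrow> b i k \<in> {b i j + b j k, b i j + b j k + 1})"

definition alcove ::
    "('k::field) formal_module \<Rightarrow> nat \<Rightarrow> (nat \<Rightarrow> int \<Rightarrow> 'k) \<Rightarrow> (nat \<Rightarrow> nat \<Rightarrow> int) \<Rightarrow>
       (int \<Rightarrow> 'k) set set set" where
  "alcove H n e b = {x \<in> apartment H n e.
     \<forall>i j. 1 \<le> i \<longrightarrow> i < j \<longrightarrow> j \<le> n \<longrightarrow> alpha H n e i j x \<in> {b i j, b i j + 1}}"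

definition maximal_simplex ::
    "('k::field) formal_module \<Rightarrow> nat \<Rightarrow> (nat \<Rightarrow> int \<Rightarrow> 'k) \<Rightarrow> (int \<Rightarrow> 'k) set set set \<Rightarrow> bool" where
  "maximal_simplex H n e s \<longleftrightarrow> simplex H s \<and> s \<subseteq> apartment H n e \<and>
     (\<forall>t. simplex H t \<and> t \<subseteq> apartment H n e \<and> s \<subseteq> t \<longrightarrow> t = s)"

definition Fil_simplex :: "('k::field) formal_module \<Rightarrow> real \<Rightarrow> (int \<Rightarrow> 'k) set set set" where
  "Fil_simplex H \<epsilon> = {hclass H (Fil H (ereal l)) |l. 0 < l \<and> l \<le> \<epsilon>}"

end

theory Submission
  imports Defs
begin

text \<open>
  The point is that \<open>v(\<Sum> x\<^sub>i) = min v(x\<^sub>i)\<close> for multiples \<open>x\<^sub>i\<close> of the \<open>e\<^sub>i\<close> in \<open>V\<^sub>p(H)\<close>.  Modulo \<open>T\<^sub>p(H)\<close>,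
  for \<open>x\<^sub>i \<in> \<pi>\<^sup>-\<^sup>1 T\<^sub>p(H)\<close>, this follows by counting the points of \<open>H[\<pi>]\<close>; in general it follows by induction
  on the denominators from \<open>v(\<pi> x) \<ge> \<eta>(v(x))\<close>, which holds because \<open>[\<pi>](T)\<close> is divisible by the product
  of \<open>T - z\<close> over the \<open>q\<^sup>n\<close> zeros \<open>z \<in> H[\<pi>]\<close>.  Hence \<open>Fil\<^sub>\<lambda> V = \<Oplus> \<O> \<pi>\<^sup>-\<^sup>a e\<^sub>i\<close> with \<open>a = a\<^sub>i(\<lambda>)\<close> the number of \<open>k \<ge> 1\<close>
  such that \<open>\<lambda>\<^sub>i\<^sup>(\<^sup>k\<^sup>) \<ge> \<lambda>\<close>.

  Put \<open>B\<^sub>i = b\<^sub>i\<^sub>n\<close> (and \<open>B\<^sub>n = 0\<close>) and \<open>\<mu>\<^sub>i = \<lambda>\<^sub>i\<^sup>(\<^sup>B\<^sup>i\<^sup>+\<^sup>1\<^sup>)\<close>, so that \<open>\<lambda>\<^sub>n \<le> \<mu>\<^sub>i < q\<^sup>n \<lambda>\<^sub>n\<close>.  For \<open>i < j\<close> one finds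
  \<open>B\<^sub>i - B\<^sub>j = b\<^sub>i\<^sub>j\<close> if \<open>\<mu>\<^sub>i \<ge> \<mu>\<^sub>j\<close> and \<open>b\<^sub>i\<^sub>j + 1\<close> otherwise.  Therefore the vertices of the maximal simplex are the
  \<open>B + 1\<^sub>D\<close> for the proper initial segments \<open>D\<close> of \<open>{1..n}\<close>, ordered by decreasing \<open>\<mu>\<^sub>i\<close> with ties broken by the
  index, and those of \<open>S\<close> are the ones where \<open>D = {i. \<mu>\<^sub>i \<ge> t}\<close>, i.e. where \<open>D\<close> does not separate ties.
\<close>

section \<open>Series over a complete valued field\<close>

text \<open>Two obstacles shape the development. The axioms of a formal module are identities
  between nested power series, whereas the statement is about points; an evaluation homomorphism
  compatible with substitution carries the former to the latter. Secondly, the valuation of a sum is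
  only bounded below. What makes cancellation harmless is that \<open>\<eta>\<close> is increasing
  and that the bound \<open>v (\<pi> x) >= \<eta> (v x)\<close> is attained at
  \<open>\<pi>^-k e_i\<close> for k >= 2: a gain by cancellation survives multiplication by
  \<open>\<pi>\<close> and descends to a smaller denominator. In \<open>\<eta>\<close> the summand s
  belongs to the zero z = 0 of \<open>[\<pi>](T)\<close>, and \<open>min s (lam i)\<close> to the
  zeros of valuation \<open>lam i\<close>, since v(x - z) >= min (v x) (v z). The constant q^n
  appears because the weights of \<open>\<eta>\<close>, with that of z = 0, add up to q^n: up to the
  smallest slope \<open>\<eta>\<close> is multiplication by q^n. Hence all slope sequences are
  eventually geometric with the same ratio, and one period, from \<open>lam n\<close> to
  \<open>q^n * lam n\<close>, describes all small levels. The index n serves as the reference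
  because it carries the smallest slope.\<close>

locale complete_valued_field =
  fixes v :: "'k::field \<Rightarrow> ereal"
  assumes valuation: "valuation v" and complete: "vcomplete v"
begin

lemma v_eq_infty_iff [simp]: "v x = \<infinity> \<longleftrightarrow> x = 0"
  using valuation by (simp add: valuation_def)

lemma v_0 [simp]: "v 0 = \<infinity>"
  by simp

lemma v_not_minus_infty [simp]: "v x \<noteq> -\<infinity>"
  using valuation by (simp add: valuation_def)

lemma v_mult: "v (x * y) = v x + v y"
  using valuation by (simp add: valuation_def)

lemma v_cases: obtains "x = 0" | r where "v x = ereal r"
  by (cases "v x") auto

lemma v_add: "min (v x) (v y) \<le> v (x + y)"
  using valuation by (simp add: valuation_def)

lemma v_1 [simp]: "v 1 = 0"
proof -
  have "v 1 + v 1 = v 1"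
    using v_mult[of 1 1] by simp
  then show ?thesis
    by (cases "v 1") (auto simp: zero_ereal_def)
qed

lemma v_uminus [simp]: "v (- x) = v x"
proof -
  have "v (-1) + v (-1) = 0"
    using v_mult[of "-1" "-1"] by simp
  then have "v (-1) = 0"
    by (cases "v (-1)") (auto simp: zero_ereal_def)
  then show ?thesis
    using v_mult[of "-1" x] by simp
qed

lemma v_minus_commute: "v (x - y) = v (y - x)"
  using v_uminus[of "x - y"] by simp

lemma v_add_ge: "r \<le> v x \<Longrightarrow> r \<le> v y \<Longrightarrow> r \<le> v (x + y)"
  using v_add[of x y] by (meson min.boundedI order_trans)

lemma v_diff_ge: "r \<le> v x \<Longrightarrow> r \<le> v y \<Longrightarrow> r \<le> v (x - y)"
  using v_add_ge[of r x "-y"] by simp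

lemma v_add_gt: "r < v x \<Longrightarrow> r < v y \<Longrightarrow> r < v (x + y)"
  using v_add[of x y] by (meson min_less_iff_conj order_less_le_trans)

lemma v_add_eq: "v x < v y \<Longrightarrow> v (x + y) = v x"
proof -
  assume less: "v x < v y"
  have "v x \<le> v (x + y)"
    using less by (intro v_add_ge) auto
  moreover have "v (x + y) \<le> v x"
  proof (rule ccontr)
    assume "\<not> ?thesis"
    then have "v x < v (x + y + - y)"
      using less by (intro v_add_gt[of _ "x + y"]) auto
    then have "v x < v x"
      by simp
    then show False
      by blast
  qed
  ultimately show ?thesis
    by simp
qed

lemma v_sum_ge: "(\<And>i. i \<in> A \<Longrightarrow> r \<le> v (f i)) \<Longrightarrow> r \<le> v (sum f A)"
  by (induction A rule: infinite_finite_induct) (auto intro: v_add_ge)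

lemma v_mult_ge: "r \<le> v x \<Longrightarrow> 0 \<le> v y \<Longrightarrow> r \<le> v (x * y)"
  unfolding v_mult by (metis add.right_neutral add_mono)

lemma v_mult_nonneg: "0 \<le> v x \<Longrightarrow> 0 \<le> v y \<Longrightarrow> 0 \<le> v (x * y)"
  by (rule v_mult_ge)

lemma v_power_nonneg: "0 \<le> v x \<Longrightarrow> 0 \<le> v (x ^ n)"
  by (induction n) (auto intro: v_mult_nonneg)

lemma v_power_ge: "ereal r \<le> v x \<Longrightarrow> ereal (real n * r) \<le> v (x ^ n)"
proof (induction n)
  case (Suc n)
  have "ereal r + ereal (real n * r) \<le> v x + v (x ^ n)"
    using Suc by (intro add_mono) auto
  then show ?case
    by (simp add: v_mult algebra_simps)
qed auto

lemma v_inverse: "x \<noteq> 0 \<Longrightarrow> v (inverse x) = - v x"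
  using v_mult[of x "inverse x"]
  by (cases "v x"; cases "v (inverse x)") (auto simp: zero_ereal_def)

lemma vtendsto_iff:
  "vtendsto v u l \<longleftrightarrow> (\<forall>M::real. \<exists>N. \<forall>n\<ge>N. ereal M < v (u n - l))"
  unfolding vtendsto_def tendsto_PInfty eventually_sequentially ..

text \<open>\<open>vtendsto_iff\<close> works with real thresholds only; an infinite bound is
  reached by letting them grow.\<close>

lemma ereal_le_if_real_le:
  fixes r :: ereal
  assumes "\<And>M. ereal M \<le> r \<Longrightarrow> ereal M \<le> s" "r \<noteq> -\<infinity>"
  shows "r \<le> s"
proof (cases r)
  case PInf
  then show ?thesis
    using assms(1) by (simp add: ereal_top)
qed (use assms in auto)

lemma vtendsto_unique:
  assumes "vtendsto v u l" "vtendsto v u l'"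
  shows "l = l'"
proof -
  have "ereal M < v (l - l')" for M
  proof -
    obtain N N' where "\<forall>n\<ge>N. ereal M < v (u n - l)" "\<forall>n\<ge>N'. ereal M < v (u n - l')"
      using assms unfolding vtendsto_iff by blast
    then have "ereal M < v (l - u (max N N'))" "ereal M < v (u (max N N') - l')"
      by (auto simp: v_minus_commute)
    then show ?thesis
      using v_add_gt by fastforce
  qed
  then have "v (l - l') = \<infinity>"
    by (metis ereal_less_PInfty less_le_not_le linorder_cases ereal_dense2)
  then show ?thesis
    by simp
qed

lemma vlim_eqI: "vtendsto v u l \<Longrightarrow> vlim v u = l"
  unfolding vlim_def using vtendsto_unique by blast

lemma vtendsto_ge:
  assumes lim: "vtendsto v u l" and ge: "\<And>n. N \<le> n \<Longrightarrow> r \<le> v (u n)"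
  shows "r \<le> v l"
proof (cases "r = -\<infinity>")
  case False
  show ?thesis
  proof (rule ereal_le_if_real_le)
    fix M assume M: "ereal M \<le> r"
    obtain N' where N': "\<forall>n\<ge>N'. ereal M < v (u n - l)"
      using lim unfolding vtendsto_iff by blast
    have "ereal M \<le> v (u (max N N'))"
      using ge[of "max N N'"] M by simp
    moreover have "ereal M \<le> v (u (max N N') - l)"
      using N' by (simp add: less_imp_le)
    ultimately have "ereal M \<le> v (u (max N N') - (u (max N N') - l))"
      by (rule v_diff_ge)
    then show "ereal M \<le> v l"
      by simp
  qed (use False in auto)
qed auto

lemma vtendsto_diff_const:
  "vtendsto v u l \<Longrightarrow> vtendsto v (\<lambda>n. u n - c) (l - c)"
  by (simp add: vtendsto_iff)

lemma vtendsto_mult_const: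
  assumes "vtendsto v u l"
  shows "vtendsto v (\<lambda>n. u n * c) (l * c)"
proof (cases rule: v_cases[of c])
  case (2 r)
  show ?thesis
    unfolding vtendsto_iff
  proof
    fix M
    obtain N where N: "\<forall>n\<ge>N. ereal (M - r) < v (u n - l)"
      using assms unfolding vtendsto_iff by blast
    have "ereal M < v (u n * c - l * c)" if "n \<ge> N" for n
    proof -
      have "ereal (M - r) < v (u n - l)"
        using N that by blast
      then have "ereal M < v (u n - l) + v c"
        by (cases "v (u n - l)") (auto simp: 2)
      then show ?thesis
        by (simp add: v_mult[symmetric] algebra_simps)
    qed
    then show "\<exists>N. \<forall>n\<ge>N. ereal M < v (u n * c - l * c)"
      by blast
  qed
qed (simp add: vtendsto_iff)

lemma real_multiple_gt: "0 < (\<mu>::real) \<Longrightarrow> \<exists>N. \<forall>n\<ge>N. M < real n * \<mu>"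
  by (metis (no_types, opaque_lifting) dual_order.strict_trans1 ex_less_of_nat_mult
      mult_right_mono of_nat_le_iff less_imp_le)

text \<open>Identities between values of series are proved through this: both sides agree with the
  N-th truncation up to valuation \<open>N * \<mu>\<close>, where \<open>\<mu>\<close> is a positive
  lower bound for the valuations of the points.\<close>

lemma eq_if_v_diff_ge_multiples:
  assumes "0 < \<mu>" "\<And>N. ereal (real N * \<mu>) \<le> v (x - y)"
  shows "x = y"
proof -
  have "v (x - y) = \<infinity>"
  proof (rule ccontr)
    assume "v (x - y) \<noteq> \<infinity>"
    then obtain r where r: "v (x - y) = ereal r"
      by (cases "v (x - y)") auto
    obtain N where "r < real N * \<mu>"
      using real_multiple_gt[OF assms(1), of r] by blast
    then show False
      using assms(2)[of N] r by simp
  qed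
  then show ?thesis
    by simp
qed

text \<open>\<open>vlim\<close> is a definite description, so its use requires existence of the
  limit. The partial sums of integral series at points satisfy this linear Cauchy estimate.\<close>

lemma vtendsto_vlim_linear:
  assumes \<mu>: "0 < \<mu>" and u: "\<And>M N. N \<le> M \<Longrightarrow> ereal (real N * \<mu>) \<le> v (u M - u N)"
  shows "vtendsto v u (vlim v u)"
proof -
  have "vcauchy v u"
    unfolding vcauchy_def
  proof
    fix M
    obtain N where N: "M < real N * \<mu>"
      using real_multiple_gt[OF \<mu>, of M] by blast
    have "ereal M < v (u i - u j)" if "i \<ge> N" "j \<ge> N" for i j
    proof -
      have "ereal (real N * \<mu>) \<le> v (u i - u N - (u j - u N))"
        by (rule v_diff_ge) (use u that in auto)
      then have "ereal (real N * \<mu>) \<le> v (u i - u j)"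
        by simp
      then show ?thesis
        by (rule less_le_trans[rotated]) (use N in simp)
    qed
    then show "\<exists>N. \<forall>i\<ge>N. \<forall>j\<ge>N. ereal M < v (u i - u j)"
      by blast
  qed
  then show ?thesis
    using complete vlim_eqI unfolding vcomplete_def by metis
qed

lemma v_pos_obtain_real:
  assumes "0 < v x"
  obtains \<mu> where "0 < \<mu>" "ereal \<mu> \<le> v x"
  using assms by (cases "v x") (auto intro: that[of 1])

lemma v_pos_obtain_common:
  assumes "finite A" "\<And>x. x \<in> A \<Longrightarrow> 0 < v x"
  obtains \<mu> where "0 < \<mu>" "\<And>x. x \<in> A \<Longrightarrow> ereal \<mu> \<le> v x"
proof -
  have "\<exists>\<mu>>0. \<forall>x\<in>A. ereal \<mu> \<le> v x"
    using assms
  proof (induction A)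
    case (insert x A)
    then obtain \<mu> where \<mu>: "0 < \<mu>" "\<forall>x\<in>A. ereal \<mu> \<le> v x"
      by auto
    obtain \<nu> where \<nu>: "0 < \<nu>" "ereal \<nu> \<le> v x"
      using v_pos_obtain_real insert.prems by blast
    have "\<forall>y\<in>insert x A. ereal (min \<mu> \<nu>) \<le> v y"
      using \<mu> \<nu> by (metis ereal_less_eq(3) insert_iff min.cobounded1 min.cobounded2 order_trans)
    then show ?case
      using \<mu>(1) \<nu>(1) by (metis min_less_iff_conj)
  qed (auto intro: exI[of _ 1])
  then show ?thesis
    using that by blast
qed

section \<open>Integral power series and their values\<close>

definition integral_fps :: "'k fps \<Rightarrow> bool" where
  "integral_fps f \<longleftrightarrow> (\<forall>i. 0 \<le> v (fps_nth f i))"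

definition ev :: "'k \<Rightarrow> 'k fps \<Rightarrow> 'k" where
  "ev x f = vlim v (\<lambda>N. \<Sum>i<N. fps_nth f i * x ^ i)"

lemma integral_fps_simps [simp, intro]:
  "integral_fps 0" "integral_fps 1" "integral_fps fps_X"
  by (auto simp: integral_fps_def fps_X_def)

lemma integral_fps_const [simp]: "integral_fps (fps_const c) \<longleftrightarrow> 0 \<le> v c"
  by (auto simp: integral_fps_def)

lemma integral_fps_add: "integral_fps f \<Longrightarrow> integral_fps g \<Longrightarrow> integral_fps (f + g)"
  by (auto simp: integral_fps_def intro: v_add_ge)

lemma integral_fps_mult: "integral_fps f \<Longrightarrow> integral_fps g \<Longrightarrow> integral_fps (f * g)"
  by (auto simp: integral_fps_def fps_mult_nth intro!: v_sum_ge v_mult_nonneg)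

lemma v_term_ge:
  assumes "integral_fps f" "ereal \<mu> \<le> v x"
  shows "ereal (real i * \<mu>) \<le> v (fps_nth f i * x ^ i)"
proof -
  have "ereal (real i * \<mu>) \<le> v (x ^ i * fps_nth f i)"
    using assms by (intro v_mult_ge v_power_ge) (auto simp: integral_fps_def)
  then show ?thesis
    by (simp only: mult.commute)
qed

lemma sum_lessThan_diff:
  fixes f :: "nat \<Rightarrow> 'k"
  shows "N \<le> M \<Longrightarrow> sum f {..<M} - sum f {..<N} = sum f {N..<M}"
proof -
  assume "N \<le> M"
  then have "sum f {..<M} = sum f {..<N} + sum f {N..<M}"
    using sum.atLeastLessThan_concat[of 0 N M f] by (simp add: atLeast0LessThan)
  then show ?thesis
    by simp
qed

lemma ev_tendsto:
  assumes f: "integral_fps f" and x: "0 < v x"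
  shows "vtendsto v (\<lambda>N. \<Sum>i<N. fps_nth f i * x ^ i) (ev x f)"
proof -
  obtain \<mu> where \<mu>: "0 < \<mu>" "ereal \<mu> \<le> v x"
    using v_pos_obtain_real[OF x] .
  have "ereal (real N * \<mu>) \<le> v ((\<Sum>i<M. fps_nth f i * x ^ i) - (\<Sum>i<N. fps_nth f i * x ^ i))"
    if "N \<le> M" for M N
    unfolding sum_lessThan_diff[OF that]
  proof (rule v_sum_ge)
    fix i assume "i \<in> {N..<M}"
    then have "ereal (real N * \<mu>) \<le> ereal (real i * \<mu>)"
      using \<mu> by auto
    also have "\<dots> \<le> v (fps_nth f i * x ^ i)"
      by (rule v_term_ge[OF f \<mu>(2)])
    finally show "ereal (real N * \<mu>) \<le> v (fps_nth f i * x ^ i)" .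
  qed
  then show ?thesis
    unfolding ev_def by (rule vtendsto_vlim_linear[OF \<mu>(1)])
qed

text \<open>The spare factor \<open>c\<close> carries the monomial in the variables evaluated later,
  so that the bound can be iterated in several variables.\<close>

lemma v_ev_tail_ge:
  assumes f: "integral_fps f" and x: "0 < v x"
    and ge: "\<And>i. N \<le> i \<Longrightarrow> r \<le> v (fps_nth f i * x ^ i * c)"
  shows "r \<le> v ((ev x f - (\<Sum>i<N. fps_nth f i * x ^ i)) * c)"
proof (rule vtendsto_ge[where N = N])
  show "vtendsto v (\<lambda>M. ((\<Sum>i<M. fps_nth f i * x ^ i) - (\<Sum>i<N. fps_nth f i * x ^ i)) * c)
      ((ev x f - (\<Sum>i<N. fps_nth f i * x ^ i)) * c)"
    by (intro vtendsto_mult_const vtendsto_diff_const ev_tendsto f x)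
  show "r \<le> v (((\<Sum>i<M. fps_nth f i * x ^ i) - (\<Sum>i<N. fps_nth f i * x ^ i)) * c)"
    if "N \<le> M" for M
    unfolding sum_lessThan_diff[OF that] sum_distrib_right
    by (rule v_sum_ge) (use ge in auto)
qed

lemma v_ev_mult_ge:
  assumes "integral_fps f" "0 < v x" "\<And>i. r \<le> v (fps_nth f i * x ^ i * c)"
  shows "r \<le> v (ev x f * c)"
  using v_ev_tail_ge[OF assms(1,2), where N = 0] assms(3) by simp

lemma v_ev_ge:
  assumes "integral_fps f" "0 < v x" "\<And>i. r \<le> v (fps_nth f i * x ^ i)"
  shows "r \<le> v (ev x f)"
  using v_ev_mult_ge[OF assms(1,2), where c = 1] assms(3) by simp

lemma v_ev_nonneg: "integral_fps f \<Longrightarrow> 0 < v x \<Longrightarrow> 0 \<le> v (ev x f)"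
  by (rule v_ev_ge) (auto simp: integral_fps_def intro!: v_mult_nonneg v_power_nonneg)

lemma v_ev_truncate:
  assumes "integral_fps f" "0 < \<mu>" "ereal \<mu> \<le> v x"
  shows "ereal (real N * \<mu>) \<le> v (ev x f - (\<Sum>i<N. fps_nth f i * x ^ i))"
proof -
  have "0 < v x"
    using assms by (metis ereal_less(2) less_le_trans)
  moreover have "ereal (real N * \<mu>) \<le> v (fps_nth f i * x ^ i * 1)" if "N \<le> i" for i
  proof -
    have "ereal (real N * \<mu>) \<le> ereal (real i * \<mu>)"
      using assms that by auto
    also have "\<dots> \<le> v (fps_nth f i * x ^ i)"
      by (rule v_term_ge[OF assms(1,3)])
    finally show ?thesis
      by simp
  qed
  ultimately show ?thesis
    using v_ev_tail_ge[OF assms(1), where c = 1] by simp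
qed

lemma ev_eqI:
  assumes "integral_fps f" "0 < \<mu>" "ereal \<mu> \<le> v x"
    and "\<And>N. ereal (real N * \<mu>) \<le> v (l - (\<Sum>i<N. fps_nth f i * x ^ i))"
  shows "ev x f = l"
proof (rule eq_if_v_diff_ge_multiples[OF assms(2)])
  fix N
  show "ereal (real N * \<mu>) \<le> v (ev x f - l)"
    using v_diff_ge[OF v_ev_truncate[OF assms(1-3), of N] assms(4)[of N]] by simp
qed

lemma ev_add:
  assumes "integral_fps f" "integral_fps g" "0 < v x"
  shows "ev x (f + g) = ev x f + ev x g"
proof -
  obtain \<mu> where \<mu>: "0 < \<mu>" "ereal \<mu> \<le> v x"
    using v_pos_obtain_real[OF assms(3)] .
  show ?thesis
  proof (rule ev_eqI[OF integral_fps_add[OF assms(1,2)] \<mu>])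
    fix N
    have eq: "ev x f + ev x g - (\<Sum>i<N. fps_nth (f + g) i * x ^ i)
        = (ev x f - (\<Sum>i<N. fps_nth f i * x ^ i)) + (ev x g - (\<Sum>i<N. fps_nth g i * x ^ i))"
      by (simp add: algebra_simps sum.distrib)
    show "ereal (real N * \<mu>) \<le> v (ev x f + ev x g - (\<Sum>i<N. fps_nth (f + g) i * x ^ i))"
      unfolding eq
      by (rule v_add_ge[OF v_ev_truncate[OF assms(1) \<mu>] v_ev_truncate[OF assms(2) \<mu>]])
  qed
qed

text \<open>What remains is the square of index pairs minus the triangle; there i + j >= N, so the
  remainder is small at points.\<close>

lemma sum_product_truncate:
  fixes f g :: "'k fps"
  shows "(\<Sum>i<N. fps_nth f i * x ^ i) * (\<Sum>j<N. fps_nth g j * x ^ j)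
       - (\<Sum>k<N. fps_nth (f * g) k * x ^ k)
       = (\<Sum>(i, j)\<in>{..<N} \<times> {..<N} - {(i, j). i + j < N}. fps_nth f i * fps_nth g j * x ^ (i + j))"
proof -
  let ?h = "\<lambda>(i, j). fps_nth f i * fps_nth g j * x ^ (i + j)"
  have "(\<Sum>k<N. fps_nth (f * g) k * x ^ k) = (\<Sum>k<N. \<Sum>i\<le>k. ?h (i, k - i))"
    by (intro sum.cong refl) (auto simp: fps_mult_nth sum_distrib_right atLeast0AtMost intro!: sum.cong)
  also have "\<dots> = sum ?h {(i, j). i + j < N}"
    using sum.triangle_reindex[of "\<lambda>i j. ?h (i, j)" N] by (simp add: split_def)
  finally have *: "(\<Sum>k<N. fps_nth (f * g) k * x ^ k) = sum ?h {(i, j). i + j < N}" .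
  have "(\<Sum>i<N. fps_nth f i * x ^ i) * (\<Sum>j<N. fps_nth g j * x ^ j) = sum ?h ({..<N} \<times> {..<N})"
    by (simp add: sum_product sum.cartesian_product[symmetric] power_add mult_ac)
  moreover have "sum ?h ({..<N} \<times> {..<N} - {(i, j). i + j < N})
      = sum ?h ({..<N} \<times> {..<N}) - sum ?h {(i, j). i + j < N}"
    by (rule sum_diff) auto
  ultimately show ?thesis
    using * by simp
qed

lemma ev_mult:
  assumes "integral_fps f" "integral_fps g" "0 < v x"
  shows "ev x (f * g) = ev x f * ev x g"
proof -
  obtain \<mu> where \<mu>: "0 < \<mu>" "ereal \<mu> \<le> v x"
    using v_pos_obtain_real[OF assms(3)] .
  show ?thesis
  proof (rule ev_eqI[OF integral_fps_mult[OF assms(1,2)] \<mu>])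
    fix N
    let ?F = "\<Sum>i<N. fps_nth f i * x ^ i" and ?G = "\<Sum>i<N. fps_nth g i * x ^ i"
    \<comment> \<open>Three errors: truncating f, truncating g, and truncating the product of the
      two polynomials.\<close>
    have eq: "ev x f * ev x g - (\<Sum>i<N. fps_nth (f * g) i * x ^ i)
        = (ev x f - ?F) * ev x g + (ev x g - ?G) * ?F
          + (?F * ?G - (\<Sum>k<N. fps_nth (f * g) k * x ^ k))"
      by (simp add: algebra_simps)
    have nonneg: "0 \<le> v x"
      using assms(3) by simp
    have F: "0 \<le> v ?F"
      using assms(1) nonneg
      by (auto intro!: v_sum_ge v_mult_nonneg v_power_nonneg simp: integral_fps_def)
    have "ereal (real N * \<mu>) \<le> v (?F * ?G - (\<Sum>k<N. fps_nth (f * g) k * x ^ k))"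
      unfolding sum_product_truncate
    proof (rule v_sum_ge, clarsimp)
      fix i j assume "\<not> i + j < N"
      then have "ereal (real N * \<mu>) \<le> ereal (real (i + j) * \<mu>)"
        using \<mu> by auto
      also have "\<dots> \<le> v (x ^ (i + j) * (fps_nth f i * fps_nth g j))"
        using assms v_power_ge[OF \<mu>(2), of "i + j"]
        by (intro v_mult_ge v_mult_nonneg) (auto simp: integral_fps_def)
      finally show "ereal (real N * \<mu>) \<le> v (fps_nth f i * fps_nth g j * x ^ (i + j))"
        by (simp add: mult_ac)
    qed
    then show "ereal (real N * \<mu>) \<le> v (ev x f * ev x g - (\<Sum>i<N. fps_nth (f * g) i * x ^ i))"
      unfolding eq using F v_ev_nonneg[OF assms(2,3)]
      by (intro v_add_ge v_mult_ge v_ev_truncate assms \<mu>)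
  qed
qed

lemma ev_const [simp]:
  assumes "0 \<le> v c" "0 < v x"
  shows "ev x (fps_const c) = c"
proof -
  obtain \<mu> where \<mu>: "0 < \<mu>" "ereal \<mu> \<le> v x"
    using v_pos_obtain_real[OF assms(2)] .
  show ?thesis
  proof (rule ev_eqI[OF _ \<mu>])
    fix N
    have "(\<Sum>i<N. fps_nth (fps_const c) i * x ^ i) = (\<Sum>i<N. if i = 0 then c else 0)"
      by (intro sum.cong) auto
    then show "ereal (real N * \<mu>) \<le> v (c - (\<Sum>i<N. fps_nth (fps_const c) i * x ^ i))"
      using assms by (cases "N = 0") (auto simp: zero_ereal_def[symmetric])
  qed (use assms in auto)
qed

lemma ev_0 [simp]: "0 < v x \<Longrightarrow> ev x 0 = 0"
  using ev_const[of 0 x] by simp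

lemma ev_1 [simp]: "0 < v x \<Longrightarrow> ev x 1 = 1"
  using ev_const[of 1 x] by simp

lemma ev_X [simp]:
  assumes "0 < v x"
  shows "ev x fps_X = x"
proof -
  obtain \<mu> where \<mu>: "0 < \<mu>" "ereal \<mu> \<le> v x"
    using v_pos_obtain_real[OF assms] .
  show ?thesis
  proof (rule ev_eqI[OF _ \<mu>])
    fix N
    have "(\<Sum>i<N. fps_nth fps_X i * x ^ i) = (\<Sum>i<N. if i = 1 then x else 0)"
      by (intro sum.cong) (auto simp: fps_X_def)
    also have "\<dots> = (if 1 < N then x else 0)"
      by simp
    finally have "x - (\<Sum>i<N. fps_nth fps_X i * x ^ i) = (if 1 < N then 0 else x)"
      by simp
    moreover have "real N * \<mu> \<le> \<mu>" if "\<not> 1 < N"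
      using that \<mu> by (cases N) auto
    ultimately show "ereal (real N * \<mu>) \<le> v (x - (\<Sum>i<N. fps_nth fps_X i * x ^ i))"
      using \<mu>(2) by (auto intro: order_trans[where y = "ereal \<mu>"])
  qed auto
qed


section \<open>Evaluation of power series in three variables\<close>

definition integral_mps :: "'k mps \<Rightarrow> bool" where
  "integral_mps A \<longleftrightarrow> (\<forall>d b a. 0 \<le> v (fps_nth (fps_nth (fps_nth A d) b) a))"

text \<open>Evaluation follows the nesting of \<open>mps\<close>, with X innermost and Z outermost.
  Each stage leaves an integral series, so the one-variable results apply three times.\<close>

definition ev2 :: "'k \<Rightarrow> 'k \<Rightarrow> 'k fps fps \<Rightarrow> 'k" where
  "ev2 x y A = ev y (Abs_fps (\<lambda>b. ev x (fps_nth A b)))"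

definition ev3 :: "'k \<Rightarrow> 'k \<Rightarrow> 'k \<Rightarrow> 'k mps \<Rightarrow> 'k" where
  "ev3 x y z A = ev z (Abs_fps (\<lambda>d. ev2 x y (fps_nth A d)))"

text \<open>This is the filtration by total degree, which the nested type does not display; it
  controls how small the value at a point is.\<close>

definition order_ge :: "nat \<Rightarrow> 'k mps \<Rightarrow> bool" where
  "order_ge k A \<longleftrightarrow> (\<forall>d b a. a + b + d < k \<longrightarrow> fps_nth (fps_nth (fps_nth A d) b) a = 0)"

abbreviation integral_fps2 :: "'k fps fps \<Rightarrow> bool" where
  "integral_fps2 A \<equiv> \<forall>b. integral_fps (fps_nth A b)"

lemma integral_mps_iff: "integral_mps A \<longleftrightarrow> (\<forall>d. integral_fps2 (fps_nth A d))"
  by (auto simp: integral_mps_def integral_fps_def)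

lemma integral_fps2_coeffs:
  "integral_fps2 A \<Longrightarrow> 0 < v x \<Longrightarrow> integral_fps (Abs_fps (\<lambda>b. ev x (fps_nth A b)))"
  unfolding integral_fps_def[of "Abs_fps _"] by (auto intro: v_ev_nonneg)

lemma v_ev2_nonneg: "integral_fps2 A \<Longrightarrow> 0 < v x \<Longrightarrow> 0 < v y \<Longrightarrow> 0 \<le> v (ev2 x y A)"
  unfolding ev2_def by (intro v_ev_nonneg integral_fps2_coeffs)

lemma integral_mps_coeffs:
  "integral_mps A \<Longrightarrow> 0 < v x \<Longrightarrow> 0 < v y \<Longrightarrow>
    integral_fps (Abs_fps (\<lambda>d. ev2 x y (fps_nth A d)))"
  unfolding integral_fps_def[of "Abs_fps _"] by (auto simp: integral_mps_iff intro: v_ev2_nonneg)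

lemma integral_fps_sum:
  "(\<And>i. i \<in> I \<Longrightarrow> integral_fps (f i)) \<Longrightarrow> integral_fps (sum f I)"
  by (induction I rule: infinite_finite_induct) (auto intro: integral_fps_add)

lemma ev_sum:
  assumes "0 < v x" "\<And>i. i \<in> I \<Longrightarrow> integral_fps (f i)"
  shows "ev x (sum f I) = (\<Sum>i\<in>I. ev x (f i))"
  using assms(2) by (induction I rule: infinite_finite_induct)
    (auto simp: assms(1) ev_add integral_fps_sum)

lemma integral_fps2_mult: "integral_fps2 A \<Longrightarrow> integral_fps2 B \<Longrightarrow> integral_fps2 (A * B)"
  by (auto simp: fps_mult_nth intro: integral_fps_sum integral_fps_mult)

lemma ev2_add:
  assumes "integral_fps2 A" "integral_fps2 B" "0 < v x" "0 < v y"
  shows "ev2 x y (A + B) = ev2 x y A + ev2 x y B"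
proof -
  have "Abs_fps (\<lambda>b. ev x (fps_nth (A + B) b))
      = Abs_fps (\<lambda>b. ev x (fps_nth A b)) + Abs_fps (\<lambda>b. ev x (fps_nth B b))"
    using assms by (auto simp: fps_eq_iff ev_add)
  then show ?thesis
    unfolding ev2_def using assms by (simp add: ev_add integral_fps2_coeffs)
qed

lemma ev2_mult:
  assumes "integral_fps2 A" "integral_fps2 B" "0 < v x" "0 < v y"
  shows "ev2 x y (A * B) = ev2 x y A * ev2 x y B"
proof -
  have "Abs_fps (\<lambda>b. ev x (fps_nth (A * B) b))
      = Abs_fps (\<lambda>b. ev x (fps_nth A b)) * Abs_fps (\<lambda>b. ev x (fps_nth B b))"
    using assms by (auto simp: fps_eq_iff fps_mult_nth ev_sum ev_mult integral_fps_mult)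
  then show ?thesis
    unfolding ev2_def using assms by (simp add: ev_mult integral_fps2_coeffs)
qed

lemma ev2_const: "integral_fps f \<Longrightarrow> 0 < v x \<Longrightarrow> 0 < v y \<Longrightarrow> ev2 x y (fps_const f) = ev x f"
proof -
  assume *: "integral_fps f" "0 < v x" "0 < v y"
  have "Abs_fps (\<lambda>b. ev x (fps_nth (fps_const f) b)) = fps_const (ev x f)"
    using * by (auto simp: fps_eq_iff)
  then show ?thesis
    using * by (simp add: ev2_def v_ev_nonneg)
qed

lemma ev2_sum:
  assumes "0 < v x" "0 < v y" "\<And>i. i \<in> I \<Longrightarrow> integral_fps2 (f i)"
  shows "ev2 x y (sum f I) = (\<Sum>i\<in>I. ev2 x y (f i))"
  using assms(3)
proof (induction I rule: infinite_finite_induct)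
  case (insert i I)
  then have "integral_fps2 (sum f I)"
    by (auto simp: fps_sum_nth intro: integral_fps_sum)
  with insert show ?case
    by (simp add: ev2_add assms)
qed (use assms ev2_const[of 0] in auto)

lemma integral_mps_add: "integral_mps A \<Longrightarrow> integral_mps B \<Longrightarrow> integral_mps (A + B)"
  by (auto simp: integral_mps_def intro: v_add_ge)

lemma integral_mps_mult: "integral_mps A \<Longrightarrow> integral_mps B \<Longrightarrow> integral_mps (A * B)"
  by (auto simp: integral_mps_iff fps_mult_nth[of A] fps_sum_nth
      intro!: integral_fps_sum integral_fps2_mult[rule_format])

lemma ev3_add:
  assumes "integral_mps A" "integral_mps B" "0 < v x" "0 < v y" "0 < v z"
  shows "ev3 x y z (A + B) = ev3 x y z A + ev3 x y z B"
proof -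
  have "Abs_fps (\<lambda>d. ev2 x y (fps_nth (A + B) d))
      = Abs_fps (\<lambda>d. ev2 x y (fps_nth A d)) + Abs_fps (\<lambda>d. ev2 x y (fps_nth B d))"
    using assms by (auto simp: fps_eq_iff ev2_add integral_mps_iff)
  then show ?thesis
    unfolding ev3_def using assms by (simp add: ev_add integral_mps_coeffs)
qed

lemma ev3_mult:
  assumes "integral_mps A" "integral_mps B" "0 < v x" "0 < v y" "0 < v z"
  shows "ev3 x y z (A * B) = ev3 x y z A * ev3 x y z B"
proof -
  have "integral_fps2 (fps_nth A i * fps_nth B j)" for i j
    using assms by (intro integral_fps2_mult) (auto simp: integral_mps_iff)
  then have "Abs_fps (\<lambda>d. ev2 x y (fps_nth (A * B) d))
      = Abs_fps (\<lambda>d. ev2 x y (fps_nth A d)) * Abs_fps (\<lambda>d. ev2 x y (fps_nth B d))"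
    using assms
    by (auto simp: fps_eq_iff fps_mult_nth[of A] fps_mult_nth[of "Abs_fps _"] ev2_sum ev2_mult integral_mps_iff)
  then show ?thesis
    unfolding ev3_def using assms by (simp add: ev_mult integral_mps_coeffs)
qed

lemma ev3_const:
  assumes "integral_fps2 A" "0 < v x" "0 < v y" "0 < v z"
  shows "ev3 x y z (fps_const A) = ev2 x y A"
proof -
  have "Abs_fps (\<lambda>b. ev2 x y (fps_nth (fps_const A) b)) = fps_const (ev2 x y A)"
    using assms ev2_const[of 0 x y] by (auto simp: fps_eq_iff)
  then show ?thesis
    using assms by (simp add: ev3_def v_ev2_nonneg)
qed

lemma ev3_varX [simp]: "0 < v x \<Longrightarrow> 0 < v y \<Longrightarrow> 0 < v z \<Longrightarrow> ev3 x y z varX = x"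
  unfolding varX_def by (subst ev3_const) (auto simp: ev2_const)

lemma ev3_varY [simp]: "0 < v x \<Longrightarrow> 0 < v y \<Longrightarrow> 0 < v z \<Longrightarrow> ev3 x y z varY = y"
proof -
  assume *: "0 < v x" "0 < v y" "0 < v z"
  have "Abs_fps (\<lambda>b. ev x (fps_nth fps_X b)) = fps_X"
    using * by (auto simp: fps_eq_iff fps_X_def)
  then show ?thesis
    unfolding varY_def using * by (subst ev3_const) (auto simp: ev2_def)
qed

lemma ev3_varZ [simp]: "0 < v x \<Longrightarrow> 0 < v y \<Longrightarrow> 0 < v z \<Longrightarrow> ev3 x y z varZ = z"
proof -
  assume *: "0 < v x" "0 < v y" "0 < v z"
  have "Abs_fps (\<lambda>b. ev2 x y (fps_nth fps_X b)) = fps_X"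
    using * ev2_const[of 0 x y] ev2_const[of 1 x y] by (auto simp: fps_eq_iff fps_X_def)
  then show ?thesis
    unfolding varZ_def ev3_def using * by simp
qed

lemma integral_mps_var [simp]: "integral_mps varX" "integral_mps varY" "integral_mps varZ"
  by (auto simp: integral_mps_def varX_def varY_def varZ_def fps_X_def)

lemma order_ge_var: "order_ge 1 varX" "order_ge 1 varY" "order_ge 1 varZ"
  by (auto simp: order_ge_def varX_def varY_def varZ_def)

lemma integral_mps_0 [simp]: "integral_mps 0"
  by (auto simp: integral_mps_def)

lemma integral_mps_1 [simp]: "integral_mps 1"
  by (auto simp: integral_mps_def)

lemma order_ge_0 [simp]: "order_ge k 0"
  by (auto simp: order_ge_def)

lemma ev3_0 [simp]: "0 < v x \<Longrightarrow> 0 < v y \<Longrightarrow> 0 < v z \<Longrightarrow> ev3 x y z 0 = 0"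
  using ev3_const[of 0 x y z] ev2_const[of 0 x y] by auto

lemma ev3_1 [simp]: "0 < v x \<Longrightarrow> 0 < v y \<Longrightarrow> 0 < v z \<Longrightarrow> ev3 x y z 1 = 1"
  using ev3_const[of 1 x y z] ev2_const[of 1 x y] by auto

lemma integral_mps_power: "integral_mps A \<Longrightarrow> integral_mps (A ^ i)"
  by (induction i) (auto intro: integral_mps_mult)

lemma ev3_power:
  assumes "integral_mps A" "0 < v x" "0 < v y" "0 < v z"
  shows "ev3 x y z (A ^ i) = ev3 x y z A ^ i"
  by (induction i) (auto simp: assms ev3_mult integral_mps_power)

lemma integral_mps_sum: "(\<And>i. i \<in> I \<Longrightarrow> integral_mps (f i)) \<Longrightarrow> integral_mps (sum f I)"
  by (induction I rule: infinite_finite_induct) (auto intro: integral_mps_add)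

lemma ev3_sum:
  assumes "0 < v x" "0 < v y" "0 < v z" "\<And>i. i \<in> I \<Longrightarrow> integral_mps (f i)"
  shows "ev3 x y z (sum f I) = (\<Sum>i\<in>I. ev3 x y z (f i))"
  using assms(4) by (induction I rule: infinite_finite_induct)
    (auto simp: assms(1-3) ev3_add integral_mps_sum)

definition mps_const :: "'k \<Rightarrow> 'k mps" where
  "mps_const c = fps_const (fps_const (fps_const c))"

lemma integral_mps_const: "0 \<le> v c \<Longrightarrow> integral_mps (mps_const c)"
  by (auto simp: integral_mps_def mps_const_def)

lemma ev3_mps_const:
  "0 \<le> v c \<Longrightarrow> 0 < v x \<Longrightarrow> 0 < v y \<Longrightarrow> 0 < v z \<Longrightarrow> ev3 x y z (mps_const c) = c"
  unfolding mps_const_def by (subst ev3_const) (auto simp: ev2_const)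

lemma v_ev3_ge:
  assumes A: "integral_mps A" and xyz: "0 < v x" "0 < v y" "0 < v z"
    and ge: "\<And>d b a. r \<le> v (fps_nth (fps_nth (fps_nth A d) b) a * x ^ a * y ^ b * z ^ d)"
  shows "r \<le> v (ev3 x y z A)"
  unfolding ev3_def
proof (rule v_ev_ge[OF integral_mps_coeffs[OF A xyz(1,2)] xyz(3)], simp add: ev2_def)
  fix d
  have A': "integral_fps2 (fps_nth A d)"
    using A by (simp add: integral_mps_iff)
  show "r \<le> v (ev y (Abs_fps (\<lambda>b. ev x (fps_nth (fps_nth A d) b))) * z ^ d)"
  proof (rule v_ev_mult_ge[OF integral_fps2_coeffs[OF A' xyz(1)] xyz(2)], simp)
    fix b
    have "r \<le> v (ev x (fps_nth (fps_nth A d) b) * (y ^ b * z ^ d))"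
      using A' xyz ge[where d = d and b = b] by (intro v_ev_mult_ge) (auto simp: mult_ac)
    then show "r \<le> v (ev x (fps_nth (fps_nth A d) b) * y ^ b * z ^ d)"
      by (simp add: mult_ac)
  qed
qed

text \<open>Every surviving monomial has total degree at least k, hence a value of valuation at
  least \<open>k * \<mu>\<close>, and limits keep the bound.\<close>

lemma v_ev3_order_ge:
  assumes A: "integral_mps A" "order_ge k A"
    and \<mu>: "0 < \<mu>" "ereal \<mu> \<le> v x" "ereal \<mu> \<le> v y" "ereal \<mu> \<le> v z"
  shows "ereal (real k * \<mu>) \<le> v (ev3 x y z A)"
proof (rule v_ev3_ge[OF A(1)])
  show "0 < v x" "0 < v y" "0 < v z"
    using \<mu> by (metis ereal_less(2) less_le_trans)+
  fix d b a
  let ?c = "fps_nth (fps_nth (fps_nth A d) b) a"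
  show "ereal (real k * \<mu>) \<le> v (?c * x ^ a * y ^ b * z ^ d)"
  proof (cases "a + b + d < k")
    case True
    then have "?c = 0"
      using A(2) unfolding order_ge_def by blast
    then show ?thesis
      by simp
  next
    case False
    then have "ereal (real k * \<mu>) \<le> ereal (real (a + b + d) * \<mu>)"
      using \<mu> by auto
    also have "\<dots> = ereal (real a * \<mu>) + (ereal (real b * \<mu>) + ereal (real d * \<mu>))"
      by (simp add: algebra_simps)
    also have "\<dots> \<le> v (x ^ a) + (v (y ^ b) + v (z ^ d))"
      using \<mu> by (intro add_mono v_power_ge)
    also have "\<dots> = v (x ^ a * (y ^ b * z ^ d))"
      by (simp add: v_mult)
    also have "\<dots> \<le> v (x ^ a * (y ^ b * z ^ d) * ?c)"
      using A(1) by (intro v_mult_ge[OF order_refl]) (auto simp: integral_mps_def)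
    finally show ?thesis
      by (simp add: mult_ac)
  qed
qed

section \<open>Substitution of series and its compatibility with evaluation\<close>

lemma order_ge_mult:
  assumes "order_ge k A" "order_ge l B"
  shows "order_ge (k + l) (A * B)"
  unfolding order_ge_def
proof (intro allI impI)
  fix d b a assume less: "a + b + d < k + l"
  have "fps_nth (fps_nth (fps_nth A d') b') a' *
      fps_nth (fps_nth (fps_nth B (d - d')) (b - b')) (a - a') = 0"
    if "d' \<le> d" "b' \<le> b" "a' \<le> a" for d' b' a'
  proof (cases "a' + b' + d' < k")
    case False
    then have "(a - a') + (b - b') + (d - d') < l"
      using that less by linarith
    then show ?thesis
      using assms(2) by (auto simp: order_ge_def)
  qed (use assms(1) in \<open>auto simp: order_ge_def\<close>)
  then show "fps_nth (fps_nth (fps_nth (A * B) d) b) a = 0"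
    by (auto simp: fps_mult_nth fps_sum_nth intro!: sum.neutral)
qed

lemma order_ge_power: "order_ge 1 A \<Longrightarrow> order_ge i (A ^ i)"
proof (induction i)
  case (Suc i)
  then show ?case
    using order_ge_mult[of 1 A i "A ^ i"] by simp
qed (auto simp: order_ge_def)

definition eval2 :: "(nat \<Rightarrow> nat \<Rightarrow> 'k) \<Rightarrow> 'k \<Rightarrow> 'k \<Rightarrow> 'k" where
  "eval2 c x y = vlim v (\<lambda>N. \<Sum>i<N. \<Sum>j<N. c i j * x ^ i * y ^ j)"

lemma v_term2_ge:
  assumes c: "0 \<le> v (c i j)" and \<mu>: "0 < \<mu>" "ereal \<mu> \<le> v x" "ereal \<mu> \<le> v y"
    and "N \<le> i + j"
  shows "ereal (real N * \<mu>) \<le> v (c i j * x ^ i * y ^ j)"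
proof -
  have "ereal (real N * \<mu>) \<le> ereal (real (i + j) * \<mu>)"
    using assms by auto
  also have "\<dots> = ereal (real i * \<mu>) + ereal (real j * \<mu>)"
    by (simp add: algebra_simps)
  also have "\<dots> \<le> v (x ^ i) + v (y ^ j)"
    using \<mu> by (intro add_mono v_power_ge)
  also have "\<dots> = v (x ^ i * y ^ j)"
    by (simp add: v_mult)
  also have "\<dots> \<le> v (x ^ i * y ^ j * c i j)"
    by (rule v_mult_ge[OF order_refl c])
  finally show ?thesis
    by (simp add: mult_ac)
qed

lemma eval2_tendsto:
  assumes c: "\<And>i j. 0 \<le> v (c i j)" and \<mu>: "0 < \<mu>" "ereal \<mu> \<le> v x" "ereal \<mu> \<le> v y"
  shows "vtendsto v (\<lambda>N. \<Sum>i<N. \<Sum>j<N. c i j * x ^ i * y ^ j) (eval2 c x y)" (is ?lim)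
    and "ereal (real N * \<mu>) \<le> v (eval2 c x y - (\<Sum>i<N. \<Sum>j<N. c i j * x ^ i * y ^ j))"
proof -
  let ?u = "\<lambda>N. \<Sum>i<N. \<Sum>j<N. c i j * x ^ i * y ^ j"
  let ?h = "\<lambda>(i, j). c i j * x ^ i * y ^ j"
  have u: "ereal (real N * \<mu>) \<le> v (?u M - ?u N)" if "N \<le> M" for M N
  proof -
    have "?u M - ?u N = sum ?h ({..<M} \<times> {..<M}) - sum ?h ({..<N} \<times> {..<N})"
      by (simp add: sum.cartesian_product)
    also have "\<dots> = sum ?h ({..<M} \<times> {..<M} - {..<N} \<times> {..<N})"
      using that by (intro sum_diff[symmetric]) auto
    finally show ?thesis
      using c \<mu> by (auto intro!: v_sum_ge v_term2_ge)
  qed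
  show lim: ?lim
    unfolding eval2_def by (rule vtendsto_vlim_linear[OF \<mu>(1) u])
  show "ereal (real N * \<mu>) \<le> v (eval2 c x y - ?u N)"
    by (rule vtendsto_ge[OF vtendsto_diff_const[OF lim] u])
qed

lemma integral_mps_subst2:
  assumes "\<And>i j. 0 \<le> v (c i j)" "integral_mps A" "integral_mps B"
  shows "integral_mps (subst2 c A B)"
proof -
  have "integral_mps (A ^ i * B ^ j)" for i j
    using assms by (intro integral_mps_mult integral_mps_power)
  then show ?thesis
    using assms(1) unfolding integral_mps_def subst2_def
    by (auto intro!: v_sum_ge v_mult_nonneg)
qed

lemma order_ge_subst2: "c 0 0 = 0 \<Longrightarrow> order_ge 1 (subst2 c A B)"
  by (auto simp: order_ge_def subst2_def)

lemma mps_const_mult_nth [simp]: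
  "fps_nth (fps_nth (fps_nth (mps_const c * A) d) b) a = c * fps_nth (fps_nth (fps_nth A d) b) a"
  by (simp add: mps_const_def)

text \<open>\<open>subst2\<close> cuts the sums for each coefficient at its total degree. As
  \<open>A ^ i * B ^ j\<close> has order at least i + j, the uniform cut at N gives the same
  coefficients in all degrees below N.\<close>

lemma order_ge_subst2_truncate:
  assumes "order_ge 1 A" "order_ge 1 B"
  shows "order_ge N (subst2 c A B - (\<Sum>i<N. \<Sum>j<N. mps_const (c i j) * (A ^ i * B ^ j)))"
  unfolding order_ge_def
proof (intro allI impI)
  fix d b a assume less: "a + b + d < N"
  let ?h = "\<lambda>i j. c i j * fps_nth (fps_nth (fps_nth (A ^ i * B ^ j) d) b) a"
  let ?s = "a + b + d"
  have "?h i j = 0" if "?s < i + j" for i j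
    using order_ge_mult[OF order_ge_power[OF assms(1), of i] order_ge_power[OF assms(2), of j]] that
    by (auto simp: order_ge_def)
  then have "(\<Sum>i<N. \<Sum>j<N. ?h i j) = (\<Sum>i\<le>?s. \<Sum>j\<le>?s. ?h i j)"
    using less unfolding sum.cartesian_product
    by (intro sum.mono_neutral_right) (force simp: not_le)+
  then show "fps_nth (fps_nth (fps_nth
      (subst2 c A B - (\<Sum>i<N. \<Sum>j<N. mps_const (c i j) * (A ^ i * B ^ j))) d) b) a = 0"
    by (simp add: subst2_def fps_sum_nth)
qed

lemma integral_mps_diff: "integral_mps A \<Longrightarrow> integral_mps B \<Longrightarrow> integral_mps (A - B)"
  by (auto simp: integral_mps_def intro: v_diff_ge)

text \<open>Both sides are within \<open>N * \<mu>\<close> of the same polynomial expression, for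
  which \<open>ev3\<close> is a ring homomorphism. This is the bridge from the power series axioms
  to the group of points.\<close>

lemma ev3_subst2:
  assumes c: "\<And>i j. 0 \<le> v (c i j)" and A: "integral_mps A" "order_ge 1 A"
    and B: "integral_mps B" "order_ge 1 B" and xyz: "0 < v x" "0 < v y" "0 < v z"
  shows "ev3 x y z (subst2 c A B) = eval2 c (ev3 x y z A) (ev3 x y z B)"
proof -
  obtain \<mu> where \<mu>: "0 < \<mu>" "ereal \<mu> \<le> v x" "ereal \<mu> \<le> v y" "ereal \<mu> \<le> v z"
    by (rule v_pos_obtain_common[of "{x, y, z}"]) (use xyz in auto)
  have \<mu>': "ereal \<mu> \<le> v (ev3 x y z A)" "ereal \<mu> \<le> v (ev3 x y z B)"
    using v_ev3_order_ge[OF A \<mu>] v_ev3_order_ge[OF B \<mu>] by auto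
  show ?thesis
  proof (rule eq_if_v_diff_ge_multiples[OF \<mu>(1)])
    fix N
    let ?T = "\<Sum>i<N. \<Sum>j<N. mps_const (c i j) * (A ^ i * B ^ j)"
    have int: "integral_mps (mps_const (c i j) * (A ^ i * B ^ j))" for i j
      using c A B by (intro integral_mps_mult integral_mps_power integral_mps_const)
    have int_T: "integral_mps ?T"
      by (intro integral_mps_sum int)
    have int_D: "integral_mps (subst2 c A B - ?T)"
      by (intro integral_mps_diff integral_mps_subst2 c A B int_T)
    have "ev3 x y z ?T = (\<Sum>i<N. \<Sum>j<N. c i j * ev3 x y z A ^ i * ev3 x y z B ^ j)"
      using c A B xyz int
      by (simp add: ev3_sum integral_mps_sum ev3_mult integral_mps_mult integral_mps_power
          integral_mps_const ev3_mps_const ev3_power mult.assoc)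
    moreover have "ev3 x y z (subst2 c A B) = ev3 x y z (subst2 c A B - ?T) + ev3 x y z ?T"
      using ev3_add[OF int_D int_T xyz] by simp
    ultimately have eq: "ev3 x y z (subst2 c A B) - eval2 c (ev3 x y z A) (ev3 x y z B)
        = ev3 x y z (subst2 c A B - ?T) - (eval2 c (ev3 x y z A) (ev3 x y z B)
           - (\<Sum>i<N. \<Sum>j<N. c i j * ev3 x y z A ^ i * ev3 x y z B ^ j))"
      by simp
    show "ereal (real N * \<mu>)
        \<le> v (ev3 x y z (subst2 c A B) - eval2 c (ev3 x y z A) (ev3 x y z B))"
      unfolding eq
      by (rule v_diff_ge[OF v_ev3_order_ge[OF int_D order_ge_subst2_truncate[OF A(2) B(2)] \<mu>]
            eval2_tendsto(2)[of c, OF c \<mu>(1) \<mu>']])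
  qed
qed

text \<open>A series in one variable is treated as a series in two that does not involve the second,
  so the convergence arguments need not be repeated.\<close>

lemma subst1_eq_subst2:
  "subst1 f A = subst2 (\<lambda>i j. if j = 0 then fps_nth f i else 0) A 0"
proof -
  have "(\<Sum>j\<le>s. (if j = 0 then fps_nth f i else 0) *
          fps_nth (fps_nth (fps_nth (A ^ i * 0 ^ j) d) b) a)
      = fps_nth f i * fps_nth (fps_nth (fps_nth (A ^ i) d) b) a" for s i d b a
    by (subst sum.mono_neutral_right[where S = "{0}"]) auto
  then show ?thesis
    by (simp add: subst1_def subst2_def)
qed

lemma eval2_eq_ev: "eval2 (\<lambda>i j. if j = 0 then fps_nth f i else 0) x 0 = ev x f"
proof -
  have "(\<Sum>i<N. \<Sum>j<N. (if j = 0 then fps_nth f i else 0) * x ^ i * 0 ^ j)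
      = (\<Sum>i<N. fps_nth f i * x ^ i)" for N
  proof (rule sum.cong)
    fix i assume i: "i \<in> {..<N}"
    have "(\<Sum>j<N. (if j = 0 then fps_nth f i else 0) * x ^ i * 0 ^ j)
        = (\<Sum>j\<in>{0}. (if j = 0 then fps_nth f i else 0) * x ^ i * 0 ^ j)"
      using i by (intro sum.mono_neutral_right) auto
    then show "(\<Sum>j<N. (if j = 0 then fps_nth f i else 0) * x ^ i * 0 ^ j) = fps_nth f i * x ^ i"
      by simp
  qed auto
  then show ?thesis
    by (simp add: eval2_def ev_def)
qed

lemma ev3_subst1:
  assumes f: "integral_fps f" and A: "integral_mps A" "order_ge 1 A"
    and xyz: "0 < v x" "0 < v y" "0 < v z"
  shows "ev3 x y z (subst1 f A) = ev (ev3 x y z A) f"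
  unfolding subst1_eq_subst2
  using assms by (subst ev3_subst2) (auto simp: integral_fps_def eval2_eq_ev)

lemma integral_mps_subst1: "integral_fps f \<Longrightarrow> integral_mps A \<Longrightarrow> integral_mps (subst1 f A)"
  unfolding subst1_eq_subst2 by (rule integral_mps_subst2) (auto simp: integral_fps_def)

lemma order_ge_subst1: "fps_nth f 0 = 0 \<Longrightarrow> order_ge 1 (subst1 f A)"
  unfolding subst1_eq_subst2 by (rule order_ge_subst2) auto

end


section \<open>Splitting off zeros\<close>

context complete_valued_field
begin

lemma ev_shift:
  assumes "integral_fps f" "0 < v z"
  shows "ev z f = fps_nth f 0 + z * ev z (fps_shift 1 f)"
proof -
  have "f = fps_const (fps_nth f 0) + fps_X * fps_shift 1 f"
    by (auto simp: fps_eq_iff)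
  moreover have "integral_fps (fps_shift 1 f)" "integral_fps (fps_const (fps_nth f 0))"
    using assms by (auto simp: integral_fps_def)
  ultimately show ?thesis
    using assms
    by (metis ev_add ev_mult ev_X ev_const integral_fps_mult integral_fps_simps(3) integral_fps_const)
qed

lemma ev_factor:
  assumes f: "integral_fps f" and z: "0 < v z" and root: "ev z f = 0"
  obtains g where "integral_fps g" "\<And>x. 0 < v x \<Longrightarrow> ev x f = (x - z) * ev x g"
proof -
  have shift: "integral_fps (fps_shift k f)" for k
    using f by (auto simp: integral_fps_def)
  \<comment> \<open>Synthetic division by X - z: the k-th coefficient of the quotient is the sum of
    \<open>f_i z^(i-k-1)\<close> over i > k, which converges to an integral element because z lies
    in the maximal ideal.\<close>
  define g where "g = Abs_fps (\<lambda>k. ev z (fps_shift (Suc k) f))"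
  have g: "integral_fps g"
    unfolding g_def integral_fps_def[of "Abs_fps _"] using v_ev_nonneg[OF shift z] by simp
  have step: "ev z (fps_shift k f) = fps_nth f k + z * ev z (fps_shift (Suc k) f)" for k
  proof -
    have "fps_shift 1 (fps_shift k f) = fps_shift (Suc k) f"
      by (simp add: fps_eq_iff)
    then show ?thesis
      using ev_shift[OF shift z, of k] by simp
  qed
  have "f = (fps_X + fps_const (- z)) * g"
  proof (rule fps_ext)
    fix k
    show "fps_nth f k = fps_nth ((fps_X + fps_const (- z)) * g) k"
      using step[of k] root by (cases k) (simp_all add: distrib_right g_def eq_neg_iff_add_eq_0)
  qed
  moreover have "integral_fps (fps_const (- z))"
    using z by simp
  ultimately have "ev x f = (x - z) * ev x g" if "0 < v x" for x
    using that g z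
    by (subst \<open>f = _\<close>, subst ev_mult) (auto simp: ev_add integral_fps_add)
  then show ?thesis
    using that g by blast
qed

text \<open>The zeros are distinct, so after the factors for Z are split off, a further zero z is
  still a zero of the cofactor.\<close>

lemma ev_factor_prod:
  assumes "finite Z" "\<And>z. z \<in> Z \<Longrightarrow> 0 < v z" "\<And>z. z \<in> Z \<Longrightarrow> ev z f = 0" "integral_fps f"
  shows "\<exists>g. integral_fps g \<and> (\<forall>x. 0 < v x \<longrightarrow> ev x f = (\<Prod>z\<in>Z. x - z) * ev x g)"
  using assms
proof (induction Z)
  case (insert z Z)
  then obtain g where g: "integral_fps g" "\<forall>x. 0 < v x \<longrightarrow> ev x f = (\<Prod>z\<in>Z. x - z) * ev x g"
    by auto
  have "(\<Prod>z'\<in>Z. z - z') * ev z g = 0"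
    using g(2) insert.prems by (metis insertI1)
  then have "ev z g = 0"
    using insert.hyps by (auto simp: prod_zero_iff)
  then obtain h where "integral_fps h" "\<And>x. 0 < v x \<Longrightarrow> ev x g = (x - z) * ev x h"
    using ev_factor[OF g(1)] insert.prems by blast
  then show ?case
    using g(2) insert.hyps by (intro exI[of _ h]) (auto simp: mult_ac)
qed auto

lemma v_prod: "v (\<Prod>z\<in>Z. f z) = (\<Sum>z\<in>Z. v (f z))"
  by (induction Z rule: infinite_finite_induct) (auto simp: v_mult)

text \<open>The cofactor is an integral series, so its value can only increase the
  valuation.\<close>

lemma v_ev_ge_sum_zeros:
  assumes "finite Z" "\<And>z. z \<in> Z \<Longrightarrow> 0 < v z" "\<And>z. z \<in> Z \<Longrightarrow> ev z f = 0" "integral_fps f"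
    and x: "0 < v x"
  shows "(\<Sum>z\<in>Z. v (x - z)) \<le> v (ev x f)"
proof -
  obtain g where g: "integral_fps g" "ev x f = (\<Prod>z\<in>Z. x - z) * ev x g"
    using ev_factor_prod[OF assms(1-4)] x by blast
  show ?thesis
    unfolding g(2) v_prod[symmetric]
    by (rule v_mult_ge[OF order_refl v_ev_nonneg[OF g(1) x]])
qed

end


section \<open>The module of points\<close>

context pi_divisible_module
begin

sublocale complete_valued_field "val H"
  by unfold_locales (rule val_valuation val_complete)+

abbreviation \<O> where "\<O> \<equiv> OF_ring H"
abbreviation unif_H ("\<pi>") where "\<pi> \<equiv> unif H"
abbreviation val_H ("v") where "v \<equiv> val H"

lemma ring_of_type_algebra_simps [simp]:
  "carrier ring_of_type_algebra = (UNIV :: 'k set)"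
  "x \<otimes>\<^bsub>ring_of_type_algebra\<^esub> y = (x * y :: 'k)"
  "x \<oplus>\<^bsub>ring_of_type_algebra\<^esub> y = (x + y :: 'k)"
  "\<one>\<^bsub>ring_of_type_algebra\<^esub> = (1 :: 'k)"
  "\<zero>\<^bsub>ring_of_type_algebra\<^esub> = (0 :: 'k)"
  by (simp_all add: ring_of_type_algebra_def)

lemma base_closed:
  shows base_0: "0 \<in> base H" and base_1: "1 \<in> base H"
    and base_add: "x \<in> base H \<Longrightarrow> y \<in> base H \<Longrightarrow> x + y \<in> base H"
    and base_mult: "x \<in> base H \<Longrightarrow> y \<in> base H \<Longrightarrow> x * y \<in> base H"
    and base_uminus: "x \<in> base H \<Longrightarrow> - x \<in> base H"
    and base_inverse: "x \<in> base H \<Longrightarrow> inverse x \<in> base H"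
proof -
  interpret R: field "ring_of_type_algebra :: 'k ring"
    by (rule field_from_type_algebra)
  note sub = subringE[OF subfieldE(1)[OF base_subfield], simplified]
  show "0 \<in> base H" "1 \<in> base H"
    "x \<in> base H \<Longrightarrow> y \<in> base H \<Longrightarrow> x + y \<in> base H"
    "x \<in> base H \<Longrightarrow> y \<in> base H \<Longrightarrow> x * y \<in> base H"
    using sub by auto
  have "\<ominus>\<^bsub>ring_of_type_algebra\<^esub> x = - x" for x :: 'k
    using R.r_neg[of x] by (simp add: add_eq_0_iff)
  then show "x \<in> base H \<Longrightarrow> - x \<in> base H"
    using sub by metis
  show "inverse x \<in> base H" if "x \<in> base H"
  proof (cases "x = 0")
    case False
    then have "inv\<^bsub>ring_of_type_algebra\<^esub> x \<in> base H" "x * inv\<^bsub>ring_of_type_algebra\<^esub> x = 1"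
      using R.subfield_m_inv[OF base_subfield, of x] that by auto
    then show ?thesis
      using inverse_unique by metis
  qed (use sub in auto)
qed

lemma base_power: "x \<in> base H \<Longrightarrow> x ^ m \<in> base H"
  by (induction m) (auto intro: base_1 base_mult)

lemma unif_nonzero [simp]: "\<pi> \<noteq> 0"
  using val_unif by auto

lemma val_unif_power [simp]: "v (\<pi> ^ m) = ereal (real m)"
  by (induction m) (auto simp: v_mult val_unif one_ereal_def zero_ereal_def)

lemma OF_ring_iff: "a \<in> \<O> \<longleftrightarrow> a \<in> base H \<and> 0 \<le> v a"
  by (simp add: OF_ring_def)

lemma OF_ring_closed:
  shows OF_0: "0 \<in> \<O>" and OF_1: "1 \<in> \<O>"
    and OF_add: "x \<in> \<O> \<Longrightarrow> y \<in> \<O> \<Longrightarrow> x + y \<in> \<O>"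
    and OF_mult: "x \<in> \<O> \<Longrightarrow> y \<in> \<O> \<Longrightarrow> x * y \<in> \<O>"
    and OF_uminus: "x \<in> \<O> \<Longrightarrow> - x \<in> \<O>"
    and OF_unif: "\<pi> \<in> \<O>"
    and OF_unif_power: "\<pi> ^ m \<in> \<O>"
  using unif_base
  by (auto simp: OF_ring_iff val_unif base_closed base_power intro: v_add_ge v_mult_nonneg)

lemma points_iff: "x \<in> points H \<longleftrightarrow> 0 < v x"
  by (simp add: points_def)

lemma points_0 [simp]: "0 \<in> points H"
  by (simp add: points_iff)

lemma padd_eq_eval2: "padd H x y = eval2 (law H) x y"
  by (simp add: padd_def eval2_def)

lemma pact_eq_ev: "pact H a x = ev x (act H a)"
  by (simp add: pact_def ev_def)

lemma integral_act: "a \<in> \<O> \<Longrightarrow> integral_fps (act H a)"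
  by (simp add: integral_fps_def act_integral)

lemma varX_power_nth:
  "fps_nth (fps_nth (fps_nth (varX ^ i :: 'k mps) 0) 0) a = (if a = i then 1 else 0)"
  by (simp add: varX_def fps_const_power fps_X_power_nth)

text \<open>Compare the coefficients of X^i in F(X, 0) = X; in the second argument only
  \<open>0 ^ 0\<close> contributes.\<close>

lemma law_right_0: "law H i 0 = (if i = 1 then 1 else 0)"
proof -
  have "(if i = 1 then 1 else 0) = fps_nth (fps_nth (fps_nth (varX :: 'k mps) 0) 0) i"
    using varX_power_nth[of 1 i] by simp
  also have "\<dots> = (\<Sum>i'\<le>i. \<Sum>j\<le>i. law H i' j * fps_nth (fps_nth (fps_nth (varX ^ i' * 0 ^ j) 0) 0) i)"
    by (subst law_zero_right[symmetric]) (simp add: subst2_def)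
  also have "\<dots> = (\<Sum>i'\<le>i. \<Sum>j\<in>{0}. law H i' j * fps_nth (fps_nth (fps_nth (varX ^ i' * 0 ^ j) 0) 0) i)"
    by (rule sum.cong[OF refl], rule sum.mono_neutral_right) (auto simp: power_0_left)
  also have "\<dots> = (\<Sum>i'\<le>i. if i' = i then law H i' 0 else 0)"
    by (intro sum.cong) (auto simp: varX_power_nth)
  also have "\<dots> = law H i 0"
    by simp
  finally show ?thesis ..
qed

lemma law_left_0: "law H 0 j = (if j = 1 then 1 else 0)"
proof -
  have "(if j = 1 then 1 else 0) = fps_nth (fps_nth (fps_nth (varX :: 'k mps) 0) 0) j"
    using varX_power_nth[of 1 j] by simp
  also have "\<dots> = (\<Sum>i\<le>j. \<Sum>j'\<le>j. law H i j' * fps_nth (fps_nth (fps_nth (0 ^ i * varX ^ j') 0) 0) j)"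
    by (subst law_zero_left[symmetric]) (simp add: subst2_def)
  also have "\<dots> = (\<Sum>i\<in>{0}. \<Sum>j'\<le>j. law H i j' * fps_nth (fps_nth (fps_nth (0 ^ i * varX ^ j') 0) 0) j)"
    by (rule sum.mono_neutral_right) (auto simp: power_0_left)
  also have "\<dots> = (\<Sum>j'\<le>j. law H 0 j' * (if j = j' then 1 else 0))"
    by (simp add: varX_power_nth)
  also have "\<dots> = (\<Sum>j'\<le>j. if j' = j then law H 0 j' else 0)"
    by (intro sum.cong) auto
  also have "\<dots> = law H 0 j"
    by simp
  finally show ?thesis ..
qed

lemma law_0_0: "law H 0 0 = 0"
  by (simp add: law_right_0)

text \<open>The two unit laws fix the coefficients on both axes, so F(X, Y) = X + Y + XY G(X, Y)
  with G integral.\<close>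

lemma v_padd_diff_ge:
  assumes "x \<in> points H" "y \<in> points H"
  shows "v x + v y \<le> v (padd H x y - (x + y))"
proof -
  obtain \<mu> where \<mu>: "0 < \<mu>" "ereal \<mu> \<le> v x" "ereal \<mu> \<le> v y"
    by (rule v_pos_obtain_common[of "{x, y}"]) (use assms in \<open>auto simp: points_iff\<close>)
  let ?S = "\<lambda>N. \<Sum>i<N. \<Sum>j<N. law H i j * x ^ i * y ^ j"
  have nonneg: "0 \<le> v x" "0 \<le> v y"
    using assms by (auto simp: points_iff)
  show ?thesis
    unfolding padd_eq_eval2
  proof (rule vtendsto_ge)
    show "vtendsto v (\<lambda>N. ?S N - (x + y)) (eval2 (law H) x y - (x + y))"
      by (intro vtendsto_diff_const eval2_tendsto(1)[OF law_integral \<mu>])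
    \<comment> \<open>From N = 2 on, the partial sum contains both linear terms.\<close>
    fix N assume N: "(2::nat) \<le> N"
    let ?c = "\<lambda>i j. if i = 0 \<or> j = 0 then 0 else law H i j"
    have "law H i j * x ^ i * y ^ j = ?c i j * x ^ i * y ^ j +
        ((if i = 1 then if j = 0 then x else 0 else 0) +
         (if i = 0 then if j = 1 then y else 0 else 0))" for i j
      using law_right_0[of i] law_left_0[of j] by auto
    then have "?S N = (\<Sum>i<N. \<Sum>j<N. ?c i j * x ^ i * y ^ j) +
        ((\<Sum>i<N. \<Sum>j<N. if i = 1 then if j = 0 then x else 0 else 0) +
         (\<Sum>i<N. \<Sum>j<N. if i = 0 then if j = 1 then y else 0 else 0))"
      by (simp add: sum.distrib)
    also have "(\<Sum>i<N. \<Sum>j<N. if i = 1 then if j = 0 then x else 0 else 0) =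
        (\<Sum>i<N. if i = 1 then x else 0)"
      using N by (intro sum.cong) auto
    also have "\<dots> = x"
      using N by simp
    also have "(\<Sum>i<N. \<Sum>j<N. if i = 0 then if j = 1 then y else 0 else 0) =
        (\<Sum>i<N. if i = 0 then y else 0)"
      using N by (intro sum.cong) auto
    also have "\<dots> = y"
      using N by simp
    finally have "?S N - (x + y) = (\<Sum>i<N. \<Sum>j<N. ?c i j * x ^ i * y ^ j)"
      by simp
    also have "v x + v y \<le> v \<dots>"
    proof (intro v_sum_ge)
      fix i j
      have "v x + v y \<le> v (?c i j * x ^ i * y ^ j)" if "i \<noteq> 0" "j \<noteq> 0"
      proof -
        from that obtain i' j' where ij: "i = Suc i'" "j = Suc j'"
          by (cases i; cases j) auto
        have "v (x * y) \<le> v (x * y * (law H i j * x ^ i' * y ^ j'))"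
          using nonneg law_integral
          by (intro v_mult_ge[OF order_refl] v_mult_nonneg v_power_nonneg)
        then show ?thesis
          using that by (simp add: v_mult[symmetric] ij mult_ac)
      qed
      then show "v x + v y \<le> v (?c i j * x ^ i * y ^ j)"
        by auto
    qed
    finally show "v x + v y \<le> v (?S N - (x + y))" .
  qed
qed

lemma v_padd_ge:
  assumes "x \<in> points H" "y \<in> points H" "r \<le> v x" "r \<le> v y"
  shows "r \<le> v (padd H x y)"
proof -
  have "r + 0 \<le> v x + v y"
    using assms by (intro add_mono) (auto simp: points_iff)
  then have "r \<le> v (padd H x y - (x + y))"
    using v_padd_diff_ge[OF assms(1,2)] by simp
  then have "r \<le> v (padd H x y - (x + y) + (x + y))"
    using assms by (intro v_add_ge)
  then show ?thesis
    by simp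
qed

lemma padd_closed: "x \<in> points H \<Longrightarrow> y \<in> points H \<Longrightarrow> padd H x y \<in> points H"
proof -
  assume xy: "x \<in> points H" "y \<in> points H"
  obtain \<mu> where "0 < \<mu>" "ereal \<mu> \<le> v x" "ereal \<mu> \<le> v y"
    by (rule v_pos_obtain_common[of "{x, y}"]) (use xy in \<open>auto simp: points_iff\<close>)
  then show ?thesis
    using v_padd_ge[OF xy, of "ereal \<mu>"] unfolding points_iff
    by (metis ereal_less(2) less_le_trans)
qed

text \<open>The correction to x + y has valuation at least v x + v y, which exceeds the finite v x;
  so the ultrametric equality passes from addition to the group law.\<close>

lemma v_padd_eq:
  assumes "x \<in> points H" "y \<in> points H" "v x < v y"
  shows "v (padd H x y) = v x"
proof -
  obtain r where r: "v x = ereal r"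
    using assms(3) by (cases "v x") auto
  have "v x < v x + v y"
    using assms by (cases "v y") (auto simp: r points_iff)
  then have "v x < v (padd H x y - (x + y))"
    using v_padd_diff_ge[OF assms(1,2)] by simp
  moreover have "v (x + y) = v x"
    using assms(3) by (rule v_add_eq)
  ultimately show ?thesis
    using v_add_eq[of "x + y" "padd H x y - (x + y)"] by simp
qed

lemma ev3_law:
  assumes "integral_mps A" "order_ge 1 A" "integral_mps B" "order_ge 1 B"
    and "x \<in> points H" "y \<in> points H" "z \<in> points H"
  shows "ev3 x y z (subst2 (law H) A B) = padd H (ev3 x y z A) (ev3 x y z B)"
  using assms ev3_subst2[of "law H", OF law_integral] unfolding padd_eq_eval2 points_iff by blast

lemma ev3_act:
  assumes "a \<in> \<O>" "integral_mps A" "order_ge 1 A"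
    and "x \<in> points H" "y \<in> points H" "z \<in> points H"
  shows "ev3 x y z (subst1 (act H a) A) = pact H a (ev3 x y z A)"
  using assms ev3_subst1[OF integral_act] unfolding pact_eq_ev points_iff by blast

lemma integral_law: "integral_mps A \<Longrightarrow> integral_mps B \<Longrightarrow> integral_mps (subst2 (law H) A B)"
  by (rule integral_mps_subst2[OF law_integral])

lemma order_law: "order_ge 1 (subst2 (law H) A B)"
  by (rule order_ge_subst2[of "law H", OF law_0_0])

lemma integral_act_mps: "a \<in> \<O> \<Longrightarrow> integral_mps A \<Longrightarrow> integral_mps (subst1 (act H a) A)"
  by (rule integral_mps_subst1[OF integral_act])

lemma order_act: "a \<in> \<O> \<Longrightarrow> order_ge 1 (subst1 (act H a) A)"
  by (rule order_ge_subst1[OF act_const])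

lemmas mps_intros = integral_mps_var order_ge_var integral_law order_law integral_act_mps order_act
  integral_mps_0 order_ge_0

lemma ev3_var_points:
  assumes "x \<in> points H" "y \<in> points H" "z \<in> points H"
  shows "ev3 x y z varX = x" "ev3 x y z varY = y" "ev3 x y z varZ = z" "ev3 x y z 0 = 0"
  using assms by (auto simp: points_iff)

text \<open>This law and the ones up to \<open>pact_1\<close> are the power series axioms evaluated
  by \<open>ev3\<close>. Variables that do not occur receive an arbitrary point.\<close>

lemma padd_commute:
  assumes "x \<in> points H" "y \<in> points H"
  shows "padd H x y = padd H y x"
  using arg_cong[OF law_comm, of "ev3 x y y"] assms by (simp only: ev3_law ev3_var_points mps_intros)

lemma padd_assoc:
  assumes "x \<in> points H" "y \<in> points H" "z \<in> points H"
  shows "padd H (padd H x y) z = padd H x (padd H y z)"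
  using arg_cong[OF law_assoc, of "ev3 x y z"] assms by (simp only: ev3_law ev3_var_points mps_intros)

lemma padd_0_right:
  assumes "x \<in> points H"
  shows "padd H x 0 = x"
  using arg_cong[OF law_zero_right, of "ev3 x x x"] assms by (simp only: ev3_law ev3_var_points mps_intros)

lemma pact_padd:
  assumes "a \<in> \<O>" "x \<in> points H" "y \<in> points H"
  shows "pact H a (padd H x y) = padd H (pact H a x) (pact H a y)"
  using arg_cong[OF act_hom, of a "ev3 x y y"] assms
  by (simp only: ev3_law ev3_act ev3_var_points mps_intros)

lemma pact_add:
  assumes "a \<in> \<O>" "b \<in> \<O>" "x \<in> points H"
  shows "pact H (a + b) x = padd H (pact H a x) (pact H b x)"
  using arg_cong[OF act_add, of a b "ev3 x x x"] assms
  by (simp only: ev3_law ev3_act ev3_var_points mps_intros OF_add)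

lemma pact_mult:
  assumes "a \<in> \<O>" "b \<in> \<O>" "x \<in> points H"
  shows "pact H (a * b) x = pact H a (pact H b x)"
  using arg_cong[OF act_mult, of a b "ev3 x x x"] assms
  by (simp only: ev3_act ev3_var_points mps_intros OF_mult)

lemma pact_1: "x \<in> points H \<Longrightarrow> pact H 1 x = x"
  using arg_cong[OF act_one, of "ev3 x x x"]
  by (simp only: ev3_act ev3_var_points mps_intros OF_1)

text \<open>The series \<open>[a](T)\<close> has no constant term, so every monomial contains a
  factor x.\<close>

lemma v_pact_ge:
  assumes "a \<in> \<O>" "x \<in> points H"
  shows "v x \<le> v (pact H a x)"
  unfolding pact_eq_ev
proof (rule v_ev_ge[OF integral_act])
  fix i
  show "v x \<le> v (fps_nth (act H a) i * x ^ i)"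
  proof (cases i)
    case (Suc i')
    have "v x \<le> v (x * (fps_nth (act H a) i * x ^ i'))"
      using assms act_integral
      by (intro v_mult_ge[OF order_refl] v_mult_nonneg v_power_nonneg) (auto simp: points_iff)
    then show ?thesis
      by (simp add: Suc mult_ac)
  qed (use assms act_const in auto)
qed (use assms in \<open>auto simp: points_iff\<close>)

lemma pact_closed: "a \<in> \<O> \<Longrightarrow> x \<in> points H \<Longrightarrow> pact H a x \<in> points H"
  using v_pact_ge less_le_trans unfolding points_iff by blast

lemma pact_0_right: "a \<in> \<O> \<Longrightarrow> pact H a 0 = 0"
  using v_pact_ge[of a 0] by simp

text \<open>An idempotent \<open>z\<close> of the group satisfies \<open>v z \<ge> 2 v z\<close>, hence vanishes.\<close>
lemma pact_0_left:
  assumes "x \<in> points H"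
  shows "pact H 0 x = 0"
proof -
  define z where "z = pact H 0 x"
  have z: "z \<in> points H" "padd H z z = z"
    using pact_add[of 0 0 x] assms by (auto simp: z_def OF_0 pact_closed)
  then have "v z + v z \<le> v (- z)"
    using v_padd_diff_ge[of z z] by simp
  then have "v z = \<infinity>"
    using z(1) by (cases "v z") (auto simp: points_iff)
  then show ?thesis
    by (simp add: z_def)
qed

text \<open>Apply \<open>v_pact_ge\<close> to a and to its inverse.\<close>

lemma v_pact_unit:
  assumes "a \<in> base H" "v a = 0" "x \<in> points H"
  shows "v (pact H a x) = v x"
proof (rule antisym)
  have "a \<noteq> 0"
    using assms(2) by auto
  then have a: "a \<in> \<O>" "inverse a \<in> \<O>"
    using assms by (auto simp: OF_ring_iff v_inverse base_inverse)
  then have "pact H (inverse a) (pact H a x) = x"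
    using pact_mult[of "inverse a" a x] \<open>a \<noteq> 0\<close> assms pact_1 by simp
  then show "v (pact H a x) \<le> v x"
    using v_pact_ge[OF a(2) pact_closed[OF a(1) assms(3)]] by simp
  show "v x \<le> v (pact H a x)"
    using v_pact_ge a assms by blast
qed


section \<open>The rational Tate module\<close>

abbreviation V where "V \<equiv> VH H"

lemma VH_simps:
  "\<zero>\<^bsub>V\<^esub> = (\<lambda>i. 0)"
  "x \<oplus>\<^bsub>V\<^esub> y = (\<lambda>i. padd H (x i) (y i))"
  by (simp_all add: VH_def)

lemma carrier_VH_iff: "x \<in> carrier V \<longleftrightarrow>
  (\<forall>i. x i \<in> points H) \<and> (\<forall>i. pact H \<pi> (x (i + 1)) = x i) \<and> (\<exists>N. \<forall>i<N. x i = 0)"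
  by (simp add: VH_def)

lemma carrier_VH_D:
  assumes "x \<in> carrier V"
  shows "x i \<in> points H" "pact H \<pi> (x (i + 1)) = x i"
  using assms by (auto simp: carrier_VH_iff)

lemma ex_unif_power_integral:
  assumes "a \<in> base H"
  obtains m where "\<pi> ^ m * a \<in> \<O>"
proof (cases "a = 0")
  case False
  then obtain k :: int where "v a = ereal (of_int k)"
    using val_base assms by blast
  then have "0 \<le> v (\<pi> ^ nat \<bar>k\<bar> * a)"
    by (simp add: v_mult zero_ereal_def)
  then show ?thesis
    using assms that by (auto simp: OF_ring_iff base_mult base_power unif_base)
qed (use that[of 0] in \<open>simp add: OF_0\<close>)

lemma OF_unif_power_mono:
  assumes "\<pi> ^ m * a \<in> \<O>" "m \<le> m'"
  shows "\<pi> ^ m' * a \<in> \<O>"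
proof -
  have "\<pi> ^ m' * a = \<pi> ^ (m' - m) * (\<pi> ^ m * a)"
    using assms(2) by (simp add: mult.assoc[symmetric] power_add[symmetric])
  then show ?thesis
    using OF_mult[OF OF_unif_power[of "m' - m"] assms(1)] by argo
qed

lemma base_if_OF_unif_power:
  assumes "\<pi> ^ m * a \<in> \<O>"
  shows "a \<in> base H"
proof -
  have "a = inverse (\<pi> ^ m) * (\<pi> ^ m * a)"
    by simp
  also have "\<dots> \<in> base H"
    using assms by (intro base_mult[OF base_inverse[OF base_power[OF unif_base]]]) (simp add: OF_ring_iff)
  finally show ?thesis .
qed

text \<open>This removes the least exponent from the definition: one more factor
  \<open>\<pi>\<close> is absorbed by the relation between x_(i+1) and x_i. Several scalars can then
  be treated with a common exponent.\<close>

lemma smult_eq: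
  assumes x: "x \<in> carrier V" and a: "\<pi> ^ m * a \<in> \<O>"
  shows "(a \<odot>\<^bsub>V\<^esub> x) i = pact H (\<pi> ^ m * a) (x (i + int m))"
proof -
  define m0 where "m0 = (LEAST m::nat. 0 \<le> v (\<pi> ^ m * a))"
  have m0: "0 \<le> v (\<pi> ^ m0 * a)" "m0 \<le> m"
    unfolding m0_def using a LeastI[of "\<lambda>m. 0 \<le> v (\<pi> ^ m * a)" m]
    by (auto simp: OF_ring_iff intro: Least_le)
  have a0: "\<pi> ^ m0 * a \<in> \<O>"
    using m0(1) base_if_OF_unif_power[OF a] by (auto simp: OF_ring_iff base_mult base_power unif_base)
  have "pact H (\<pi> ^ (m0 + d) * a) (x (i + int (m0 + d))) = pact H (\<pi> ^ m0 * a) (x (i + int m0))" for d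
  proof (induction d)
    case (Suc d)
    have "pact H (\<pi> ^ (m0 + Suc d) * a) (x (i + int (m0 + Suc d)))
        = pact H (\<pi> ^ (m0 + d) * a * \<pi>) (x (i + int (m0 + d) + 1))"
      by (simp add: mult_ac add_ac)
    also have "\<dots> = pact H (\<pi> ^ (m0 + d) * a) (x (i + int (m0 + d)))"
      using OF_unif_power_mono[OF a0, of "m0 + d"] x
      by (subst pact_mult) (auto simp: OF_unif carrier_VH_D)
    finally show ?case
      using Suc by simp
  qed simp
  from this[of "m - m0"] show ?thesis
    using m0 by (simp add: VH_def Let_def m0_def[symmetric])
qed

lemma smult_eq_OF: "x \<in> carrier V \<Longrightarrow> a \<in> \<O> \<Longrightarrow> (a \<odot>\<^bsub>V\<^esub> x) i = pact H a (x i)"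
  using smult_eq[of x 0 a i] by simp

lemma smult_closed:
  assumes x: "x \<in> carrier V" and a: "a \<in> base H"
  shows "a \<odot>\<^bsub>V\<^esub> x \<in> carrier V"
proof -
  obtain m where m: "\<pi> ^ m * a \<in> \<O>"
    using ex_unif_power_integral[OF a] .
  let ?b = "\<pi> ^ m * a"
  obtain N where N: "\<forall>i<N. x i = 0"
    using x by (auto simp: carrier_VH_iff)
  show ?thesis
    unfolding carrier_VH_iff smult_eq[OF x m]
  proof (intro conjI allI exI impI)
    fix i
    show "pact H ?b (x (i + int m)) \<in> points H"
      using m x by (simp add: pact_closed carrier_VH_D)
    have "pact H \<pi> (pact H ?b (x (i + 1 + int m))) = pact H ?b (pact H \<pi> (x (i + 1 + int m)))"
      using m x OF_unif by (simp add: pact_mult[symmetric] carrier_VH_D mult.commute)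
    also have "pact H \<pi> (x (i + 1 + int m)) = x (i + int m)"
      using carrier_VH_D(2)[OF x, of "i + int m"] by (simp add: add_ac)
    finally show "pact H \<pi> (pact H ?b (x (i + 1 + int m))) = pact H ?b (x (i + int m))" .
  next
    fix i assume "i < N - int m"
    then show "pact H ?b (x (i + int m)) = 0"
      using N m by (simp add: pact_0_right)
  qed
qed

text \<open>This structure is what \<open>finsum\<close> asks for; differences are formed later with
  the scalar -1.\<close>

lemma VH_abelian_monoid: "abelian_monoid V"
proof (rule abelian_monoidI)
  fix x y assume xy: "x \<in> carrier V" "y \<in> carrier V"
  obtain N M where NM: "\<forall>i<N. x i = 0" "\<forall>i<M. y i = 0"
    using xy by (auto simp: carrier_VH_iff)
  have "\<forall>i<min N M. padd H (x i) (y i) = 0"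
    using NM by (simp add: padd_0_right)
  then have "\<exists>N. \<forall>i<N. padd H (x i) (y i) = 0"
    by blast
  moreover have "padd H (x i) (y i) \<in> points H"
    "pact H \<pi> (padd H (x (i + 1)) (y (i + 1))) = padd H (x i) (y i)" for i
    using xy by (simp_all add: carrier_VH_D padd_closed pact_padd OF_unif)
  ultimately show "x \<oplus>\<^bsub>V\<^esub> y \<in> carrier V"
    by (simp add: carrier_VH_iff VH_simps)
  show "x \<oplus>\<^bsub>V\<^esub> y = y \<oplus>\<^bsub>V\<^esub> x"
    using xy by (auto simp: VH_simps carrier_VH_D padd_commute)
next
  show "\<zero>\<^bsub>V\<^esub> \<in> carrier V"
    by (auto simp: VH_simps carrier_VH_iff pact_0_right OF_unif)
next
  fix x assume "x \<in> carrier V"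
  then show "\<zero>\<^bsub>V\<^esub> \<oplus>\<^bsub>V\<^esub> x = x"
    by (auto simp: VH_simps carrier_VH_D padd_0_right padd_commute[of 0])
qed (auto simp: VH_simps carrier_VH_D padd_assoc)

sublocale V: abelian_monoid "VH H"
  by (rule VH_abelian_monoid)

lemma smult_add:
  assumes "x \<in> carrier V" "y \<in> carrier V" "a \<in> base H"
  shows "a \<odot>\<^bsub>V\<^esub> (x \<oplus>\<^bsub>V\<^esub> y) = a \<odot>\<^bsub>V\<^esub> x \<oplus>\<^bsub>V\<^esub> a \<odot>\<^bsub>V\<^esub> y"
proof -
  obtain m where m: "\<pi> ^ m * a \<in> \<O>"
    using ex_unif_power_integral[OF assms(3)] .
  show ?thesis
  proof
    fix i
    show "(a \<odot>\<^bsub>V\<^esub> (x \<oplus>\<^bsub>V\<^esub> y)) i = (a \<odot>\<^bsub>V\<^esub> x \<oplus>\<^bsub>V\<^esub> a \<odot>\<^bsub>V\<^esub> y) i"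
      using assms m smult_eq[OF V.a_closed[OF assms(1,2)] m, of i]
      by (simp add: VH_simps(2) smult_eq[OF _ m] pact_padd carrier_VH_D)
  qed
qed

lemma add_smult:
  assumes "x \<in> carrier V" "a \<in> base H" "b \<in> base H"
  shows "(a + b) \<odot>\<^bsub>V\<^esub> x = a \<odot>\<^bsub>V\<^esub> x \<oplus>\<^bsub>V\<^esub> b \<odot>\<^bsub>V\<^esub> x"
proof -
  obtain m1 m2 where "\<pi> ^ m1 * a \<in> \<O>" "\<pi> ^ m2 * b \<in> \<O>"
    using ex_unif_power_integral assms(2,3) by metis
  then have m: "\<pi> ^ (m1 + m2) * a \<in> \<O>" "\<pi> ^ (m1 + m2) * b \<in> \<O>"
    using OF_unif_power_mono by auto
  then have "\<pi> ^ (m1 + m2) * (a + b) \<in> \<O>"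
    by (simp add: distrib_left OF_add)
  note smult_eqs = smult_eq[OF assms(1) this] smult_eq[OF assms(1) m(1)] smult_eq[OF assms(1) m(2)]
  show ?thesis
    using m by (auto simp: VH_simps(2) smult_eqs distrib_left pact_add carrier_VH_D[OF assms(1)])
qed

lemma mult_smult:
  assumes "x \<in> carrier V" "a \<in> base H" "b \<in> base H"
  shows "(a * b) \<odot>\<^bsub>V\<^esub> x = a \<odot>\<^bsub>V\<^esub> (b \<odot>\<^bsub>V\<^esub> x)"
proof -
  obtain m1 m2 where m: "\<pi> ^ m1 * a \<in> \<O>" "\<pi> ^ m2 * b \<in> \<O>"
    using ex_unif_power_integral assms(2,3) by metis
  have eq: "\<pi> ^ (m1 + m2) * (a * b) = (\<pi> ^ m1 * a) * (\<pi> ^ m2 * b)"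
    by (simp add: power_add mult_ac)
  have m12: "\<pi> ^ (m1 + m2) * (a * b) \<in> \<O>"
    unfolding eq using m by (rule OF_mult)
  show ?thesis
  proof
    fix i
    have "((a * b) \<odot>\<^bsub>V\<^esub> x) i = pact H ((\<pi> ^ m1 * a) * (\<pi> ^ m2 * b)) (x (i + int (m1 + m2)))"
      using smult_eq[OF assms(1) m12] eq by simp
    also have "\<dots> = pact H (\<pi> ^ m1 * a) (pact H (\<pi> ^ m2 * b) (x (i + int m1 + int m2)))"
      using m by (simp add: pact_mult carrier_VH_D[OF assms(1)] add_ac)
    also have "\<dots> = (a \<odot>\<^bsub>V\<^esub> (b \<odot>\<^bsub>V\<^esub> x)) i"
      using smult_eq[OF smult_closed[OF assms(1,3)] m(1)] smult_eq[OF assms(1) m(2)] by simp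
    finally show "((a * b) \<odot>\<^bsub>V\<^esub> x) i = (a \<odot>\<^bsub>V\<^esub> (b \<odot>\<^bsub>V\<^esub> x)) i" .
  qed
qed

lemma one_smult: "x \<in> carrier V \<Longrightarrow> 1 \<odot>\<^bsub>V\<^esub> x = x"
  by (auto simp: smult_eq_OF OF_1 pact_1 carrier_VH_D)

lemma zero_smult: "x \<in> carrier V \<Longrightarrow> 0 \<odot>\<^bsub>V\<^esub> x = \<zero>\<^bsub>V\<^esub>"
  by (auto simp: smult_eq_OF OF_0 pact_0_left carrier_VH_D VH_simps)

lemma smult_zero: "a \<in> base H \<Longrightarrow> a \<odot>\<^bsub>V\<^esub> \<zero>\<^bsub>V\<^esub> = \<zero>\<^bsub>V\<^esub>"
proof -
  assume a: "a \<in> base H"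
  obtain m where "\<pi> ^ m * a \<in> \<O>"
    using ex_unif_power_integral[OF a] .
  from smult_eq[OF V.zero_closed this] this show ?thesis
    by (auto simp: VH_simps pact_0_right)
qed

end


section \<open>Linear combinations\<close>

context pi_divisible_module
begin

lemma base_diff: "x \<in> base H \<Longrightarrow> y \<in> base H \<Longrightarrow> x - y \<in> base H"
  using base_add[of x "- y"] base_uminus[of y] by simp

lemma smult_finsum:
  assumes "finite A" "\<And>i. i \<in> A \<Longrightarrow> f i \<in> carrier V" "a \<in> base H"
  shows "a \<odot>\<^bsub>V\<^esub> (\<Oplus>\<^bsub>V\<^esub>i\<in>A. f i) = (\<Oplus>\<^bsub>V\<^esub>i\<in>A. a \<odot>\<^bsub>V\<^esub> f i)"
  using assms(1,2)
proof (induction A)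
  case (insert i A)
  then have "f i \<in> carrier V" "f \<in> A \<rightarrow> carrier V" "(\<lambda>i. a \<odot>\<^bsub>V\<^esub> f i) \<in> A \<rightarrow> carrier V"
    using assms(3) by (auto simp: smult_closed)
  with insert show ?case
    by (simp add: smult_add assms(3) smult_closed)
qed (simp add: smult_zero assms(3))

context
  fixes m :: nat and f :: "nat \<Rightarrow> int \<Rightarrow> 'k"
  assumes f: "\<And>i. i \<in> {1..m} \<Longrightarrow> f i \<in> carrier V"
begin

lemma lincomb_closed:
  assumes "\<And>i. i \<in> {1..m} \<Longrightarrow> c i \<in> base H"
  shows "lincomb H m c f \<in> carrier V"
  unfolding lincomb_def using assms f by (intro V.finsum_closed) (auto simp: smult_closed)

lemma lincomb_cong:
  assumes "\<And>i. i \<in> {1..m} \<Longrightarrow> c i \<in> base H" "\<And>i. i \<in> {1..m} \<Longrightarrow> c i = d i"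
  shows "lincomb H m c f = lincomb H m d f"
  unfolding lincomb_def
proof (rule V.finsum_cong')
  show "(\<lambda>i. d i \<odot>\<^bsub>V\<^esub> f i) \<in> {1..m} \<rightarrow> carrier V"
    using assms f by (auto simp: Pi_iff intro!: smult_closed)
qed (use assms in auto)

lemma smult_lincomb:
  assumes "\<And>i. i \<in> {1..m} \<Longrightarrow> c i \<in> base H" "a \<in> base H"
  shows "a \<odot>\<^bsub>V\<^esub> lincomb H m c f = lincomb H m (\<lambda>i. a * c i) f"
proof -
  have "a \<odot>\<^bsub>V\<^esub> lincomb H m c f = (\<Oplus>\<^bsub>V\<^esub>i\<in>{1..m}. a \<odot>\<^bsub>V\<^esub> (c i \<odot>\<^bsub>V\<^esub> f i))"
    unfolding lincomb_def using assms f by (intro smult_finsum) (auto simp: smult_closed)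
  also have "\<dots> = lincomb H m (\<lambda>i. a * c i) f"
    unfolding lincomb_def using assms f
    by (intro V.finsum_cong') (auto simp: mult_smult smult_closed base_mult)
  finally show ?thesis .
qed

lemma lincomb_add:
  assumes "\<And>i. i \<in> {1..m} \<Longrightarrow> c i \<in> base H" "\<And>i. i \<in> {1..m} \<Longrightarrow> d i \<in> base H"
  shows "lincomb H m c f \<oplus>\<^bsub>V\<^esub> lincomb H m d f = lincomb H m (\<lambda>i. c i + d i) f"
proof -
  have "lincomb H m c f \<oplus>\<^bsub>V\<^esub> lincomb H m d f
      = (\<Oplus>\<^bsub>V\<^esub>i\<in>{1..m}. c i \<odot>\<^bsub>V\<^esub> f i \<oplus>\<^bsub>V\<^esub> d i \<odot>\<^bsub>V\<^esub> f i)"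
    unfolding lincomb_def using assms f
    by (intro V.finsum_addf[symmetric]) (auto simp: smult_closed)
  also have "\<dots> = lincomb H m (\<lambda>i. c i + d i) f"
    unfolding lincomb_def using assms f
    by (intro V.finsum_cong') (auto simp: add_smult smult_closed base_add)
  finally show ?thesis .
qed

lemma lincomb_scale:
  assumes "\<And>i. i \<in> {1..m} \<Longrightarrow> c i \<in> base H" "\<And>i. i \<in> {1..m} \<Longrightarrow> d i \<in> base H"
  shows "lincomb H m c (\<lambda>i. d i \<odot>\<^bsub>V\<^esub> f i) = lincomb H m (\<lambda>i. c i * d i) f"
  unfolding lincomb_def using assms f
  by (intro V.finsum_cong') (auto simp: mult_smult smult_closed base_mult)

end

lemma O_span_subset_carrier:
  assumes "f \<in> {1..m} \<rightarrow> carrier V"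
  shows "O_span H m f \<subseteq> carrier V"
  unfolding O_span_def using assms by (auto simp: OF_ring_iff Pi_iff intro!: lincomb_closed)

lemma v_add_0_ge:
  assumes "x \<in> carrier V" "y \<in> carrier V" "r \<le> v (x 0)" "r \<le> v (y 0)"
  shows "r \<le> v ((x \<oplus>\<^bsub>V\<^esub> y) 0)"
  using assms by (auto simp: VH_simps carrier_VH_D intro: v_padd_ge)

lemma v_finsum_0_ge:
  assumes "finite A" "\<And>i. i \<in> A \<Longrightarrow> f i \<in> carrier V" "\<And>i. i \<in> A \<Longrightarrow> r \<le> v (f i 0)"
  shows "r \<le> v ((\<Oplus>\<^bsub>V\<^esub>i\<in>A. f i) 0)"
  using assms
proof (induction A)
  case (insert i A)
  then have "f i \<in> carrier V" "f \<in> A \<rightarrow> carrier V"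
    by auto
  with insert show ?case
    by (simp add: v_add_0_ge)
qed (simp add: VH_simps)

lemma v_finsum_0_gt:
  assumes "finite A" "\<And>i. i \<in> A \<Longrightarrow> f i \<in> carrier V" "\<And>i. i \<in> A \<Longrightarrow> ereal r < v (f i 0)"
  shows "ereal r < v ((\<Oplus>\<^bsub>V\<^esub>i\<in>A. f i) 0)"
proof -
  \<comment> \<open>The element \<open>\<infinity>\<close> keeps the minimum defined for empty A,
    and finiteness of A keeps it strictly above r.\<close>
  define s where "s = Min (insert \<infinity> ((\<lambda>i. v (f i 0)) ` A))"
  have "ereal r < s"
    unfolding s_def using assms(1,3) by (subst Min_gr_iff) auto
  also have "s \<le> v ((\<Oplus>\<^bsub>V\<^esub>i\<in>A. f i) 0)"
    using assms(1,2) by (intro v_finsum_0_ge) (auto simp: s_def)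
  finally show ?thesis .
qed

lemma v_smult_unit_0:
  assumes "x \<in> carrier V" "a \<in> base H" "v a = 0"
  shows "v ((a \<odot>\<^bsub>V\<^esub> x) 0) = v (x 0)"
  using assms by (simp add: smult_eq_OF OF_ring_iff v_pact_unit carrier_VH_D)

lemma v_smult_OF_0:
  assumes "x \<in> carrier V" "a \<in> \<O>"
  shows "v (x 0) \<le> v ((a \<odot>\<^bsub>V\<^esub> x) 0)"
  using assms by (simp add: smult_eq_OF v_pact_ge carrier_VH_D)

lemma Tate_iff: "x \<in> Tate H \<longleftrightarrow> x \<in> carrier V \<and> x 0 = 0"
  by (auto simp: Tate_def Fil_def)

lemma ex_unif_power_Tate:
  assumes x: "x \<in> carrier V"
  obtains k where "\<pi> ^ k \<odot>\<^bsub>V\<^esub> x \<in> Tate H"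
proof -
  have power: "pact H (\<pi> ^ k) (x (i + int k)) = x i" for k i
  proof (induction k arbitrary: i)
    case (Suc k)
    have "pact H (\<pi> ^ Suc k) (x (i + int (Suc k)))
        = pact H (\<pi> ^ k) (pact H \<pi> (x (i + int k + 1)))"
      using x OF_unif OF_unif_power by (simp add: pact_mult[symmetric] carrier_VH_D mult.commute add_ac)
    also have "\<dots> = x i"
      using Suc carrier_VH_D(2)[OF x] by simp
    finally show ?case .
  qed (simp add: pact_1 carrier_VH_D x)
  obtain N where N: "\<forall>i<N. x i = 0"
    using x by (auto simp: carrier_VH_iff)
  \<comment> \<open>Multiplication by \<open>\<pi> ^ k\<close> shifts indices by k, and this k
    brings index 0 to one below N, where x vanishes.\<close>
  define k where "k = nat (1 - N)"
  have "(\<pi> ^ k \<odot>\<^bsub>V\<^esub> x) 0 = x (- int k)"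
    using power[of k "- int k"] by (simp add: smult_eq_OF x OF_unif_power)
  also have "\<dots> = 0"
    using N by (simp add: k_def)
  finally have "\<pi> ^ k \<odot>\<^bsub>V\<^esub> x \<in> Tate H"
    using x by (simp add: Tate_iff smult_closed base_power unif_base)
  then show ?thesis
    using that by blast
qed

section \<open>The residue field\<close>

abbreviation q where "q \<equiv> residue_card H"

text \<open>Finiteness of the residue field comes from the height condition. An infinite set has
  \<open>card\<close> 0; then \<open>q ^ n\<close> would be 0 as n >= 1, and the constant
  coefficient of \<open>[\<pi>](T)\<close> would be a unit. Given finiteness, the classes of 0 and 1
  are two elements.\<close>

lemma residue_card_ge_2: "2 \<le> q"
proof -
  let ?r = "{(x, y). x \<in> \<O> \<and> y \<in> \<O> \<and> 0 < v (x - y)}"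
  have "q \<noteq> 0"
  proof
    assume "q = 0"
    then have "v (fps_nth (act H \<pi>) 0) = 0"
      using height_unit height_pos by (simp add: power_0_left)
    then show False
      using act_const[OF OF_unif] by simp
  qed
  then have "finite (\<O> // ?r)"
    using card.infinite by (fastforce simp: residue_card_def)
  moreover have "?r `` {0} \<in> \<O> // ?r" "?r `` {1} \<in> \<O> // ?r"
    by (rule quotientI[OF OF_0], rule quotientI[OF OF_1])
  moreover have "?r `` {0} \<noteq> ?r `` {1}"
  proof -
    have "0 \<in> ?r `` {0}" "0 \<notin> ?r `` {1}"
      using OF_0 OF_1 by auto
    then show ?thesis
      by blast
  qed
  ultimately have "card {?r `` {0}, ?r `` {1}} \<le> q"
    unfolding residue_card_def by (intro card_mono) auto
  then show ?thesis
    using \<open>?r `` {0} \<noteq> ?r `` {1}\<close> by simp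
qed

text \<open>These representatives are the digits with which distinct points of
  \<open>H[\<pi>]\<close> are produced.\<close>

lemma ex_residue_system:
  obtains R where "R \<subseteq> \<O>" "finite R" "card R = q" "\<And>x y. x \<in> R \<Longrightarrow> y \<in> R \<Longrightarrow> 0 < v (x - y) \<Longrightarrow> x = y"
proof -
  let ?r = "{(x, y). x \<in> \<O> \<and> y \<in> \<O> \<and> 0 < v (x - y)}"
  have fin: "finite (\<O> // ?r)"
    using card.infinite residue_card_ge_2 by (fastforce simp: residue_card_def)
  have equiv: "equiv \<O> ?r"
  proof (rule equivI)
    show "trans ?r"
    proof (rule transI, clarsimp)
      fix x y z assume "0 < v (x - y)" "0 < v (y - z)"
      then show "0 < v (x - z)"
        using v_add_gt[of 0 "x - y" "y - z"] by simp
    qed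
  qed (auto simp: refl_on_def sym_def v_minus_commute)
  define rep where "rep C = (SOME x. x \<in> C)" for C :: "'k set"
  have rep: "rep C \<in> C" if "C \<in> \<O> // ?r" for C
    unfolding rep_def using in_quotient_imp_non_empty[OF equiv that] by (simp add: some_in_eq)
  have inj: "C = D" if "C \<in> \<O> // ?r" "D \<in> \<O> // ?r" "0 < v (rep C - rep D)" for C D
  proof (rule quotient_eqI[OF equiv that(1,2) rep rep])
    show "(rep C, rep D) \<in> ?r"
      using that rep[OF that(1)] rep[OF that(2)] in_quotient_imp_subset[OF equiv] by blast
  qed (use that in auto)
  show ?thesis
  proof (rule that[of "rep ` (\<O> // ?r)"])
    show "rep ` (\<O> // ?r) \<subseteq> \<O>"
      using rep in_quotient_imp_subset[OF equiv] by blast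
    have "inj_on rep (\<O> // ?r)"
      by (rule inj_onI, rule inj) auto
    then show "card (rep ` (\<O> // ?r)) = q"
      by (simp add: card_image residue_card_def)
    show "x = y" if "x \<in> rep ` (\<O> // ?r)" "y \<in> rep ` (\<O> // ?r)" "0 < v (x - y)" for x y
      using that inj by blast
  qed (use fin in auto)
qed

end


section \<open>Slopes\<close>

locale adapted = pi_divisible_module +
  fixes lam :: "nat \<Rightarrow> real" and e :: "nat \<Rightarrow> int \<Rightarrow> 'a"
  assumes slopes: "is_slopes H n lam" and adapted: "adapted_basis H n lam e"
begin

abbreviation eta_H ("\<eta>") where "\<eta> \<equiv> eta H n lam"
definition eta_inv where "eta_inv = the_inv_into {0..} \<eta>"
abbreviation slope ("\<Lambda>") where "\<Lambda> i k \<equiv> iter H n lam k (lam i)"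

lemma lam_mono: "1 \<le> i \<Longrightarrow> i \<le> j \<Longrightarrow> j \<le> n \<Longrightarrow> lam j \<le> lam i"
  using slopes by (simp add: is_slopes_def)

lemma lam_pos: "1 \<le> i \<Longrightarrow> i \<le> n \<Longrightarrow> 0 < lam i"
  using slopes lam_mono[of i n] unfolding is_slopes_def by linarith

lemma residue_power_le: "q ^ (i - 1) \<le> q ^ i"
  using residue_card_ge_2 by (intro power_increasing) auto

lemma sum_residue_powers: "(\<Sum>i = 1..m. real q ^ i - real q ^ (i - 1)) = real q ^ m - 1"
  by (induction m) auto

lemma eta_diff_ge:
  assumes "s \<le> t"
  shows "t - s \<le> \<eta> t - \<eta> s"
proof -
  have "(\<Sum>i = 1..n. (real q ^ i - real q ^ (i - 1)) * min s (lam i))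
      \<le> (\<Sum>i = 1..n. (real q ^ i - real q ^ (i - 1)) * min t (lam i))"
  proof (intro sum_mono mult_left_mono)
    fix i
    show "0 \<le> real q ^ i - real q ^ (i - 1)"
      using residue_power_le[of i] by (simp flip: of_nat_power)
  qed (use assms in auto)
  then show ?thesis
    by (simp add: eta_def)
qed

lemma eta_strict_mono: "s < t \<Longrightarrow> \<eta> s < \<eta> t"
  using eta_diff_ge[of s t] by simp

lemma eta_less_iff: "\<eta> s < \<eta> t \<longleftrightarrow> s < t"
  using eta_strict_mono[of s t] eta_strict_mono[of t s] by (cases s t rule: linorder_cases) auto

text \<open>All minima equal s, and the weights telescope to q^n - 1.\<close>

lemma eta_small: "s \<le> lam n \<Longrightarrow> \<eta> s = real q ^ n * s"
proof -
  assume s: "s \<le> lam n"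
  have "(\<Sum>i = 1..n. (real q ^ i - real q ^ (i - 1)) * min s (lam i))
      = (\<Sum>i = 1..n. (real q ^ i - real q ^ (i - 1)) * s)"
    using lam_mono s by (intro sum.cong) (auto simp: min_def dest: order_trans)
  also have "\<dots> = (real q ^ n - 1) * s"
    by (simp only: sum_distrib_right[symmetric] sum_residue_powers)
  finally show ?thesis
    by (simp add: eta_def algebra_simps)
qed

lemma eta_0: "\<eta> 0 = 0"
  using eta_small[of 0] lam_pos[of n] height_pos by simp

lemma eta_bij: "bij_betw \<eta> {0..} {0..}"
  unfolding bij_betw_def
proof
  show "inj_on \<eta> {0..}"
    by (metis eta_less_iff inj_onI linorder_neq_iff)
  have "\<exists>s\<ge>0. \<eta> s = t" if "0 \<le> t" for t
  proof -
    have "continuous_on {0..t} \<eta>"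
      unfolding eta_def by (intro continuous_intros)
    moreover have "t \<le> \<eta> t"
      using eta_diff_ge[of 0 t] eta_0 that by simp
    ultimately show ?thesis
      using IVT'[of \<eta> 0 t t] eta_0 that by auto
  qed
  moreover have "0 \<le> \<eta> s" if "0 \<le> s" for s
    using eta_diff_ge[of 0 s] eta_0 that by simp
  ultimately show "\<eta> ` {0..} = {0..}"
    by (auto simp: image_iff Bex_def)
qed

lemma eta_inv_nonneg: "0 \<le> s \<Longrightarrow> 0 \<le> eta_inv s"
  using bij_betwE[OF bij_betw_the_inv_into[OF eta_bij]] by (simp add: eta_inv_def)

lemma eta_eta_inv: "0 \<le> s \<Longrightarrow> \<eta> (eta_inv s) = s"
  unfolding eta_inv_def using eta_bij by (intro f_the_inv_into_f) (auto simp: bij_betw_def)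

lemma eta_inv_less_iff: "0 \<le> s \<Longrightarrow> 0 \<le> t \<Longrightarrow> eta_inv s < eta_inv t \<longleftrightarrow> s < t"
  using eta_less_iff[of "eta_inv s" "eta_inv t"] by (simp add: eta_eta_inv)

lemma eta_inv_pos: "0 < s \<Longrightarrow> 0 < eta_inv s"
  using eta_less_iff[of 0 "eta_inv s"] by (simp add: eta_eta_inv eta_0)

lemma residue_power_gt_1: "1 < real q ^ n"
  using residue_card_ge_2 height_pos by (intro one_less_power) auto

lemma eta_gt: "0 < s \<Longrightarrow> s < \<eta> s"
proof -
  assume s: "0 < s"
  \<comment> \<open>On the linear piece the inequality is explicit, and \<open>\<eta> s - s\<close>
    does not decrease afterwards.\<close>
  let ?t = "min s (lam n)"
  have "?t > 0"
    using s lam_pos[of n] height_pos by simp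
  then have "?t < real q ^ n * ?t"
    using residue_power_gt_1 by simp
  then show ?thesis
    using eta_diff_ge[of ?t s] eta_small[of ?t] by simp
qed

lemma eta_inv_less: "0 < s \<Longrightarrow> eta_inv s < s"
  using eta_gt[of "eta_inv s"] eta_inv_pos[of s] by (simp add: eta_eta_inv)

lemma iter_1: "iter H n lam 1 s = s"
  by (simp add: iter_def)

lemma iter_Suc: "1 \<le> k \<Longrightarrow> iter H n lam (Suc k) s = eta_inv (iter H n lam k s)"
  by (cases k) (simp_all add: iter_def eta_inv_def)

lemma iter_add: "1 \<le> k \<Longrightarrow> iter H n lam (k + j) s = (eta_inv ^^ j) (iter H n lam k s)"
  by (induction j) (auto simp: iter_Suc)

lemma iter_pos: "1 \<le> k \<Longrightarrow> 0 < s \<Longrightarrow> 0 < iter H n lam k s"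
  by (induction k rule: dec_induct) (auto simp: iter_1[simplified] iter_Suc eta_inv_pos)

lemma eta_iter: "1 \<le> k \<Longrightarrow> 0 < s \<Longrightarrow> \<eta> (iter H n lam (Suc k) s) = iter H n lam k s"
  using iter_pos[of k s] by (simp add: iter_Suc eta_eta_inv)

lemma iter_strict_antimono:
  assumes "1 \<le> k" "k < k'" "0 < s"
  shows "iter H n lam k' s < iter H n lam k s"
  using assms(2)
proof (induction k')
  case (Suc k')
  then have "iter H n lam (Suc k') s < iter H n lam k' s"
    using assms iter_pos[of k' s] by (simp add: iter_Suc eta_inv_less)
  with Suc show ?case
    by (cases "k = k'") auto
qed simp

section \<open>Torsion points and multiplication by the uniformizer\<close>

definition torsion :: "'a set" where
  "torsion = {x \<in> points H. pact H \<pi> x = 0 \<and> x \<noteq> 0}"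

text \<open>The multiset of slopes in a form applicable to any f: a constant gives finiteness, an
  indicator the number of points above a threshold, and a minimum gives
  \<open>\<eta>\<close>.\<close>

lemma sum_torsion:
  fixes f :: "ereal \<Rightarrow> 'b::comm_semiring_1"
  shows "(\<Sum>z\<in>torsion. f (v z)) = (\<Sum>i = 1..n. of_nat (q ^ i - q ^ (i - 1)) * f (ereal (lam i)))"
proof -
  have *: "sum_mset (image_mset f (\<Sum>i\<in>A. M i)) = (\<Sum>i\<in>A. sum_mset (image_mset f (M i)))"
    for A :: "nat set" and M
    by (induction A rule: infinite_finite_induct) auto
  have "(\<Sum>z\<in>torsion. f (v z)) = sum_mset (image_mset f (image_mset v (mset_set torsion)))"
    by (simp add: sum_unfold_sum_mset image_mset.compositionality comp_def)
  also have "image_mset v (mset_set torsion)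
      = (\<Sum>i\<in>{1..n}. replicate_mset (q ^ i - q ^ (i - 1)) (ereal (lam i)))"
    using slopes by (simp add: is_slopes_def torsion_def)
  also have "sum_mset (image_mset f \<dots>) = (\<Sum>i = 1..n. of_nat (q ^ i - q ^ (i - 1)) * f (ereal (lam i)))"
    unfolding * by (simp only: image_replicate_mset sum_mset_replicate_mset)
  finally show ?thesis .
qed

text \<open>A sum over an infinite set is 0 by convention, whereas the slopes make the sum of ones
  at least q - 1.\<close>

lemma finite_torsion: "finite torsion"
proof -
  have "q ^ 1 - q ^ (1 - 1) \<le> (\<Sum>i = 1..n. q ^ i - q ^ (i - 1))"
    using height_pos by (intro member_le_sum) auto
  also have "\<dots> = (\<Sum>z\<in>torsion. 1)"
    using sum_torsion[of "\<lambda>_. 1::nat"] by simp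
  also have "\<dots> = card torsion"
    by simp
  finally show ?thesis
    using residue_card_ge_2 by (intro card_ge_0_finite) simp
qed

lemma ex_slope_index:
  obtains r where "r \<le> n" "\<And>i. 1 \<le> i \<Longrightarrow> i \<le> n \<Longrightarrow> m < lam i \<longleftrightarrow> i \<le> r"
proof -
  define r where "r = Max (insert 0 {i \<in> {1..n}. m < lam i})"
  have fin: "finite (insert 0 {i \<in> {1..n}. m < lam i})"
    by simp
  have r: "r = 0 \<or> (r \<in> {1..n} \<and> m < lam r)"
    using Max_in[OF fin] by (auto simp: r_def)
  have "m < lam i \<longleftrightarrow> i \<le> r" if "1 \<le> i" "i \<le> n" for i
  proof
    show "i \<le> r" if "m < lam i"
      unfolding r_def using that \<open>1 \<le> i\<close> \<open>i \<le> n\<close> by (intro Max_ge) auto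
    show "m < lam i" if "i \<le> r"
      using r that \<open>1 \<le> i\<close> lam_mono[of i r] by auto
  qed
  then show ?thesis
    using that r by fastforce
qed

text \<open>The origin supplies the 1 that completes the telescoping sum of q^i - q^(i-1) for i <=
  r.\<close>

lemma card_torsion_gt:
  assumes "r \<le> n" "\<And>i. 1 \<le> i \<Longrightarrow> i \<le> n \<Longrightarrow> m < lam i \<longleftrightarrow> i \<le> r"
  shows "card {x \<in> points H. pact H \<pi> x = 0 \<and> ereal m < v x} = q ^ r"
proof -
  have telescope: "(\<Sum>i = 1..r. q ^ i - q ^ (i - 1)) + 1 = q ^ r"
  proof (induction r)
    case (Suc r)
    then show ?case
      using residue_power_le[of "Suc r"] by (simp del: power_Suc)
  qed simp
  have "{x \<in> points H. pact H \<pi> x = 0 \<and> ereal m < v x}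
      = insert 0 {x \<in> torsion. ereal m < v x}"
    by (auto simp: torsion_def pact_0_right OF_unif)
  then have "card {x \<in> points H. pact H \<pi> x = 0 \<and> ereal m < v x}
      = card {x \<in> torsion. ereal m < v x} + 1"
  proof -
    have "0 \<notin> {x \<in> torsion. ereal m < v x}" "finite {x \<in> torsion. ereal m < v x}"
      using finite_torsion by (simp add: torsion_def, elim finite_subset[rotated]) blast
    then show ?thesis
      using \<open>_ = insert 0 _\<close> by simp
  qed
  also have "card {x \<in> torsion. ereal m < v x} = (\<Sum>z\<in>torsion. if ereal m < v z then 1 else 0)"
    using finite_torsion by (simp add: sum.If_cases Int_def)
  also have "\<dots> = (\<Sum>i = 1..n. (q ^ i - q ^ (i - 1)) * (if m < lam i then 1 else 0))"
    using sum_torsion[of "\<lambda>t. if ereal m < t then 1 else (0::nat)"] by simp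
  also have "\<dots> = (\<Sum>i = 1..r. q ^ i - q ^ (i - 1))"
    using assms by (intro sum.mono_neutral_cong_right) auto
  finally show ?thesis
    using telescope by simp
qed

text \<open>The origin and the points of \<open>torsion\<close> are distinct zeros of
  \<open>[\<pi>](T)\<close>. Bounding v(x - z) by min (v x) (v z) and summing gives exactly
  \<open>\<eta> s\<close>.\<close>

lemma v_unif_ge:
  assumes x: "x \<in> points H" and s: "v x = ereal s"
  shows "ereal (\<eta> s) \<le> v (pact H \<pi> x)"
proof -
  have z: "pact H \<pi> z = 0" "0 < v z" if "z \<in> insert 0 torsion" for z
    using that by (auto simp: torsion_def points_iff pact_0_right OF_unif)
  \<comment> \<open>Real-valued, because \<open>sum_torsion\<close> needs values in a semiring and
    extended reals fail distributivity.\<close>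
  define f where "f t = real_of_ereal (min (ereal s) t)" for t
  have f: "ereal (f (v z)) = min (v x) (v z)" for z
    unfolding f_def s by (cases "v z") (auto simp: min_def)
  have "(\<Sum>z\<in>torsion. f (v z)) = (\<Sum>i = 1..n. (real q ^ i - real q ^ (i - 1)) * min s (lam i))"
    unfolding sum_torsion
  proof (rule sum.cong[OF refl])
    fix i
    have "f (ereal (lam i)) = min s (lam i)"
      by (simp add: f_def min_def)
    then show "real (q ^ i - q ^ (i - 1)) * f (ereal (lam i))
        = (real q ^ i - real q ^ (i - 1)) * min s (lam i)"
      using residue_power_le[of i] by (simp only: of_nat_diff of_nat_power)
  qed
  then have "ereal (\<eta> s) = v x + ereal (\<Sum>z\<in>torsion. f (v z))"
    by (simp add: s eta_def)
  also have "\<dots> = v x + (\<Sum>z\<in>torsion. min (v x) (v z))"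
    by (simp add: f flip: sum_ereal)
  also have "\<dots> \<le> v x + (\<Sum>z\<in>torsion. v (x - z))"
    by (intro add_mono sum_mono v_diff_ge) auto
  also have "\<dots> = (\<Sum>z\<in>insert 0 torsion. v (x - z))"
    using finite_torsion by (simp add: torsion_def)
  also have "\<dots> \<le> v (pact H \<pi> x)"
    unfolding pact_eq_ev using finite_torsion z x
    by (intro v_ev_ge_sum_zeros integral_act OF_unif) (auto simp: pact_eq_ev points_iff)
  finally show ?thesis .
qed


section \<open>Coordinates in an adapted basis\<close>

lemma e_Tate: "i \<in> {1..n} \<Longrightarrow> e i \<in> Tate H"
  using adapted by (simp add: adapted_basis_def)

lemma e_carrier: "i \<in> {1..n} \<Longrightarrow> e i \<in> carrier V"
  using e_Tate by (simp add: Tate_iff)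

text \<open>An adapted basis prescribes the values at powers of the inverse uniformizer; a unit
  factor does not change them.\<close>

lemma v_coeff_neg:
  assumes "i \<in> {1..n}" "c \<in> base H" "v c = ereal (- real k)" "1 \<le> k"
  shows "v ((c \<odot>\<^bsub>V\<^esub> e i) 0) = ereal (\<Lambda> i k)"
proof -
  have "c = (c * \<pi> ^ k) * inverse \<pi> ^ k"
    by (simp add: power_inverse)
  moreover have base: "c * \<pi> ^ k \<in> base H" "inverse \<pi> ^ k \<in> base H"
    using assms by (auto intro: base_mult base_power base_inverse unif_base)
  ultimately have "c \<odot>\<^bsub>V\<^esub> e i = (c * \<pi> ^ k) \<odot>\<^bsub>V\<^esub> (inverse \<pi> ^ k \<odot>\<^bsub>V\<^esub> e i)"
    using mult_smult[OF e_carrier[OF assms(1)] base] by metis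
  moreover have "v (c * \<pi> ^ k) = 0"
    using assms(3) by (simp add: v_mult zero_ereal_def)
  ultimately have "v ((c \<odot>\<^bsub>V\<^esub> e i) 0) = v ((inverse \<pi> ^ k \<odot>\<^bsub>V\<^esub> e i) 0)"
    using base assms(1) by (simp add: v_smult_unit_0 smult_closed e_carrier)
  then show ?thesis
    using adapted assms by (simp add: adapted_basis_def)
qed

lemma coeff_OF: "i \<in> {1..n} \<Longrightarrow> c \<in> \<O> \<Longrightarrow> (c \<odot>\<^bsub>V\<^esub> e i) 0 = 0"
  using e_Tate[of i] by (simp add: smult_eq_OF Tate_iff pact_0_right)

lemma base_cases:
  assumes "c \<in> base H"
  obtains "c \<in> \<O>" | k where "1 \<le> k" "v c = ereal (- real k)"
proof (cases "c \<in> \<O>")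
  case False
  then have "c \<noteq> 0" "v c < 0"
    using assms by (auto simp: OF_ring_iff OF_0 not_le)
  then obtain z :: int where z: "v c = ereal (of_int z)"
    using val_base assms by blast
  then have "z < 0"
    using \<open>v c < 0\<close> by (simp add: zero_ereal_def)
  then show ?thesis
    using that(2)[of "nat (- z)"] z by simp
qed (use that in auto)

abbreviation coord_comb ("\<Sigma>") where "\<Sigma> c \<equiv> lincomb H n c e"

lemma comb_closed: "(\<And>i. i \<in> {1..n} \<Longrightarrow> c i \<in> base H) \<Longrightarrow> \<Sigma> c \<in> carrier V"
  by (rule lincomb_closed[OF e_carrier])

lemma comb_cong:
  "(\<And>i. i \<in> {1..n} \<Longrightarrow> c i \<in> base H) \<Longrightarrow> (\<And>i. i \<in> {1..n} \<Longrightarrow> c i = d i) \<Longrightarrow> \<Sigma> c = \<Sigma> d"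
  by (rule lincomb_cong[OF e_carrier])

lemma comb_add:
  "(\<And>i. i \<in> {1..n} \<Longrightarrow> c i \<in> base H) \<Longrightarrow> (\<And>i. i \<in> {1..n} \<Longrightarrow> d i \<in> base H) \<Longrightarrow>
    \<Sigma> c \<oplus>\<^bsub>V\<^esub> \<Sigma> d = \<Sigma> (\<lambda>i. c i + d i)"
  by (rule lincomb_add[OF e_carrier])

lemma smult_comb:
  "(\<And>i. i \<in> {1..n} \<Longrightarrow> c i \<in> base H) \<Longrightarrow> a \<in> base H \<Longrightarrow> a \<odot>\<^bsub>V\<^esub> \<Sigma> c = \<Sigma> (\<lambda>i. a * c i)"
  by (rule smult_lincomb[OF e_carrier])

lemma v_comb_ge:
  assumes "\<And>i. i \<in> {1..n} \<Longrightarrow> c i \<in> base H" "\<And>i. i \<in> {1..n} \<Longrightarrow> r \<le> v ((c i \<odot>\<^bsub>V\<^esub> e i) 0)"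
  shows "r \<le> v (\<Sigma> c 0)"
  unfolding lincomb_def using assms by (intro v_finsum_0_ge) (auto simp: smult_closed e_carrier)

lemma v_comb_gt:
  assumes "\<And>i. i \<in> {1..n} \<Longrightarrow> c i \<in> base H" "\<And>i. i \<in> {1..n} \<Longrightarrow> ereal r < v ((c i \<odot>\<^bsub>V\<^esub> e i) 0)"
  shows "ereal r < v (\<Sigma> c 0)"
  unfolding lincomb_def using assms by (intro v_finsum_0_gt) (auto simp: smult_closed e_carrier)

lemma comb_OF_0: "(\<And>i. i \<in> {1..n} \<Longrightarrow> c i \<in> \<O>) \<Longrightarrow> \<Sigma> c 0 = 0"
  using v_comb_ge[of c \<infinity>] by (simp add: coeff_OF OF_ring_iff)

lemma comb_eq_OF:
  assumes c: "\<And>i. i \<in> {1..n} \<Longrightarrow> c i \<in> \<O>" and d: "\<And>i. i \<in> {1..n} \<Longrightarrow> d i \<in> \<O>"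
    and eq: "\<Sigma> c = \<Sigma> d" and i: "i \<in> {1..n}"
  shows "c i = d i"
proof -
  have "\<Sigma> c \<in> Tate H"
    using c comb_OF_0[of c] comb_closed[of c] by (simp add: Tate_iff OF_ring_iff)
  then have ex1: "\<exists>!c'. c' \<in> {1..n} \<rightarrow>\<^sub>E \<O> \<and> \<Sigma> c = \<Sigma> c'"
    using adapted by (simp add: adapted_basis_def)
  have "\<Sigma> c = \<Sigma> (restrict c {1..n})" "\<Sigma> d = \<Sigma> (restrict d {1..n})"
    using c d by (auto intro!: comb_cong simp: OF_ring_iff)
  then have "restrict c {1..n} = restrict d {1..n}"
    using ex1 c d eq by (metis restrict_PiE_iff)
  then show ?thesis
    using i by (metis restrict_apply')
qed

lemma ex_common_denominator:
  assumes "\<And>i. i \<in> {1..n} \<Longrightarrow> c i \<in> base H"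
  obtains k where "\<And>i. i \<in> {1..n} \<Longrightarrow> \<pi> ^ k * c i \<in> \<O>"
proof -
  have "\<exists>k. \<pi> ^ k * c i \<in> \<O>" if "i \<in> {1..n}" for i
    by (rule ex_unif_power_integral[OF assms[OF that]]) (rule exI)
  then obtain k where k: "\<And>i. i \<in> {1..n} \<Longrightarrow> \<pi> ^ k i * c i \<in> \<O>"
    by metis
  have "k i \<le> (\<Sum>i\<in>{1..n}. k i)" if "i \<in> {1..n}" for i
    using that by (intro member_le_sum) auto
  then show ?thesis
    using OF_unif_power_mono k that by blast
qed

lemma comb_eqD:
  assumes c: "\<And>i. i \<in> {1..n} \<Longrightarrow> c i \<in> base H" and d: "\<And>i. i \<in> {1..n} \<Longrightarrow> d i \<in> base H"
    and eq: "\<Sigma> c = \<Sigma> d" and i: "i \<in> {1..n}"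
  shows "c i = d i"
proof -
  obtain k1 k2 where k: "\<And>i. i \<in> {1..n} \<Longrightarrow> \<pi> ^ k1 * c i \<in> \<O>" "\<And>i. i \<in> {1..n} \<Longrightarrow> \<pi> ^ k2 * d i \<in> \<O>"
    using ex_common_denominator[of c] ex_common_denominator[of d] c d by metis
  define k where "k = k1 + k2"
  have "\<pi> ^ k * c i = \<pi> ^ k * d i"
  proof (rule comb_eq_OF[where i = i])
    show "\<pi> ^ k * c i \<in> \<O>" "\<pi> ^ k * d i \<in> \<O>" if "i \<in> {1..n}" for i
      using k that OF_unif_power_mono[of k1 "c i" k] OF_unif_power_mono[of k2 "d i" k] by (auto simp: k_def)
    show "\<Sigma> (\<lambda>i. \<pi> ^ k * c i) = \<Sigma> (\<lambda>i. \<pi> ^ k * d i)"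
      using smult_comb[of c "\<pi> ^ k"] smult_comb[of d "\<pi> ^ k"] c d eq base_power[OF unif_base] by simp
  qed (rule i)
  then show ?thesis
    by simp
qed

lemma ex_coords:
  assumes x: "x \<in> carrier V"
  obtains c where "\<And>i. i \<in> {1..n} \<Longrightarrow> c i \<in> base H" "x = \<Sigma> c"
proof -
  obtain k where "\<pi> ^ k \<odot>\<^bsub>V\<^esub> x \<in> Tate H"
    using ex_unif_power_Tate[OF x] .
  then have "\<exists>!c. c \<in> {1..n} \<rightarrow>\<^sub>E \<O> \<and> \<pi> ^ k \<odot>\<^bsub>V\<^esub> x = \<Sigma> c"
    using adapted by (simp add: adapted_basis_def)
  then obtain c where c: "c \<in> {1..n} \<rightarrow>\<^sub>E \<O>" "\<pi> ^ k \<odot>\<^bsub>V\<^esub> x = \<Sigma> c"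
    by blast
  have base: "\<pi> ^ k \<in> base H" "inverse (\<pi> ^ k) \<in> base H" "\<And>i. i \<in> {1..n} \<Longrightarrow> c i \<in> base H"
    using c(1) by (auto simp: base_power base_inverse unif_base OF_ring_iff PiE_iff)
  have "x = inverse (\<pi> ^ k) \<odot>\<^bsub>V\<^esub> (\<pi> ^ k \<odot>\<^bsub>V\<^esub> x)"
    using mult_smult[OF x base(2,1)] one_smult[OF x] by simp
  also have "\<dots> = \<Sigma> (\<lambda>i. inverse (\<pi> ^ k) * c i)"
    unfolding c(2) using base by (intro smult_comb)
  finally show ?thesis
    using that[of "\<lambda>i. inverse (\<pi> ^ k) * c i"] base by (auto intro: base_mult)
qed

lemma OF_if_comb_0:
  assumes c: "\<And>i. i \<in> {1..n} \<Longrightarrow> c i \<in> base H" and 0: "\<Sigma> c 0 = 0" and i: "i \<in> {1..n}"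
  shows "c i \<in> \<O>"
proof -
  have "\<Sigma> c \<in> Tate H"
    using comb_closed[OF c] 0 by (simp add: Tate_iff)
  then have "\<exists>!d. d \<in> {1..n} \<rightarrow>\<^sub>E \<O> \<and> \<Sigma> c = \<Sigma> d"
    using adapted by (simp add: adapted_basis_def)
  then obtain d where d: "d \<in> {1..n} \<rightarrow>\<^sub>E \<O>" "\<Sigma> c = \<Sigma> d"
    by blast
  then have "c i = d i"
    using c i by (intro comb_eqD) (auto simp: OF_ring_iff PiE_iff)
  then show ?thesis
    using d i by auto
qed

text \<open>The component at 0 sees an element of V modulo the Tate module, hence its coordinates
  modulo \<open>\<O>\<close>. The difference is built with the scalar -1, and
  \<open>pact_add\<close> for 1 and -1 shows that its component at 0 vanishes.\<close>

lemma comb_eq_0_component: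
  assumes c: "\<And>i. i \<in> {1..n} \<Longrightarrow> c i \<in> base H" and d: "\<And>i. i \<in> {1..n} \<Longrightarrow> d i \<in> base H"
    and eq: "\<Sigma> c 0 = \<Sigma> d 0" and i: "i \<in> {1..n}"
  shows "c i - d i \<in> \<O>"
proof -
  have m1: "- 1 \<in> \<O>" "- 1 \<in> base H"
    using OF_uminus OF_1 base_uminus base_1 by auto
  have closed: "\<Sigma> c \<in> carrier V" "\<Sigma> d \<in> carrier V"
    using c d by (auto intro: comb_closed)
  have "\<Sigma> (\<lambda>i. c i + (- 1) * d i) = \<Sigma> c \<oplus>\<^bsub>V\<^esub> \<Sigma> (\<lambda>i. (- 1) * d i)"
    using c d m1 by (intro comb_add[symmetric]) (auto intro: base_uminus)
  also have "\<Sigma> (\<lambda>i. (- 1) * d i) = (- 1) \<odot>\<^bsub>V\<^esub> \<Sigma> d"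
    using d m1 by (intro smult_comb[symmetric])
  finally have "\<Sigma> (\<lambda>i. c i + (- 1) * d i) 0 = padd H (\<Sigma> d 0) (pact H (- 1) (\<Sigma> d 0))"
    using closed m1 by (simp add: VH_simps smult_eq_OF eq)
  also have "\<dots> = padd H (pact H 1 (\<Sigma> d 0)) (pact H (- 1) (\<Sigma> d 0))"
    using closed by (simp add: pact_1 carrier_VH_D)
  also have "\<dots> = pact H (1 + (- 1)) (\<Sigma> d 0)"
    using closed m1 OF_1 by (intro pact_add[symmetric]) (auto simp: carrier_VH_D)
  also have "\<dots> = 0"
    using closed by (simp add: pact_0_left carrier_VH_D)
  finally have "c i + (- 1) * d i \<in> \<O>"
    using c d i by (intro OF_if_comb_0[where c = "\<lambda>i. c i + (- 1) * d i"]) (auto simp: base_diff)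
  then show ?thesis
    by simp
qed

text \<open>
  The \<open>q\<^sup>r\<close> combinations of the \<open>\<pi>\<^sup>-\<^sup>1 e\<^sub>i\<close> with \<open>\<lambda>\<^sub>i > m\<close> exhaust the \<open>q\<^sup>r\<close> points of \<open>H[\<pi>]\<close> of
  valuation \<open>> m\<close>.
\<close>
lemma coeff_divisible_if_v_comb_gt:
  assumes c: "\<And>i. i \<in> {1..n} \<Longrightarrow> c i \<in> base H" "\<And>i. i \<in> {1..n} \<Longrightarrow> \<pi> * c i \<in> \<O>"
    and m: "ereal m < v (\<Sigma> c 0)" and i: "i \<in> {1..n}" "lam i \<le> m"
  shows "c i \<in> \<O>"
proof -
  obtain r where r: "r \<le> n" "\<And>i. 1 \<le> i \<Longrightarrow> i \<le> n \<Longrightarrow> m < lam i \<longleftrightarrow> i \<le> r"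
    using ex_slope_index[of m] by blast
  obtain R where R: "R \<subseteq> \<O>" "finite R" "card R = q" "\<And>x y. x \<in> R \<Longrightarrow> y \<in> R \<Longrightarrow> 0 < v (x - y) \<Longrightarrow> x = y"
    using ex_residue_system by blast
  let ?U = "{x \<in> points H. pact H \<pi> x = 0 \<and> ereal m < v x}"
  \<comment> \<open>The coefficients are digits divided by \<open>\<pi>\<close>, placed only in the
    first r positions, where the slopes exceed m.\<close>
  define \<gamma> where "\<gamma> d i = (if i \<le> r then inverse \<pi> * d i else 0)" for d and i :: nat
  define \<Phi> where "\<Phi> d = \<Sigma> (\<gamma> d) 0" for d
  let ?D = "{1..r} \<rightarrow>\<^sub>E R"
  have \<gamma>: "\<gamma> d i \<in> base H" "\<pi> * \<gamma> d i \<in> \<O>" if "d \<in> ?D" "i \<in> {1..n}" for d i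
  proof -
    have "i \<le> r \<Longrightarrow> d i \<in> \<O>"
      using that R(1) by auto
    then show "\<gamma> d i \<in> base H"
      by (auto simp: \<gamma>_def base_0 OF_ring_iff unif_base base_mult base_inverse)
    have "\<pi> * (inverse \<pi> * d i) = d i"
      by (simp add: mult.assoc[symmetric])
    with \<open>i \<le> r \<Longrightarrow> d i \<in> \<O>\<close> have "i \<le> r \<Longrightarrow> \<pi> * (inverse \<pi> * d i) \<in> \<O>"
      by metis
    then show "\<pi> * \<gamma> d i \<in> \<O>"
      by (auto simp: \<gamma>_def OF_0)
  qed
  have killed: "pact H \<pi> (\<Sigma> c 0) = 0"
    if "\<And>i. i \<in> {1..n} \<Longrightarrow> c i \<in> base H" "\<And>i. i \<in> {1..n} \<Longrightarrow> \<pi> * c i \<in> \<O>" for c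
  proof -
    have "pact H \<pi> (\<Sigma> c 0) = (\<pi> \<odot>\<^bsub>V\<^esub> \<Sigma> c) 0"
      using comb_closed[OF that(1)] by (simp add: smult_eq_OF OF_unif)
    also have "\<dots> = \<Sigma> (\<lambda>i. \<pi> * c i) 0"
      using smult_comb[OF that(1) unif_base] by simp
    also have "\<dots> = 0"
      using that by (intro comb_OF_0)
    finally show ?thesis .
  qed
  have inj: "inj_on \<Phi> ?D"
  proof (rule inj_onI)
    fix d d' assume d: "d \<in> ?D" "d' \<in> ?D" and "\<Phi> d = \<Phi> d'"
    then have diff: "\<gamma> d i - \<gamma> d' i \<in> \<O>" if "i \<in> {1..n}" for i
      using that \<gamma> by (intro comb_eq_0_component) (auto simp: \<Phi>_def)
    show "d = d'"
    proof (rule PiE_ext[OF d])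
      fix j assume j: "j \<in> {1..r}"
      then have jR: "d j \<in> R" "d' j \<in> R"
        using d by auto
      have "inverse \<pi> * (d j - d' j) \<in> \<O>"
        using diff[of j] j r(1) by (simp add: \<gamma>_def right_diff_distrib)
      \<comment> \<open>Two digits whose difference is divisible by \<open>\<pi>\<close> represent
        the same residue class, hence coincide.\<close>
      then have "0 + 1 \<le> v (inverse \<pi> * (d j - d' j)) + v \<pi>"
        unfolding OF_ring_iff val_unif by (intro add_mono) auto
      also have "\<dots> = v (inverse \<pi> * (d j - d' j) * \<pi>)"
        by (simp only: v_mult)
      also have "inverse \<pi> * (d j - d' j) * \<pi> = d j - d' j"
        by simp
      finally have "0 < v (d j - d' j)"
        by (simp add: less_le_trans[rotated])
      then show "d j = d' j"
        using R(4) jR by blast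
    qed
  qed
  have sub: "\<Phi> ` ?D \<subseteq> ?U"
  proof clarify
    fix d assume d: "d \<in> ?D"
    have "ereal m < v ((\<gamma> d i \<odot>\<^bsub>V\<^esub> e i) 0)" if i: "i \<in> {1..n}" for i
    proof (cases "i \<le> r")
      case True
      then have dO: "d i \<in> \<O>"
        using d i R(1) by auto
      have "ereal m < ereal (\<Lambda> i 1)"
        using r(2)[of i] True i by (simp add: iter_1[simplified])
      also have "\<dots> = v ((inverse \<pi> ^ 1 \<odot>\<^bsub>V\<^esub> e i) 0)"
        using i by (intro v_coeff_neg[symmetric])
          (auto simp: base_inverse unif_base v_inverse val_unif one_ereal_def)
      also have "\<dots> \<le> v ((d i \<odot>\<^bsub>V\<^esub> (inverse \<pi> ^ 1 \<odot>\<^bsub>V\<^esub> e i)) 0)"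
        using i dO by (intro v_smult_OF_0 smult_closed e_carrier) (auto simp: base_inverse unif_base)
      also have "d i \<odot>\<^bsub>V\<^esub> (inverse \<pi> ^ 1 \<odot>\<^bsub>V\<^esub> e i) = \<gamma> d i \<odot>\<^bsub>V\<^esub> e i"
        using mult_smult[OF e_carrier[OF i], of "d i" "inverse \<pi>"] dO True
        by (simp add: \<gamma>_def OF_ring_iff base_inverse unif_base mult.commute)
      finally show ?thesis .
    qed (use i coeff_OF[of i 0] in \<open>simp add: \<gamma>_def OF_0\<close>)
    then have "ereal m < v (\<Phi> d)"
      unfolding \<Phi>_def using \<gamma>(1)[OF d] by (intro v_comb_gt)
    moreover have "\<Phi> d \<in> points H"
      unfolding \<Phi>_def using carrier_VH_D(1)[OF comb_closed] \<gamma>(1)[OF d] by blast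
    moreover have "pact H \<pi> (\<Phi> d) = 0"
      unfolding \<Phi>_def using \<gamma>[OF d] by (intro killed)
    ultimately show "\<Phi> d \<in> points H \<and> pact H \<pi> (\<Phi> d) = 0 \<and> ereal m < v (\<Phi> d)"
      by blast
  qed
  have "card (\<Phi> ` ?D) = q ^ r"
    using inj R(3) by (simp add: card_image card_PiE)
  moreover have card_U: "card ?U = q ^ r"
    by (rule card_torsion_gt[OF r])
  moreover have "finite ?U"
    using card_U residue_card_ge_2 by (intro card_ge_0_finite) simp
  ultimately have "\<Phi> ` ?D = ?U"
    using sub by (intro card_subset_eq) auto
  moreover have "\<Sigma> c 0 \<in> ?U"
    using killed[OF c] m carrier_VH_D(1)[OF comb_closed[OF c(1)]] by simp
  ultimately obtain d where d: "d \<in> ?D" "\<Sigma> c 0 = \<Sigma> (\<gamma> d) 0"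
    unfolding \<Phi>_def by blast
  then have "c i - \<gamma> d i \<in> \<O>"
    using c(1) \<gamma>(1) i(1) by (intro comb_eq_0_component)
  moreover have "\<gamma> d i = 0"
    using r(2)[of i] i by (auto simp: \<gamma>_def)
  ultimately show ?thesis
    by simp
qed

lemma v_unif_smult_gt:
  assumes x: "x \<in> carrier V" and s: "ereal s < v (x 0)"
  shows "ereal (\<eta> s) < v ((\<pi> \<odot>\<^bsub>V\<^esub> x) 0)"
proof (cases rule: v_cases[of "x 0"])
  case 1
  then show ?thesis
    using x by (simp add: smult_eq_OF OF_unif pact_0_right)
next
  case (2 t)
  then have "ereal (\<eta> s) < ereal (\<eta> t)"
    using s by (simp add: eta_less_iff)
  also have "\<dots> \<le> v ((\<pi> \<odot>\<^bsub>V\<^esub> x) 0)"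
    using v_unif_ge[OF carrier_VH_D(1)[OF x] 2] x by (simp add: smult_eq_OF OF_unif)
  finally show ?thesis .
qed

text \<open>From k = 2 on, multiplication by \<open>\<pi>\<close> moves the value exactly by
  \<open>\<eta>\<close>, so strict monotonicity allows it to be undone.\<close>

lemma v_coeff_gt_if_unif:
  assumes "i \<in> {1..n}" "c \<in> base H" "v c = ereal (- real k)" "2 \<le> k"
    and "ereal (\<eta> s) < v (((\<pi> * c) \<odot>\<^bsub>V\<^esub> e i) 0)"
  shows "ereal s < v ((c \<odot>\<^bsub>V\<^esub> e i) 0)"
proof -
  obtain k' where k: "k = Suc k'" "1 \<le> k'"
    using assms(4) by (cases k) auto
  have "v (\<pi> * c) = ereal (- real k')"
    using assms(3) by (simp add: v_mult val_unif k one_ereal_def)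
  then have "v (((\<pi> * c) \<odot>\<^bsub>V\<^esub> e i) 0) = ereal (\<Lambda> i k')"
    using assms k by (intro v_coeff_neg) (auto intro: base_mult unif_base)
  also have "\<Lambda> i k' = \<eta> (\<Lambda> i k)"
    using eta_iter[of k' "lam i"] lam_pos[of i] assms(1) k by simp
  finally show ?thesis
    using assms by (simp add: eta_less_iff v_coeff_neg)
qed

text \<open>
  Induction on the denominator.  Multiplication by \<open>\<pi>\<close> raises the valuation \<open>s\<close> to at least \<open>\<eta> s\<close>, which
  is the exact value for the multiples of the \<open>e\<^sub>i\<close> outside \<open>\<pi>\<^sup>-\<^sup>1 T\<^sub>p(H)\<close>; so a cancellation could only
  involve the components in \<open>\<pi>\<^sup>-\<^sup>1 T\<^sub>p(H)\<close>, where it is excluded by counting.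
\<close>
lemma v_coeff_gt_if_v_comb_gt:
  assumes "\<And>i. i \<in> {1..n} \<Longrightarrow> c i \<in> base H" "\<And>i. i \<in> {1..n} \<Longrightarrow> \<pi> ^ k * c i \<in> \<O>"
    and "ereal m < v (\<Sigma> c 0)" and "i \<in> {1..n}"
  shows "ereal m < v ((c i \<odot>\<^bsub>V\<^esub> e i) 0)"
  using assms
proof (induction k arbitrary: c m i)
  case 0
  then show ?case
    by (simp add: coeff_OF)
next
  case (Suc k)
  note c = Suc.prems(1)
  show ?case
  proof (rule ccontr)
    assume not_gt: "\<not> ?thesis"
    let ?w = "\<lambda>i. v ((c i \<odot>\<^bsub>V\<^esub> e i) 0)"
    \<comment> \<open>If some term fails the bound, then so does a term j of minimal value; its
      value becomes the new threshold.\<close>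
    define m0 where "m0 = Min (?w ` {1..n})"
    have "m0 \<le> ?w i"
      unfolding m0_def using Suc.prems(4) by (intro Min_le) auto
    also have "\<dots> \<le> ereal m"
      using not_gt by simp
    finally have m0_le: "m0 \<le> ereal m" .
    have "m0 \<in> ?w ` {1..n}"
      unfolding m0_def using height_pos by (intro Min_in) auto
    then obtain j where j: "j \<in> {1..n}" "?w j = m0"
      by auto
    have cj: "c j \<notin> \<O>"
      using coeff_OF[OF j(1)] j(2) m0_le by auto
    then obtain l where l: "1 \<le> l" "v (c j) = ereal (- real l)"
      using base_cases[OF c[OF j(1)]] by blast
    then have m0: "m0 = ereal (\<Lambda> j l)"
      using v_coeff_neg[OF j(1) c[OF j(1)]] j(2) by simp
    have gt: "ereal (\<Lambda> j l) < v (\<Sigma> c 0)"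
      by (rule le_less_trans[OF _ Suc.prems(3)]) (use m0_le m0 in simp)
    have "\<pi> \<odot>\<^bsub>V\<^esub> \<Sigma> c = \<Sigma> (\<lambda>i. \<pi> * c i)"
      using c by (intro smult_comb unif_base)
    then have "ereal (\<eta> (\<Lambda> j l)) < v (\<Sigma> (\<lambda>i. \<pi> * c i) 0)"
      using v_unif_smult_gt[OF comb_closed[OF c] gt] by simp
    \<comment> \<open>The induction hypothesis for \<open>\<pi> * c\<close>, whose denominators are
      shorter by one, at the threshold raised by \<open>\<eta>\<close>.\<close>
    then have unif_gt: "ereal (\<eta> (\<Lambda> j l)) < v (((\<pi> * c i) \<odot>\<^bsub>V\<^esub> e i) 0)" if "i \<in> {1..n}" for i
      using that c Suc.prems(2) by (intro Suc.IH[of "\<lambda>i. \<pi> * c i"]) (auto intro: base_mult unif_base simp: mult_ac)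
    have far: "ereal (\<Lambda> j l) < ?w i" if "i \<in> {1..n}" "\<pi> * c i \<notin> \<O>" for i
    proof (rule base_cases[OF c[OF that(1)]])
      assume "c i \<in> \<O>"
      then show ?thesis
        using that by (simp add: OF_mult OF_unif)
    next
      fix k assume k: "1 \<le> k" "v (c i) = ereal (- real k)"
      have "k \<noteq> 1"
      proof
        assume "k = 1"
        then have "v (\<pi> * c i) = 0"
          using k by (simp add: v_mult val_unif one_ereal_def zero_ereal_def)
        then show False
          using that c by (simp add: OF_ring_iff base_mult unif_base)
      qed
      then show ?thesis
        using k that by (intro v_coeff_gt_if_unif[OF that(1) c k(2) _ unif_gt]) auto
    qed
    \<comment> \<open>Here a collects the components with denominator at most \<open>\<pi>\<close>.
      The rest b lies strictly above the threshold by \<open>far\<close>, so a must do so too, or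
      the sum would have the value of a.\<close>
    define a where "a i = (if \<pi> * c i \<in> \<O> then c i else 0)" for i
    define b where "b i = (if \<pi> * c i \<in> \<O> then 0 else c i)" for i
    have ab: "a i \<in> base H" "b i \<in> base H" if "i \<in> {1..n}" for i
      using that c by (auto simp: a_def b_def base_0)
    have "\<Sigma> c = \<Sigma> (\<lambda>i. a i + b i)"
      using c by (intro comb_cong) (auto simp: a_def b_def)
    also have "\<dots> = \<Sigma> a \<oplus>\<^bsub>V\<^esub> \<Sigma> b"
      using ab by (intro comb_add[symmetric])
    finally have sum: "\<Sigma> c 0 = padd H (\<Sigma> a 0) (\<Sigma> b 0)"
      by (simp add: VH_simps)
    have pts: "\<Sigma> a 0 \<in> points H" "\<Sigma> b 0 \<in> points H"
      using carrier_VH_D(1) comb_closed ab by blast+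
    have b_gt: "ereal (\<Lambda> j l) < v (\<Sigma> b 0)"
      using ab far coeff_OF[OF _ OF_0] by (intro v_comb_gt) (auto simp: b_def)
    have "ereal (\<Lambda> j l) < v (\<Sigma> a 0)"
    proof (rule ccontr)
      assume "\<not> ?thesis"
      then have "v (\<Sigma> a 0) \<le> ereal (\<Lambda> j l)"
        by simp
      moreover from this have "v (\<Sigma> c 0) = v (\<Sigma> a 0)"
        unfolding sum using b_gt by (intro v_padd_eq pts) simp
      ultimately show False
        using gt by simp
    qed
    moreover have "\<pi> * c j \<in> \<O>"
      using far[OF j(1)] j(2) m0 by auto
    \<comment> \<open>So the threshold is the slope \<open>lam j\<close> itself. Counting at this
      threshold makes the coefficient at j integral, against the choice of j.\<close>
    moreover have "l = 1"
    proof (rule ccontr)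
      assume "l \<noteq> 1"
      then have "v (\<pi> * c j) < 0"
        using l by (simp add: v_mult val_unif one_ereal_def zero_ereal_def)
      then show False
        using \<open>\<pi> * c j \<in> \<O>\<close> by (simp add: OF_ring_iff flip: not_le)
    qed
    moreover have "\<pi> * a i \<in> \<O>" for i
      by (simp add: a_def OF_0)
    ultimately have "a j \<in> \<O>"
      using coeff_divisible_if_v_comb_gt[of a "\<Lambda> j l" j] ab(1) j(1) by (simp add: iter_1[simplified])
    then show False
      using cj \<open>\<pi> * c j \<in> \<O>\<close> by (simp add: a_def)
  qed
qed

text \<open>The induction handles strict inequalities; the weak one follows by taking a real
  threshold between a failing term and l.\<close>

lemma v_comb_ge_iff:
  assumes c: "\<And>i. i \<in> {1..n} \<Longrightarrow> c i \<in> base H"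
  shows "ereal l \<le> v (\<Sigma> c 0) \<longleftrightarrow> (\<forall>i\<in>{1..n}. ereal l \<le> v ((c i \<odot>\<^bsub>V\<^esub> e i) 0))"
proof
  assume l: "ereal l \<le> v (\<Sigma> c 0)"
  obtain k where k: "\<And>i. i \<in> {1..n} \<Longrightarrow> \<pi> ^ k * c i \<in> \<O>"
    using ex_common_denominator[of c] c by blast
  show "\<forall>i\<in>{1..n}. ereal l \<le> v ((c i \<odot>\<^bsub>V\<^esub> e i) 0)"
  proof
    fix i assume i: "i \<in> {1..n}"
    show "ereal l \<le> v ((c i \<odot>\<^bsub>V\<^esub> e i) 0)"
    proof (rule ccontr)
      assume "\<not> ?thesis"
      then obtain m where m: "v ((c i \<odot>\<^bsub>V\<^esub> e i) 0) < ereal m" "ereal m < ereal l"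
        using ereal_dense2 by (metis not_le)
      then have "ereal m < v (\<Sigma> c 0)"
        using l by (metis less_le_trans)
      then show False
        using v_coeff_gt_if_v_comb_gt[where c = c, OF c k _ i] m(1) by (meson less_asym)
    qed
  qed
qed (auto intro: v_comb_ge c)

end


section \<open>Lattices of the apartment\<close>

context pi_divisible_module
begin

lemma val_unif_powi: "v (\<pi> powi k) = ereal (of_int k)"
  by (cases "k \<ge> 0") (auto simp: power_int_def v_inverse power_inverse)

lemma base_unif_powi: "\<pi> powi k \<in> base H"
  by (auto simp: power_int_def intro: base_power base_inverse unif_base)

lemma lattice_subset_carrier: "lattice H L \<Longrightarrow> L \<subseteq> carrier V"
  using O_span_subset_carrier by (auto simp: lattice_def)

lemma hclass_self: "L \<subseteq> carrier V \<Longrightarrow> L \<in> hclass H L"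
proof -
  assume "L \<subseteq> carrier V"
  then have "homothety H 1 L = L"
    unfolding homothety_def by (force simp: one_smult)
  then show ?thesis
    using base_1 by (force simp: hclass_def)
qed

lemma homothety_mono: "L \<subseteq> L' \<Longrightarrow> homothety H a L \<subseteq> homothety H a L'"
  by (auto simp: homothety_def)

end

context adapted
begin

text \<open>The sum of the \<open>\<O> \<pi>^(-a_i) e_i\<close>, described by valuations of
  coordinates, so that inclusion and homothety become conditions on the exponents.\<close>

definition Lat :: "(nat \<Rightarrow> int) \<Rightarrow> (int \<Rightarrow> 'a) set" where
  "Lat a = {\<Sigma> c |c. \<forall>i\<in>{1..n}. c i \<in> base H \<and> ereal (of_int (- a i)) \<le> v (c i)}"

lemma Lat_E:
  assumes "x \<in> Lat a"
  obtains c where "\<And>i. i \<in> {1..n} \<Longrightarrow> c i \<in> base H" "x = \<Sigma> c"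
    "\<And>i. i \<in> {1..n} \<Longrightarrow> ereal (of_int (- a i)) \<le> v (c i)"
  using assms unfolding Lat_def by blast

lemma comb_mem_Lat_iff:
  assumes "\<And>i. i \<in> {1..n} \<Longrightarrow> c i \<in> base H"
  shows "\<Sigma> c \<in> Lat a \<longleftrightarrow> (\<forall>i\<in>{1..n}. ereal (of_int (- a i)) \<le> v (c i))"
proof
  assume "\<Sigma> c \<in> Lat a"
  then obtain d where d: "\<And>i. i \<in> {1..n} \<Longrightarrow> d i \<in> base H" "\<Sigma> c = \<Sigma> d"
    "\<And>i. i \<in> {1..n} \<Longrightarrow> ereal (of_int (- a i)) \<le> v (d i)"
    by (rule Lat_E) blast
  then show "\<forall>i\<in>{1..n}. ereal (of_int (- a i)) \<le> v (c i)"
    using comb_eqD[OF assms d(1,2)] by simp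
qed (use assms in \<open>auto simp: Lat_def\<close>)

lemma Lat_subset_carrier: "Lat a \<subseteq> carrier V"
  by (auto simp: Lat_def intro!: comb_closed)

lemma O_span_eq_Lat: "O_span H n (\<lambda>i. (\<pi> powi (- a i)) \<odot>\<^bsub>V\<^esub> e i) = Lat a"
proof -
  have scale: "lincomb H n c (\<lambda>i. (\<pi> powi (- a i)) \<odot>\<^bsub>V\<^esub> e i) = \<Sigma> (\<lambda>i. c i * \<pi> powi (- a i))"
    if "\<And>i. i \<in> {1..n} \<Longrightarrow> c i \<in> \<O>" for c
    using that by (intro lincomb_scale e_carrier base_unif_powi) (auto simp: OF_ring_iff)
  show ?thesis
  proof (intro equalityI subsetI)
    fix x assume "x \<in> O_span H n (\<lambda>i. (\<pi> powi (- a i)) \<odot>\<^bsub>V\<^esub> e i)"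
    then obtain c where "c \<in> {1..n} \<rightarrow> \<O>" "x = lincomb H n c (\<lambda>i. (\<pi> powi (- a i)) \<odot>\<^bsub>V\<^esub> e i)"
      by (auto simp: O_span_def)
    then have c: "\<And>i. i \<in> {1..n} \<Longrightarrow> c i \<in> \<O>" "x = \<Sigma> (\<lambda>i. c i * \<pi> powi (- a i))"
      using scale[of c] by blast+
    have "ereal (of_int (- a i)) \<le> v (c i * \<pi> powi (- a i))" if "i \<in> {1..n}" for i
      using v_mult_ge[of "ereal (of_int (- a i))" "\<pi> powi (- a i)" "c i"] c(1)[OF that]
      by (simp add: val_unif_powi OF_ring_iff mult.commute)
    moreover have "c i * \<pi> powi (- a i) \<in> base H" if "i \<in> {1..n}" for i
      using c(1)[OF that] by (auto simp: OF_ring_iff intro!: base_mult base_unif_powi)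
    ultimately show "x \<in> Lat a"
      unfolding Lat_def c(2) by blast
  next
    fix x assume "x \<in> Lat a"
    then obtain c where c: "\<And>i. i \<in> {1..n} \<Longrightarrow> c i \<in> base H" "x = \<Sigma> c"
      "\<And>i. i \<in> {1..n} \<Longrightarrow> ereal (of_int (- a i)) \<le> v (c i)"
      by (rule Lat_E) blast
    define d where "d i = c i * \<pi> powi (a i)" for i
    have d: "d i \<in> \<O>" if "i \<in> {1..n}" for i
    proof -
      have "ereal (of_int (- a i)) + ereal (of_int (a i)) \<le> v (c i) + v (\<pi> powi (a i))"
        using c(3)[OF that] by (intro add_mono) (auto simp: val_unif_powi)
      then show ?thesis
        using c(1)[OF that] by (simp add: d_def OF_ring_iff v_mult base_mult base_unif_powi zero_ereal_def)
    qed
    have "d i * \<pi> powi (- a i) = c i" for i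
      by (simp add: d_def mult.assoc power_int_minus)
    then have "x = lincomb H n d (\<lambda>i. (\<pi> powi (- a i)) \<odot>\<^bsub>V\<^esub> e i)"
      using scale[of d] d c(2) by simp
    then show "x \<in> O_span H n (\<lambda>i. (\<pi> powi (- a i)) \<odot>\<^bsub>V\<^esub> e i)"
      using d by (auto simp: O_span_def)
  qed
qed

lemma apt_vertex_eq: "apt_vertex H n e a = hclass H (Lat a)"
  by (simp add: apt_vertex_def O_span_eq_Lat)

lemma Lat_subset_iff: "Lat a \<subseteq> Lat b \<longleftrightarrow> (\<forall>i\<in>{1..n}. a i \<le> b i)"
proof
  assume sub: "Lat a \<subseteq> Lat b"
  have "\<Sigma> (\<lambda>i. \<pi> powi (- a i)) \<in> Lat a"
    by (subst comb_mem_Lat_iff) (auto simp: base_unif_powi val_unif_powi)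
  then have "\<Sigma> (\<lambda>i. \<pi> powi (- a i)) \<in> Lat b"
    using sub by blast
  then show "\<forall>i\<in>{1..n}. a i \<le> b i"
    by (subst (asm) comb_mem_Lat_iff) (auto simp: base_unif_powi val_unif_powi)
next
  assume le: "\<forall>i\<in>{1..n}. a i \<le> b i"
  have "ereal (of_int (- b i)) \<le> v c" if "i \<in> {1..n}" "ereal (of_int (- a i)) \<le> v c" for i c
  proof -
    have "ereal (of_int (- b i)) \<le> ereal (of_int (- a i))"
      using le that(1) by simp
    then show ?thesis
      using that(2) by (rule order_trans)
  qed
  then show "Lat a \<subseteq> Lat b"
    unfolding Lat_def by blast
qed

lemma Lat_eq_iff: "Lat a = Lat b \<longleftrightarrow> (\<forall>i\<in>{1..n}. a i = b i)"
  by (auto simp: set_eq_subset Lat_subset_iff intro: antisym)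

lemma homothety_Lat:
  assumes t: "t \<in> base H" "v t = ereal (of_int k)"
  shows "homothety H t (Lat a) = Lat (\<lambda>i. a i - k)"
proof (intro equalityI subsetI)
  fix y assume "y \<in> homothety H t (Lat a)"
  then obtain x where "x \<in> Lat a" "y = t \<odot>\<^bsub>V\<^esub> x"
    by (auto simp: homothety_def)
  then obtain c where c: "\<And>i. i \<in> {1..n} \<Longrightarrow> c i \<in> base H" "y = t \<odot>\<^bsub>V\<^esub> \<Sigma> c"
    "\<And>i. i \<in> {1..n} \<Longrightarrow> ereal (of_int (- a i)) \<le> v (c i)"
    by (blast elim: Lat_E)
  have "ereal (of_int (- (a i - k))) \<le> v (t * c i)" if "i \<in> {1..n}" for i
    using c(3)[OF that] t(2) by (cases "v (c i)") (auto simp: v_mult)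
  then have "\<Sigma> (\<lambda>i. t * c i) \<in> Lat (\<lambda>i. a i - k)"
    using c(1) t(1) by (subst comb_mem_Lat_iff) (auto intro: base_mult)
  then show "y \<in> Lat (\<lambda>i. a i - k)"
    using smult_comb[OF c(1) t(1)] c(2) by simp
next
  fix y assume "y \<in> Lat (\<lambda>i. a i - k)"
  then obtain c where c: "\<And>i. i \<in> {1..n} \<Longrightarrow> c i \<in> base H" "y = \<Sigma> c"
    "\<And>i. i \<in> {1..n} \<Longrightarrow> ereal (of_int (- (a i - k))) \<le> v (c i)"
    by (rule Lat_E) blast
  have t0: "t \<noteq> 0"
    using t(2) by auto
  have base: "inverse t * c i \<in> base H" if "i \<in> {1..n}" for i
    using c(1)[OF that] t(1) by (intro base_mult base_inverse)
  have "ereal (of_int (- a i)) \<le> v (inverse t * c i)" if "i \<in> {1..n}" for i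
    using c(3)[OF that] t(2) t0 by (cases "v (c i)") (auto simp: v_mult v_inverse)
  then have "\<Sigma> (\<lambda>i. inverse t * c i) \<in> Lat a"
    using base by (subst comb_mem_Lat_iff) auto
  moreover have "t \<odot>\<^bsub>V\<^esub> \<Sigma> (\<lambda>i. inverse t * c i) = \<Sigma> (\<lambda>i. t * (inverse t * c i))"
    using base t(1) by (intro smult_comb)
  moreover have "t * (inverse t * c i) = c i" for i
    using t0 by (simp add: mult.assoc[symmetric])
  ultimately show "y \<in> homothety H t (Lat a)"
    unfolding homothety_def c(2) by force
qed

lemma lattice_Lat: "lattice H (Lat a)"
  unfolding lattice_def
proof (intro conjI ballI)
  show "\<exists>m f. f \<in> {1..m} \<rightarrow> carrier V \<and> Lat a = O_span H m f"
    using O_span_eq_Lat[of a] e_carrier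
    by (intro exI[of _ n] exI[of _ "\<lambda>i. (\<pi> powi (- a i)) \<odot>\<^bsub>V\<^esub> e i"])
      (auto simp: smult_closed base_unif_powi)
next
  fix x assume "x \<in> carrier V"
  then obtain c where c: "\<And>i. i \<in> {1..n} \<Longrightarrow> c i \<in> base H" "x = \<Sigma> c"
    using ex_coords by blast
  then obtain k where k: "\<And>i. i \<in> {1..n} \<Longrightarrow> \<pi> ^ k * c i \<in> \<O>"
    using ex_common_denominator[of c] by blast
  \<comment> \<open>The exponent k clears the denominators of the coordinates, and the sum dominates
    every \<open>- a i\<close> at once.\<close>
  define l where "l = k + (\<Sum>i\<in>{1..n}. nat (- a i))"
  have "ereal (of_int (- a i)) \<le> v (\<pi> ^ l * c i)" if "i \<in> {1..n}" for i
  proof -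
    have "nat (- a i) \<le> (\<Sum>i\<in>{1..n}. nat (- a i))"
      using that by (intro member_le_sum) auto
    then have "nat (- a i) \<le> l - k"
      unfolding l_def by linarith
    then have "real_of_int (- a i) \<le> real (l - k)"
      by linarith
    then have "ereal (of_int (- a i)) \<le> v (\<pi> ^ (l - k))"
      unfolding val_unif_power ereal_less_eq .
    also have "\<dots> \<le> v (\<pi> ^ (l - k) * (\<pi> ^ k * c i))"
      using k[OF that] by (intro v_mult_ge[OF order_refl]) (simp add: OF_ring_iff)
    also have "\<pi> ^ (l - k) * (\<pi> ^ k * c i) = \<pi> ^ l * c i"
      by (simp add: mult.assoc[symmetric] power_add[symmetric] l_def add.commute)
    finally show ?thesis .
  qed
  then have "\<Sigma> (\<lambda>i. \<pi> ^ l * c i) \<in> Lat a"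
    using c(1) by (subst comb_mem_Lat_iff) (auto simp: base_mult base_power unif_base)
  moreover have "\<pi> ^ l \<odot>\<^bsub>V\<^esub> x = \<Sigma> (\<lambda>i. \<pi> ^ l * c i)"
    unfolding c(2) using c(1) by (intro smult_comb base_power unif_base)
  ultimately show "\<exists>t\<in>base H - {0}. t \<odot>\<^bsub>V\<^esub> x \<in> Lat a"
    by (intro bexI[of _ "\<pi> ^ l"]) (auto simp: base_power unif_base)
qed

lemma hclass_Lat: "hclass H (Lat a) = range (\<lambda>k. Lat (\<lambda>i. a i + k))"
proof (intro equalityI subsetI)
  fix L assume "L \<in> hclass H (Lat a)"
  then obtain t where t: "t \<in> base H" "t \<noteq> 0" "L = homothety H t (Lat a)"
    by (auto simp: hclass_def)
  then obtain k where "v t = ereal (of_int k)"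
    using val_base by blast
  then have "L = Lat (\<lambda>i. a i + (- k))"
    using homothety_Lat t by simp
  then show "L \<in> range (\<lambda>k. Lat (\<lambda>i. a i + k))"
    by blast
next
  fix L assume "L \<in> range (\<lambda>k. Lat (\<lambda>i. a i + k))"
  then obtain k where "L = Lat (\<lambda>i. a i + k)"
    by blast
  then have "L = homothety H (\<pi> powi (- k)) (Lat a)"
    using homothety_Lat[OF base_unif_powi val_unif_powi, of "- k" a] by simp
  then show "L \<in> hclass H (Lat a)"
    using base_unif_powi[of "- k"] by (auto simp: hclass_def)
qed

lemma hclass_Lat_eqI:
  assumes "\<And>i. i \<in> {1..n} \<Longrightarrow> a i = b i + k"
  shows "hclass H (Lat a) = hclass H (Lat b)"
proof -
  have "Lat (\<lambda>i. a i + l) = Lat (\<lambda>i. b i + (k + l))" "Lat (\<lambda>i. b i + l) = Lat (\<lambda>i. a i + (l - k))" for l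
    using assms by (auto simp: Lat_eq_iff)
  then have "Lat (\<lambda>i. a i + l) \<in> hclass H (Lat b)" "Lat (\<lambda>i. b i + l) \<in> hclass H (Lat a)" for l
    unfolding hclass_Lat by blast+
  then show ?thesis
    by (auto simp: hclass_Lat)
qed

lemma hclass_eq_Lat_obtain:
  assumes "L \<subseteq> carrier V" "hclass H L = hclass H (Lat a)"
  obtains k where "L = Lat (\<lambda>i. a i + k)"
  using hclass_self[OF assms(1)] unfolding assms(2) hclass_Lat by blast

text \<open>The description in \<open>alpha\<close> is well defined because a homothety shifts all
  exponents by the same integer.\<close>

lemma alpha_hclass_Lat:
  assumes "i \<in> {1..n}" "j \<in> {1..n}"
  shows "alpha H n e i j (hclass H (Lat a)) = a i - a j"
  unfolding alpha_def
proof (rule the_equality)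
  show "\<exists>a'. hclass H (Lat a) = apt_vertex H n e a' \<and> a i - a j = a' i - a' j"
    by (auto simp: apt_vertex_eq)
  fix m assume "\<exists>a'. hclass H (Lat a) = apt_vertex H n e a' \<and> m = a' i - a' j"
  then obtain a' where a': "hclass H (Lat a) = hclass H (Lat a')" "m = a' i - a' j"
    by (auto simp: apt_vertex_eq)
  obtain k where "Lat a = Lat (\<lambda>i. a' i + k)"
    using hclass_eq_Lat_obtain[OF Lat_subset_carrier a'(1)] by blast
  then show "m = a i - a j"
    using assms a'(2) by (simp add: Lat_eq_iff)
qed

text \<open>The definition of \<open>simplex\<close> demands a strictly decreasing enumeration.
  Along a chain of lattices the sum of the exponents is strictly monotone, so sorting by it provides
  one.\<close>

lemma simplex_Lat:
  assumes A: "finite A" "A \<noteq> {}"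
    and chain: "\<And>a b. a \<in> A \<Longrightarrow> b \<in> A \<Longrightarrow> Lat a \<subseteq> Lat b \<or> Lat b \<subseteq> Lat a"
    and period: "\<And>a b. a \<in> A \<Longrightarrow> b \<in> A \<Longrightarrow> Lat (\<lambda>i. a i - 1) \<subset> Lat b"
  shows "simplex H ((\<lambda>a. hclass H (Lat a)) ` A)"
proof -
  define s where "s a = (\<Sum>i\<in>{1..n}. a i)" for a :: "nat \<Rightarrow> int"
  have s_mono: "s a \<le> s b" if "Lat a \<subseteq> Lat b" for a b
    using that by (auto simp: s_def Lat_subset_iff intro: sum_mono)
  have s_eq: "Lat a = Lat b" if "Lat a \<subseteq> Lat b" "s b \<le> s a" for a b
  proof -
    have "a i = b i" if "i \<in> {1..n}" for i
    proof (rule ccontr)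
      assume "a i \<noteq> b i"
      then have "s a < s b"
        unfolding s_def using \<open>Lat a \<subseteq> Lat b\<close> that
        by (intro sum_strict_mono_ex1) (force simp: Lat_subset_iff)+
      then show False
        using \<open>s b \<le> s a\<close> by simp
    qed
    then show ?thesis
      by (simp add: Lat_eq_iff)
  qed
  define xs where "xs = rev (sorted_list_of_set (s ` A))"
  have set_xs: "set xs = s ` A"
    using A by (simp add: xs_def)
  have xs_nth: "xs ! j < xs ! i" if "i < j" "j < length xs" for i j
    using sorted_wrt_nth_less[of "(>)" xs i j] that
    by (simp add: xs_def sorted_wrt_rev)
  have len: "1 \<le> length xs"
    using A set_xs by (cases xs) auto
  \<comment> \<open>Functions in A that differ outside \<open>{1..n}\<close> give the same lattice,
    so one is chosen for each value of the sum.\<close>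
  define r where "r t = (SOME a. a \<in> A \<and> s a = t)" for t
  have r: "r t \<in> A" "s (r t) = t" if "t \<in> s ` A" for t
    using someI_ex[of "\<lambda>a. a \<in> A \<and> s a = t"] that by (auto simp: r_def)
  have r_nth: "r (xs ! i) \<in> A" "s (r (xs ! i)) = xs ! i" if "i < length xs" for i
    using r[of "xs ! i"] set_xs that nth_mem by metis+
  define L where "L k = Lat (r (xs ! (k - 1)))" for k
  have "L (k + 1) \<subset> L k" if "k \<in> {1..<length xs}" for k
  proof -
    have "xs ! k < xs ! (k - 1)"
      using that by (intro xs_nth) auto
    moreover have k: "k < length xs" "k - 1 < length xs"
      using that by auto
    ultimately have "s (r (xs ! k)) < s (r (xs ! (k - 1)))"
      unfolding r_nth(2)[OF k(1)] r_nth(2)[OF k(2)] by simp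
    then have "\<not> Lat (r (xs ! (k - 1))) \<subseteq> Lat (r (xs ! k))"
      using s_mono by (meson not_le)
    moreover have "Lat (r (xs ! k)) \<subseteq> Lat (r (xs ! (k - 1))) \<or> Lat (r (xs ! (k - 1))) \<subseteq> Lat (r (xs ! k))"
      by (rule chain[OF r_nth(1)[OF k(1)] r_nth(1)[OF k(2)]])
    ultimately show ?thesis
      by (auto simp: L_def)
  qed
  moreover have "homothety H \<pi> (L 1) \<subset> L (length xs)"
    using homothety_Lat[OF unif_base, of 1] val_unif len
    by (simp add: L_def one_ereal_def) (intro period r_nth, auto)
  moreover have "(\<lambda>a. hclass H (Lat a)) ` A = (\<lambda>k. hclass H (L k)) ` {1..length xs}"
  proof (intro equalityI subsetI)
    fix y assume "y \<in> (\<lambda>a. hclass H (Lat a)) ` A"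
    then obtain a where a: "a \<in> A" "y = hclass H (Lat a)"
      by blast
    then obtain k where k: "k < length xs" "xs ! k = s a"
      using set_xs by (metis imageI in_set_conv_nth)
    have "Lat a = Lat (r (xs ! k))"
      using chain[OF a(1) r_nth(1)[OF k(1)]] s_eq[of a "r (xs ! k)"] s_eq[of "r (xs ! k)" a] r_nth(2)[OF k(1)] k(2)
      by auto
    then have "y = hclass H (L (k + 1))"
      using a by (simp add: L_def)
    then show "y \<in> (\<lambda>k. hclass H (L k)) ` {1..length xs}"
      using k by auto
  next
    fix y assume "y \<in> (\<lambda>k. hclass H (L k)) ` {1..length xs}"
    then obtain k where "k \<in> {1..length xs}" "y = hclass H (L k)"
      by blast
    then show "y \<in> (\<lambda>a. hclass H (Lat a)) ` A"
      using r_nth(1)[of "k - 1"] by (force simp: L_def)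
  qed
  ultimately show ?thesis
    unfolding simplex_def using len by (intro exI[of _ "length xs"] exI[of _ L]) (auto simp: L_def lattice_Lat)
qed

text \<open>Suitable representatives satisfy \<open>\<pi> L \<subseteq> L' \<subseteq> L\<close>, so
  the differences of their exponents take at most two consecutive values.\<close>

lemma simplex_alpha_diff:
  assumes t: "simplex H t" and x: "hclass H (Lat a) \<in> t" and y: "hclass H (Lat b) \<in> t"
    and ij: "i \<in> {1..n}" "j \<in> {1..n}"
  shows "\<bar>(a i - a j) - (b i - b j)\<bar> \<le> 1"
proof -
  obtain d :: nat and L where L: "\<forall>k\<in>{1..d}. lattice H (L k)" "\<forall>k\<in>{1..<d}. L (k + 1) \<subset> L k"
    "homothety H \<pi> (L 1) \<subset> L d" "t = (\<lambda>k. hclass H (L k)) ` {1..d}"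
    using t unfolding simplex_def by blast
  have mono: "L l \<subseteq> L k" if "1 \<le> k" "k \<le> l" "l \<le> d" for k l
    using that(2,3)
  proof (induction l rule: dec_induct)
    case (step l)
    then have "L (l + 1) \<subset> L l" "L l \<subseteq> L k"
      using L(2) \<open>1 \<le> k\<close> by auto
    then show ?case
      by auto
  qed simp
  have bounds: "(\<forall>i\<in>{1..n}. b i + m \<le> a i + l) \<and> (\<forall>i\<in>{1..n}. a i + l - 1 \<le> b i + m)"
    if "L k = Lat (\<lambda>i. a i + l)" "L k' = Lat (\<lambda>i. b i + m)" "k \<le> k'" "1 \<le> k" "k' \<le> d"
    for a b k k' l m
  proof -
    have "homothety H \<pi> (L k) \<subseteq> homothety H \<pi> (L 1)"
      using that by (intro homothety_mono mono) auto
    also have "\<dots> \<subseteq> L k'"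
      using L(3) mono[of k' d] that by auto
    finally have "Lat (\<lambda>i. a i + l - 1) \<subseteq> Lat (\<lambda>i. b i + m)"
      using homothety_Lat[OF unif_base, of 1] val_unif that by (simp add: one_ereal_def)
    moreover have "Lat (\<lambda>i. b i + m) \<subseteq> Lat (\<lambda>i. a i + l)"
      using mono[of k k'] that by simp
    ultimately show ?thesis
      by (simp add: Lat_subset_iff)
  qed
  obtain k k' where k: "k \<in> {1..d}" "hclass H (L k) = hclass H (Lat a)"
    and k': "k' \<in> {1..d}" "hclass H (L k') = hclass H (Lat b)"
    using x y L(4) by (metis (no_types, lifting) imageE)
  obtain l where l: "L k = Lat (\<lambda>i. a i + l)"
    using hclass_eq_Lat_obtain[OF lattice_subset_carrier k(2)] L(1) k(1) by blast
  obtain m where m: "L k' = Lat (\<lambda>i. b i + m)"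
    using hclass_eq_Lat_obtain[OF lattice_subset_carrier k'(2)] L(1) k'(1) by blast
  show ?thesis
  proof (cases "k \<le> k'")
    case True
    then show ?thesis
      using bounds[OF l m True] k(1) k'(1) ij by (smt (verit) atLeastAtMost_iff)
  next
    case False
    then show ?thesis
      using bounds[OF m l] k(1) k'(1) ij by (smt (verit) atLeastAtMost_iff nle_le)
  qed
qed

text \<open>By \<open>v_comb_ge_iff\<close> membership is tested coordinatewise: an integral
  coefficient always passes, and one of valuation -k passes iff
  \<open>l \<le> \<Lambda> i k\<close>.\<close>

lemma Fil_eq_Lat:
  assumes a: "\<And>i. i \<in> {1..n} \<Longrightarrow> 0 \<le> a i"
    and iff: "\<And>i k. i \<in> {1..n} \<Longrightarrow> 1 \<le> k \<Longrightarrow> l \<le> \<Lambda> i k \<longleftrightarrow> int k \<le> a i"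
  shows "Fil H (ereal l) = Lat a"
proof -
  have *: "ereal l \<le> v ((c \<odot>\<^bsub>V\<^esub> e i) 0) \<longleftrightarrow> ereal (of_int (- a i)) \<le> v c"
    if i: "i \<in> {1..n}" and c: "c \<in> base H" for i c
  proof (rule base_cases[OF c])
    assume cO: "c \<in> \<O>"
    then have "ereal (of_int (- a i)) \<le> 0" "0 \<le> v c"
      using a[OF i] by (auto simp: OF_ring_iff zero_ereal_def)
    then have "ereal (of_int (- a i)) \<le> v c"
      by (rule order_trans)
    then show ?thesis
      using coeff_OF[OF i cO] by simp
  next
    fix k assume k: "1 \<le> k" "v c = ereal (- real k)"
    have "ereal (of_int (- a i)) \<le> v c \<longleftrightarrow> int k \<le> a i"
      unfolding k(2) by simp linarith
    then show ?thesis
      using v_coeff_neg[OF i c k(2,1)] iff[OF i k(1)] by simp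
  qed
  show ?thesis
  proof (intro equalityI subsetI)
    fix x assume "x \<in> Fil H (ereal l)"
    then have x: "x \<in> carrier V" "ereal l \<le> v (x 0)"
      by (auto simp: Fil_def)
    obtain c where c: "\<And>i. i \<in> {1..n} \<Longrightarrow> c i \<in> base H" "x = \<Sigma> c"
      using ex_coords[OF x(1)] by blast
    then have "\<forall>i\<in>{1..n}. ereal (of_int (- a i)) \<le> v (c i)"
      using x(2) v_comb_ge_iff[of c l] * by blast
    then show "x \<in> Lat a"
      using c comb_mem_Lat_iff[of c a] by blast
  next
    fix x assume x: "x \<in> Lat a"
    then obtain c where c: "\<And>i. i \<in> {1..n} \<Longrightarrow> c i \<in> base H" "x = \<Sigma> c"
      "\<And>i. i \<in> {1..n} \<Longrightarrow> ereal (of_int (- a i)) \<le> v (c i)"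
      by (rule Lat_E) blast
    then have "ereal l \<le> v (x 0)"
      using v_comb_ge_iff[of c l] * by blast
    then show "x \<in> Fil H (ereal l)"
      using x Lat_subset_carrier by (auto simp: Fil_def)
  qed
qed


section \<open>The maximal simplex\<close>

lemma funpow_eta_inv_nonneg: "0 \<le> s \<Longrightarrow> 0 \<le> (eta_inv ^^ m) s"
  by (induction m) (auto simp: eta_inv_nonneg)

lemma funpow_eta_inv_less_iff: "0 \<le> s \<Longrightarrow> 0 \<le> t \<Longrightarrow> (eta_inv ^^ m) s < (eta_inv ^^ m) t \<longleftrightarrow> s < t"
  by (induction m) (auto simp: eta_inv_less_iff funpow_eta_inv_nonneg)

lemma slope_add: "1 \<le> k \<Longrightarrow> \<Lambda> i (k + m) = (eta_inv ^^ m) (\<Lambda> i k)"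
  by (rule iter_add)

lemma slope_pos: "i \<in> {1..n} \<Longrightarrow> 1 \<le> k \<Longrightarrow> 0 < \<Lambda> i k"
  by (intro iter_pos lam_pos) auto

text \<open>The same increasing map, the m-th iterate of \<open>eta_inv\<close>, is applied to both
  sides.\<close>

lemma slope_shift_less_iff:
  assumes "i \<in> {1..n}" "j \<in> {1..n}" "1 \<le> k" "1 \<le> l"
  shows "\<Lambda> i (k + m) < \<Lambda> j (l + m) \<longleftrightarrow> \<Lambda> i k < \<Lambda> j l"
  using assms slope_pos[of i k] slope_pos[of j l] by (simp add: slope_add funpow_eta_inv_less_iff)

text \<open>Turns inequalities between slopes into inequalities between indices. The truncated
  \<open>k - 1\<close> in \<open>iter\<close> gives index 0 the value at index 1, so l = 0 is set
  apart.\<close>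

lemma slope_index_less:
  assumes "i \<in> {1..n}" "1 \<le> k" "t \<le> \<Lambda> i k" "\<Lambda> i l < t"
  shows "k < l \<or> l = 0"
proof (rule ccontr)
  assume "\<not> ?thesis"
  then have "1 \<le> l" "l \<le> k"
    by auto
  then have "\<Lambda> i k \<le> \<Lambda> i l"
    using iter_strict_antimono[of l k "lam i"] lam_pos[of i] assms(1) by (cases "l = k") auto
  then show False
    using assms by simp
qed

lemma slope_1: "\<Lambda> i 1 = lam i"
  by (rule iter_1)

abbreviation Q where "Q \<equiv> real q ^ n"

lemma residue_card_simps [simp]: "0 < q" "q \<noteq> 0" "Suc 0 \<le> q"
  using residue_card_ge_2 by auto

lemma eta_inv_small: "0 \<le> s \<Longrightarrow> s \<le> Q * lam n \<Longrightarrow> eta_inv s = s / Q"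
proof -
  assume s: "0 \<le> s" "s \<le> Q * lam n"
  have "s / Q \<le> lam n"
    using s residue_power_gt_1 by (simp add: divide_le_eq mult.commute)
  then have "\<eta> (s / Q) = s"
    using eta_small residue_power_gt_1 by simp
  then have "\<eta> (eta_inv s) = \<eta> (s / Q)"
    using s by (simp add: eta_eta_inv)
  then show ?thesis
    using eta_less_iff[of "eta_inv s" "s / Q"] eta_less_iff[of "s / Q" "eta_inv s"] by simp
qed

section \<open>Comparison of the slope sequences\<close>

context
  fixes b :: "nat \<Rightarrow> nat \<Rightarrow> nat"
  assumes b: "\<And>i j. 1 \<le> i \<Longrightarrow> i < j \<Longrightarrow> j \<le> n \<Longrightarrow>
    lam j \<le> \<Lambda> i (b i j + 1) \<and> \<Lambda> i (b i j + 2) < lam j"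
begin

text \<open>The number of terms of the i-th sequence that are at least \<open>lam j\<close> is
  \<open>b i j + 1\<close>. Shifting the two inequalities for (i, j) by \<open>b j k\<close> and by
  \<open>b j k + 1\<close> compares them with the terms of the j-th sequence on either side of
  \<open>lam k\<close>, which leaves two values for \<open>b i k\<close>.\<close>

lemma alcove_family_b: "alcove_family n (\<lambda>i j. int (b i j))"
  unfolding alcove_family_def
proof (intro allI impI)
  fix i j k assume ijk: "1 \<le> i" "i < j" "j < k" "k \<le> n"
  have "lam k \<le> \<Lambda> j (1 + b j k)" "\<Lambda> j (2 + b j k) < lam k"
    using b[of j k] ijk by auto
  moreover have "\<not> \<Lambda> i (b i j + 1 + b j k) < \<Lambda> j (1 + b j k)"
    using b[of i j] ijk by (subst slope_shift_less_iff) (auto simp: slope_1[simplified])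
  moreover have "\<Lambda> i (b i j + 2 + (b j k + 1)) < \<Lambda> j (1 + (b j k + 1))"
    using b[of i j] ijk by (subst slope_shift_less_iff) (auto simp: slope_1[simplified])
  ultimately have *: "lam k \<le> \<Lambda> i (b i j + 1 + b j k)" "\<Lambda> i (b i j + 2 + (b j k + 1)) < lam k"
    by (auto simp: add_ac)
  have "b i j + 1 + b j k < b i k + 2"
    using slope_index_less[OF _ _ *(1), of "b i k + 2"] b[of i k] ijk by auto
  moreover have "b i k + 1 < b i j + 2 + (b j k + 1)"
    using slope_index_less[OF _ _ _ *(2), of "b i k + 1"] b[of i k] ijk by auto
  ultimately show "int (b i k) \<in> {int (b i j) + int (b j k), int (b i j) + int (b j k) + 1}"
    by auto
qed

definition B :: "nat \<Rightarrow> nat" where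
  "B i = (if i = n then 0 else b i n)"

definition \<mu> :: "nat \<Rightarrow> real" where
  "\<mu> i = \<Lambda> i (B i + 1)"

lemma mu_n: "\<mu> n = lam n"
  by (simp add: \<mu>_def B_def slope_1[simplified])

text \<open>\<open>\<mu> i\<close> is the last term of its sequence that is at least
  \<open>lam n\<close>. Applying \<open>\<eta>\<close> to the next term gives the upper bound, so
  all \<open>\<mu> i\<close> lie in one period of multiplication by Q.\<close>

lemma mu_bounds:
  assumes "i \<in> {1..n}"
  shows "lam n \<le> \<mu> i" "\<Lambda> i (B i + 2) < lam n" "\<mu> i < Q * lam n"
proof -
  show "lam n \<le> \<mu> i"
    using assms b[of i n] mu_n by (cases "i = n") (auto simp: \<mu>_def B_def)
  show *: "\<Lambda> i (B i + 2) < lam n"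
  proof (cases "i = n")
    case True
    then show ?thesis
      using iter_strict_antimono[of 1 2 "lam n"] assms lam_pos[of n] slope_1[of n] by (simp add: B_def numeral_2_eq_2)
  qed (use assms b[of i n] in \<open>auto simp: B_def\<close>)
  have "\<mu> i = \<eta> (\<Lambda> i (B i + 2))"
    using eta_iter[of "B i + 1" "lam i"] lam_pos[of i] assms by (simp add: \<mu>_def)
  also have "\<dots> < \<eta> (lam n)"
    using * by (simp add: eta_less_iff)
  finally show "\<mu> i < Q * lam n"
    by (simp add: eta_small)
qed

lemma b_shift:
  assumes "1 \<le> i" "i < j" "j \<le> n"
  shows "\<mu> j \<le> \<Lambda> i (b i j + B j + 1)" "\<Lambda> i (b i j + B j + 2) < \<mu> j"
proof -
  have "\<not> \<Lambda> i (b i j + 1 + B j) < \<Lambda> j (1 + B j)"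
    using b[of i j] assms by (subst slope_shift_less_iff) (auto simp: slope_1[simplified])
  then show "\<mu> j \<le> \<Lambda> i (b i j + B j + 1)"
    by (simp add: \<mu>_def add_ac)
  have "\<Lambda> i (b i j + 2 + B j) < \<Lambda> j (1 + B j)"
    using b[of i j] assms by (subst slope_shift_less_iff) (auto simp: slope_1[simplified])
  then show "\<Lambda> i (b i j + B j + 2) < \<mu> j"
    by (simp add: \<mu>_def add_ac)
qed

text \<open>The last index at which the i-th sequence is at least \<open>\<mu> j\<close> is
  \<open>b i j + B j + 1\<close>. Since \<open>\<mu> j\<close> and \<open>lam n\<close> lie in one
  period, the last index for \<open>lam n\<close>, namely \<open>B i + 1\<close>, is this one or the
  next; it is the next exactly if \<open>\<mu> i\<close> is already below
  \<open>\<mu> j\<close>.\<close>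

lemma B_eq:
  assumes ij: "1 \<le> i" "i < j" "j \<le> n"
  shows "B i = b i j + B j + (if \<mu> i < \<mu> j then 1 else 0)"
proof -
  have i: "i \<in> {1..n}" and j: "j \<in> {1..n}"
    using ij by auto
  note shift = b_shift[OF ij]
  have "\<Lambda> i (b i j + B j + 3) < \<Lambda> j (B j + 2)"
    using shift(2) slope_shift_less_iff[OF i j, of "b i j + B j + 2" "B j + 1" 1]
    by (simp add: \<mu>_def numeral_3_eq_3)
  then have "\<Lambda> i (b i j + B j + 3) < lam n"
    using mu_bounds(2)[OF j] by simp
  then have upper: "B i + 1 < b i j + B j + 3"
    using slope_index_less[OF i _ mu_bounds(1)[OF i, unfolded \<mu>_def]] by fastforce
  have "lam n \<le> \<Lambda> i (b i j + B j + 1)"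
    using shift(1) mu_bounds(1)[OF j] by simp
  then have lower: "b i j + B j + 1 < B i + 2"
    using slope_index_less[OF i _ _ mu_bounds(2)[OF i]] by fastforce
  show ?thesis
  proof (cases "\<mu> i < \<mu> j")
    case True
    then have "b i j + B j + 1 < B i + 1"
      using slope_index_less[OF i _ shift(1), of "B i + 1"] by (simp add: \<mu>_def)
    then show ?thesis
      using True upper by simp
  next
    case False
    then have "B i + 1 < b i j + B j + 2"
      using slope_index_less[OF i _ _ shift(2), of "B i + 1"] by (simp add: \<mu>_def)
    then show ?thesis
      using False lower by simp
  qed
qed

text \<open>If \<open>\<mu> i < \<mu> j\<close>, the shifted term immediately precedes
  \<open>\<mu> i\<close>, and equality would give \<open>\<mu> i = eta_inv (\<mu> j)\<close>, which
  is below \<open>lam n\<close>. Otherwise the shifted term is \<open>\<mu> i\<close>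
  itself.\<close>

lemma wall_iff:
  assumes ij: "1 \<le> i" "i < j" "j \<le> n"
  shows "\<Lambda> i (b i j + 1) = lam j \<longleftrightarrow> \<mu> i = \<mu> j"
proof -
  have i: "i \<in> {1..n}" and j: "j \<in> {1..n}"
    using ij by auto
  have eq: "\<Lambda> i (b i j + 1) = lam j \<longleftrightarrow> \<Lambda> i (b i j + B j + 1) = \<mu> j"
    using slope_shift_less_iff[OF i j, of "b i j + 1" 1 "B j"]
      slope_shift_less_iff[OF j i, of 1 "b i j + 1" "B j"]
    by (auto simp: \<mu>_def slope_1[simplified] add_ac not_less_iff_gr_or_eq)
  show ?thesis
  proof (cases "\<mu> i < \<mu> j")
    case True
    have "\<Lambda> i (b i j + B j + 1) \<noteq> \<mu> j"
    proof
      assume *: "\<Lambda> i (b i j + B j + 1) = \<mu> j"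
      have "B i = b i j + B j + 1"
        using B_eq[OF ij] True by simp
      then have "\<mu> i = \<Lambda> i (b i j + B j + 1 + 1)"
        by (simp add: \<mu>_def)
      also have "\<dots> = eta_inv (\<mu> j)"
        using iter_Suc[of "b i j + B j + 1" "lam i"] * by simp
      also have "\<dots> = \<Lambda> j (B j + 1 + 1)"
        using iter_Suc[of "B j + 1" "lam j"] by (simp add: \<mu>_def)
      finally show False
        using mu_bounds(1)[OF i] mu_bounds(2)[OF j] by simp
    qed
    then show ?thesis
      using eq True by simp
  next
    case False
    then have "B i = b i j + B j"
      using B_eq[OF ij] by simp
    then have "\<mu> i = \<Lambda> i (b i j + B j + 1)"
      by (simp add: \<mu>_def)
    then show ?thesis
      using eq by simp
  qed
qed

section \<open>The vertices of the alcove as initial segments\<close>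

definition coords :: "nat set \<Rightarrow> nat \<Rightarrow> int" where
  "coords D i = int (B i) + of_bool (i \<in> D)"

definition vertex :: "nat set \<Rightarrow> (int \<Rightarrow> 'a) set set" where
  "vertex D = hclass H (Lat (coords D))"

text \<open>
  The initial segments of \<open>{1..<n}\<close> for the order by decreasing \<open>\<mu>\<close>, ties being broken by increasing index;
  \<open>n\<close> is the last element of this order.
\<close>
definition admissible :: "nat set \<Rightarrow> bool" where
  "admissible D \<longleftrightarrow> D \<subseteq> {1..<n} \<and> (\<forall>i j. 1 \<le> i \<longrightarrow> i < j \<longrightarrow> j \<le> n \<longrightarrow>
     (\<mu> j \<le> \<mu> i \<longrightarrow> j \<in> D \<longrightarrow> i \<in> D) \<and> (\<mu> i < \<mu> j \<longrightarrow> i \<in> D \<longrightarrow> j \<in> D))"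

lemma alpha_vertex:
  assumes ij: "1 \<le> i" "i < j" "j \<le> n"
  shows "alpha H n e i j (vertex D)
    = int (b i j) + of_bool (\<mu> i < \<mu> j) + of_bool (i \<in> D) - of_bool (j \<in> D)"
  using B_eq[OF ij] ij by (simp add: vertex_def alpha_hclass_Lat coords_def)

text \<open>The conditions for the pairs (i, n) force \<open>a i - a n\<close> to be
  \<open>B i\<close> or \<open>B i + 1\<close>, which determines D after normalising by
  \<open>a n\<close>. Through \<open>alpha_vertex\<close> the conditions for all pairs become
  admissibility of D.\<close>

lemma alcove_eq: "alcove H n e (\<lambda>i j. int (b i j)) = vertex ` {D. admissible D}"
proof (intro equalityI subsetI)
  fix x assume x: "x \<in> alcove H n e (\<lambda>i j. int (b i j))"
  then have alpha: "alpha H n e i j x \<in> {int (b i j), int (b i j) + 1}"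
    if "1 \<le> i" "i < j" "j \<le> n" for i j
    using that unfolding alcove_def by blast
  obtain a where a: "x = hclass H (Lat a)"
    using x by (auto simp: alcove_def apartment_def apt_vertex_eq)
  define D where "D = {i \<in> {1..<n}. a i - a n = int (B i) + 1}"
  have "a i = coords D i + a n" if i: "i \<in> {1..n}" for i
  proof (cases "i = n")
    case False
    then have "a i - a n \<in> {int (B i), int (B i) + 1}"
      using alpha[of i n] i by (simp add: a alpha_hclass_Lat B_def)
    then show ?thesis
      using False i by (auto simp: coords_def D_def)
  qed (simp add: coords_def D_def B_def)
  then have x_eq: "x = vertex D"
    unfolding a vertex_def by (rule hclass_Lat_eqI)
  have "admissible D"
    unfolding admissible_def
  proof (intro conjI allI impI)
    show "D \<subseteq> {1..<n}"
      by (auto simp: D_def)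
    fix i j assume ij: "1 \<le> i" "i < j" "j \<le> n"
    then have "of_bool (\<mu> i < \<mu> j) + of_bool (i \<in> D) - of_bool (j \<in> D) \<in> {0, 1::int}"
      using alpha[OF ij] unfolding x_eq alpha_vertex[OF ij] insert_iff empty_iff by arith
    then show "\<mu> j \<le> \<mu> i \<Longrightarrow> j \<in> D \<Longrightarrow> i \<in> D" "\<mu> i < \<mu> j \<Longrightarrow> i \<in> D \<Longrightarrow> j \<in> D"
      unfolding of_bool_def by (auto split: if_splits)
  qed
  then show "x \<in> vertex ` {D. admissible D}"
    using x_eq by blast
next
  fix x assume "x \<in> vertex ` {D. admissible D}"
  then obtain D where D: "admissible D" "x = vertex D"
    by blast
  have "alpha H n e i j x \<in> {int (b i j), int (b i j) + 1}" if ij: "1 \<le> i" "i < j" "j \<le> n" for i j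
    using D(1) ij unfolding D(2) alpha_vertex[OF ij] admissible_def
    by (cases "\<mu> i < \<mu> j") (auto simp: of_bool_def)
  moreover have "x \<in> apartment H n e"
    unfolding D(2) vertex_def apartment_def apt_vertex_eq by blast
  ultimately show "x \<in> alcove H n e (\<lambda>i j. int (b i j))"
    by (simp add: alcove_def)
qed

text \<open>Of two indices one precedes the other, and an initial segment containing the later one
  contains the earlier one.\<close>

lemma admissible_chain:
  assumes "admissible D" "admissible D'"
  shows "D \<subseteq> D' \<or> D' \<subseteq> D"
proof (rule ccontr)
  assume "\<not> ?thesis"
  then obtain i j where ij: "i \<in> D" "i \<notin> D'" "j \<in> D'" "j \<notin> D"
    by blast
  then have "i \<in> {1..<n}" "j \<in> {1..<n}" "i \<noteq> j"
    using assms by (auto simp: admissible_def)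
  then consider "1 \<le> i" "i < j" "j \<le> n" | "1 \<le> j" "j < i" "i \<le> n"
    by fastforce
  then show False
    using assms ij unfolding admissible_def by cases (meson not_le)+
qed

lemma simplex_admissible:
  assumes "\<D> \<noteq> {}" "\<D> \<subseteq> {D. admissible D}"
  shows "simplex H (vertex ` \<D>)"
proof -
  have n_notin: "n \<notin> D" if "D \<in> \<D>" for D
    using assms that unfolding admissible_def by fastforce
  have "\<D> \<subseteq> Pow {1..<n}"
    using assms by (auto simp: admissible_def)
  then have "finite (coords ` \<D>)"
    by (simp add: finite_subset)
  moreover have "Lat a \<subseteq> Lat b \<or> Lat b \<subseteq> Lat a" if ab: "a \<in> coords ` \<D>" "b \<in> coords ` \<D>" for a b
  proof -
    obtain D D' where D: "a = coords D" "b = coords D'" "D \<in> \<D>" "D' \<in> \<D>"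
      using ab by blast
    then have "D \<subseteq> D' \<or> D' \<subseteq> D"
      using assms by (intro admissible_chain) auto
    then show ?thesis
      unfolding Lat_subset_iff D by (auto simp: coords_def)
  qed
  moreover have "Lat (\<lambda>i. a i - 1) \<subset> Lat b" if ab: "a \<in> coords ` \<D>" "b \<in> coords ` \<D>" for a b
  proof -
    obtain D D' where D: "a = coords D" "b = coords D'" "D \<in> \<D>" "D' \<in> \<D>"
      using ab by blast
    \<comment> \<open>Strictness is seen at coordinate n, which is 0 for both vertices and -1 after
      multiplication by \<open>\<pi>\<close>.\<close>
    then have "a n - 1 \<noteq> b n"
      by (simp add: coords_def n_notin)
    then have "Lat (\<lambda>i. a i - 1) \<noteq> Lat b"
      using height_pos by (auto simp: Lat_eq_iff)
    moreover have "Lat (\<lambda>i. a i - 1) \<subseteq> Lat b"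
      unfolding Lat_subset_iff D by (auto simp: coords_def)
    ultimately show ?thesis
      by blast
  qed
  ultimately have "simplex H ((\<lambda>a. hclass H (Lat a)) ` coords ` \<D>)"
    using assms by (intro simplex_Lat) auto
  then show ?thesis
    by (simp add: image_image vertex_def)
qed

lemma admissible_empty: "admissible {}"
  by (simp add: admissible_def)

definition upper :: "real \<Rightarrow> nat set" where
  "upper t = {i \<in> {1..n}. t \<le> \<mu> i}"

lemma admissible_upper: "lam n < t \<Longrightarrow> admissible (upper t)"
  using mu_n by (auto simp: admissible_def upper_def le_less)

lemma simplex_alcove: "simplex H (alcove H n e (\<lambda>i j. int (b i j)))"
  unfolding alcove_eq using admissible_empty by (intro simplex_admissible) auto

text \<open>The initial segment of the order in the definition of \<open>admissible\<close> that ends with \<open>k\<close>.\<close>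
definition segment :: "nat \<Rightarrow> nat set" where
  "segment k = {i \<in> {1..n}. \<mu> k < \<mu> i \<or> \<mu> k = \<mu> i \<and> i \<le> k}"

lemma admissible_segment:
  assumes "k \<in> {1..<n}"
  shows "admissible (segment k)"
proof -
  have "\<mu> n \<le> \<mu> k"
    using mu_bounds(1)[of k] mu_n assms by simp
  then show ?thesis
    using assms unfolding admissible_def segment_def
    by (intro conjI allI impI subsetI) (fastforce simp: le_less)+
qed

text \<open>The empty set gives one value, and the segment that ends with the earlier of i and j,
  hence separates them, gives the other.\<close>

lemma ex_vertex_alpha:
  assumes ij: "1 \<le> i" "i < j" "j \<le> n"
  shows "\<exists>D. admissible D \<and> alpha H n e i j (vertex D) = int (b i j)"
    and "\<exists>D. admissible D \<and> alpha H n e i j (vertex D) = int (b i j) + 1"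
proof -
  have "(\<exists>D. admissible D \<and> alpha H n e i j (vertex D) = int (b i j)) \<and>
    (\<exists>D. admissible D \<and> alpha H n e i j (vertex D) = int (b i j) + 1)"
  proof (cases "\<mu> i < \<mu> j")
    case True
    \<comment> \<open>The index n comes last, having the least \<open>\<mu>\<close>; so the segment
      ending with j is a proper one.\<close>
    then have "j \<noteq> n"
      using mu_bounds(1)[of i] mu_n ij by auto
    then have "admissible (segment j)" "i \<notin> segment j" "j \<in> segment j"
      using ij True by (auto intro!: admissible_segment) (auto simp: segment_def)
    then have "alpha H n e i j (vertex (segment j)) = int (b i j)"
      "alpha H n e i j (vertex {}) = int (b i j) + 1"
      using True ij by (auto simp: alpha_vertex)
    then show ?thesis
      using \<open>admissible (segment j)\<close> admissible_empty by blast
  next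
    case False
    have "admissible (segment i)" "i \<in> segment i" "j \<notin> segment i"
      using ij False by (auto intro!: admissible_segment) (auto simp: segment_def)
    then have "alpha H n e i j (vertex {}) = int (b i j)"
      "alpha H n e i j (vertex (segment i)) = int (b i j) + 1"
      using False ij by (auto simp: alpha_vertex)
    then show ?thesis
      using \<open>admissible (segment i)\<close> admissible_empty by blast
  qed
  then show "\<exists>D. admissible D \<and> alpha H n e i j (vertex D) = int (b i j)"
    "\<exists>D. admissible D \<and> alpha H n e i j (vertex D) = int (b i j) + 1"
    by blast+
qed

text \<open>
  Coordinates \<open>\<alpha>\<^sub>i\<^sub>j\<close> of two vertices of a simplex differ by at most 1, and both \<open>b\<^sub>i\<^sub>j\<close> and \<open>b\<^sub>i\<^sub>j + 1\<close> occur on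
  the alcove.
\<close>
lemma maximal_simplex_alcove: "maximal_simplex H n e (alcove H n e (\<lambda>i j. int (b i j)))"
  unfolding maximal_simplex_def
proof (intro conjI allI impI simplex_alcove)
  let ?C = "alcove H n e (\<lambda>i j. int (b i j))"
  show "?C \<subseteq> apartment H n e"
    by (auto simp: alcove_def)
  fix t assume t: "simplex H t \<and> t \<subseteq> apartment H n e \<and> ?C \<subseteq> t"
  have "x \<in> ?C" if x: "x \<in> t" for x
  proof -
    obtain a where a: "x = hclass H (Lat a)"
      using x t by (auto simp: apartment_def apt_vertex_eq)
    have "alpha H n e i j x \<in> {int (b i j), int (b i j) + 1}" if ij: "1 \<le> i" "i < j" "j \<le> n" for i j
    proof -
      have close: "\<bar>alpha H n e i j x - alpha H n e i j (vertex D)\<bar> \<le> 1" if "admissible D" for D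
      proof -
        have "vertex D \<in> t"
          using that t alcove_eq by blast
        then have "\<bar>(a i - a j) - (coords D i - coords D j)\<bar> \<le> 1"
          using t x ij unfolding a vertex_def by (intro simplex_alpha_diff) auto
        then show ?thesis
          using ij by (simp add: a vertex_def alpha_hclass_Lat)
      qed
      obtain D D' where "admissible D" "alpha H n e i j (vertex D) = int (b i j)"
        "admissible D'" "alpha H n e i j (vertex D') = int (b i j) + 1"
        using ex_vertex_alpha[OF ij] by blast
      then show ?thesis
        using close[of D] close[of D'] by auto
    qed
    then show ?thesis
      using x t by (auto simp: alcove_def)
  qed
  then show "t = ?C"
    using t by blast
qed

section \<open>Small levels of the filtration and the walls\<close>

lemma slope_eventually_geometric:
  assumes i: "i \<in> {1..n}"
  shows "\<Lambda> i (B i + 1 + m) = \<mu> i / Q ^ m"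
proof (induction m)
  case (Suc m)
  have "0 < \<mu> i"
    unfolding \<mu>_def using i by (intro slope_pos) auto
  moreover have "1 \<le> Q ^ m"
    using residue_power_gt_1 by (intro one_le_power) simp
  ultimately have "0 \<le> \<mu> i / Q ^ m" "\<mu> i / Q ^ m \<le> \<mu> i"
    by (auto simp: divide_le_eq)
  \<comment> \<open>All terms from \<open>\<mu> i\<close> on stay below \<open>Q * lam n\<close>,
    where \<open>eta_inv\<close> is division by Q.\<close>
  then have "eta_inv (\<mu> i / Q ^ m) = \<mu> i / Q ^ m / Q"
    using mu_bounds(3)[OF i] by (intro eta_inv_small) auto
  then show ?case
    using Suc iter_Suc[of "B i + 1 + m" "lam i"] by simp
qed (simp add: \<mu>_def)

text \<open>At this level \<open>B i + m\<close> terms of the i-th sequence count, and one more if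
  \<open>t \<le> \<mu> i\<close>. The common summand m is a homothety.\<close>

lemma hclass_Fil:
  assumes t: "lam n < t" "t \<le> Q * lam n" and m: "1 \<le> m"
  shows "hclass H (Fil H (ereal (t / Q ^ m))) = vertex (upper t)"
proof -
  have Q: "0 < Q ^ j" for j
    using residue_power_gt_1 by simp
  have iff: "t / Q ^ m \<le> \<Lambda> i k \<longleftrightarrow> int k \<le> coords (upper t) i + int m"
    if i: "i \<in> {1..n}" and k: "1 \<le> k" for i k
  proof -
    define k0 where "k0 = B i + m + of_bool (t \<le> \<mu> i)"
    have "t / Q ^ m \<le> \<Lambda> i k0 \<and> \<Lambda> i (k0 + 1) < t / Q ^ m"
    proof (cases "t \<le> \<mu> i")
      case True
      have "\<mu> i / Q ^ (m + 1) < Q * lam n / Q ^ (m + 1)"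
        using mu_bounds(3)[OF i] Q by (intro divide_strict_right_mono)
      also have "\<dots> = lam n / Q ^ m"
        using residue_power_gt_1 by simp
      also have "\<dots> < t / Q ^ m"
        using t Q by (intro divide_strict_right_mono)
      finally show ?thesis
        using True slope_eventually_geometric[OF i, of m] slope_eventually_geometric[OF i, of "m + 1"] Q
        by (simp add: k0_def divide_right_mono add_ac)
    next
      case False
      \<comment> \<open>With m positive, the index \<open>B i + m\<close> is not before that of
        \<open>\<mu> i\<close>, so the geometric formula applies to it.\<close>
      obtain m' where m': "m = Suc m'"
        using m by (cases m) auto
      have "t / Q ^ m \<le> Q * lam n / Q ^ m"
        using t Q[of m] by (intro divide_right_mono) auto
      also have "\<dots> = lam n / Q ^ m'"
        using residue_power_gt_1 by (simp add: m')
      also have "\<dots> \<le> \<mu> i / Q ^ m'"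
        using mu_bounds(1)[OF i] Q[of m'] by (intro divide_right_mono) auto
      finally show ?thesis
        using False slope_eventually_geometric[OF i, of m'] slope_eventually_geometric[OF i, of m] Q[of m]
        by (simp add: k0_def m' divide_strict_right_mono)
    qed
    moreover have "1 \<le> k0"
      using m by (simp add: k0_def)
    ultimately have "t / Q ^ m \<le> \<Lambda> i k \<longleftrightarrow> k \<le> k0"
      using slope_index_less[OF i k, of "t / Q ^ m" "k0 + 1"] slope_index_less[OF i \<open>1 \<le> k0\<close>, of "t / Q ^ m" k] k
      by (cases "t / Q ^ m \<le> \<Lambda> i k") auto
    then show ?thesis
      using i by (auto simp: k0_def coords_def upper_def of_bool_def)
  qed
  have "Fil H (ereal (t / Q ^ m)) = Lat (\<lambda>i. coords (upper t) i + int m)"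
    by (rule Fil_eq_Lat) (use iff in \<open>auto simp: coords_def\<close>)
  moreover have "hclass H (Lat (\<lambda>i. coords (upper t) i + int m)) = hclass H (Lat (coords (upper t)))"
    by (rule hclass_Lat_eqI) simp
  ultimately show ?thesis
    by (simp add: vertex_def)
qed

lemma Fil_simplex_eq:
  assumes \<epsilon>: "0 < \<epsilon>" "\<epsilon> \<le> lam n"
  shows "Fil_simplex H \<epsilon> = vertex ` upper ` {lam n<..}"
proof (intro equalityI subsetI)
  fix x assume "x \<in> Fil_simplex H \<epsilon>"
  then obtain l where l: "0 < l" "l \<le> \<epsilon>" "x = hclass H (Fil H (ereal l))"
    by (auto simp: Fil_simplex_def)
  have "\<exists>m. lam n / l < Q ^ m"
    using residue_power_gt_1 by (rule real_arch_pow)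
  then have ex: "\<exists>m. lam n < l * Q ^ m"
    using l(1) by (auto simp: divide_less_eq mult.commute)
  \<comment> \<open>The least power of Q that lifts l above \<open>lam n\<close> puts it into the
    period ending with \<open>Q * lam n\<close>; its exponent is positive because l is at most
    \<open>lam n\<close>.\<close>
  define m where "m = (LEAST m. lam n < l * Q ^ m)"
  have m: "lam n < l * Q ^ m"
    unfolding m_def using ex by (rule LeastI_ex)
  have "m \<noteq> 0"
    using m l \<epsilon> by (cases m) auto
  then obtain m' where m': "m = Suc m'"
    by (cases m) auto
  have "\<not> lam n < l * Q ^ m'"
    using not_less_Least[of m' "\<lambda>m. lam n < l * Q ^ m"] m' by (simp add: m_def)
  then have "Q * (l * Q ^ m') \<le> Q * lam n"
    by (intro mult_left_mono) auto
  then have "l * Q ^ m \<le> Q * lam n"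
    by (simp add: m' mult_ac)
  moreover have "l = l * Q ^ m / Q ^ m"
    using residue_power_gt_1 by simp
  ultimately have "x = vertex (upper (l * Q ^ m))"
    using hclass_Fil[OF m, of m] m' l(3) by simp
  then show "x \<in> vertex ` upper ` {lam n<..}"
    using m by auto
next
  fix x assume "x \<in> vertex ` upper ` {lam n<..}"
  then obtain t where t: "lam n < t" "x = vertex (upper t)"
    by auto
  \<comment> \<open>No \<open>\<mu> i\<close> reaches \<open>Q * lam n\<close>, so the cap does not
    change \<open>upper t\<close> and brings t into the range of \<open>hclass_Fil\<close>.\<close>
  define t' where "t' = min t (Q * lam n)"
  have lam_n: "0 < lam n"
    using lam_pos[of n] height_pos by simp
  then have t': "lam n < t'" "t' \<le> Q * lam n" "0 < t'"
    using t residue_power_gt_1 by (auto simp: t'_def)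
  have "upper t = upper t'"
    using mu_bounds(3) by (force simp: upper_def t'_def)
  \<comment> \<open>Division by a high power of Q brings the level below \<open>\<epsilon>\<close>
    without changing the vertex.\<close>
  obtain m where "t' / \<epsilon> < Q ^ m"
    using real_arch_pow[OF residue_power_gt_1] by blast
  also have "\<dots> \<le> Q ^ Suc m"
    using residue_power_gt_1 by (intro power_increasing) auto
  finally have "t' / Q ^ Suc m \<le> \<epsilon>" "0 < t' / Q ^ Suc m"
    using \<epsilon> t' residue_power_gt_1 by (auto simp: divide_less_eq divide_le_eq mult.commute less_imp_le)
  moreover have "x = hclass H (Fil H (ereal (t' / Q ^ Suc m)))"
    using hclass_Fil[OF t'(1,2), of "Suc m"] t(2) \<open>upper t = upper t'\<close> by simp
  ultimately show "x \<in> Fil_simplex H \<epsilon>"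
    unfolding Fil_simplex_def by blast
qed

lemma face_Fil_simplex:
  assumes "0 < \<epsilon>" "\<epsilon> \<le> lam n"
  shows "face H (Fil_simplex H \<epsilon>) (alcove H n e (\<lambda>i j. int (b i j)))"
proof -
  have sub: "upper ` {lam n<..} \<subseteq> {D. admissible D}"
    using admissible_upper by auto
  then have "simplex H (Fil_simplex H \<epsilon>)"
    unfolding Fil_simplex_eq[OF assms] by (intro simplex_admissible) auto
  then show ?thesis
    using simplex_alcove sub unfolding face_def Fil_simplex_eq[OF assms] alcove_eq by blast
qed

text \<open>The least value of \<open>\<mu>\<close> on an initial segment determines it except for
  the choice among ties, which the hypothesis removes. The empty set arises from a threshold that no
  \<open>\<mu> i\<close> reaches.\<close>

lemma eq_upper_if_ties:
  assumes D: "admissible D"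
    and ties: "\<And>i j. 1 \<le> i \<Longrightarrow> i < j \<Longrightarrow> j \<le> n \<Longrightarrow> \<mu> i = \<mu> j \<Longrightarrow> i \<in> D \<longleftrightarrow> j \<in> D"
  shows "\<exists>t>lam n. D = upper t"
proof (cases "D = {}")
  case True
  have "lam n < Q * lam n"
    using lam_pos[of n] height_pos residue_power_gt_1 by simp
  moreover have "upper (Q * lam n) = {}"
    using mu_bounds(3) by (force simp: upper_def)
  ultimately show ?thesis
    using True by blast
next
  case False
  have sub: "D \<subseteq> {1..<n}"
    using D by (simp add: admissible_def)
  then have fin: "finite D"
    by (rule finite_subset) simp
  define t where "t = Min (\<mu> ` D)"
  have "t \<in> \<mu> ` D"
    unfolding t_def using fin False by (intro Min_in) auto
  then obtain k where k: "k \<in> D" "t = \<mu> k"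
    by blast
  have "D = upper t"
  proof (intro equalityI subsetI)
    fix i assume i: "i \<in> D"
    then have "t \<le> \<mu> i"
      unfolding t_def using fin by (intro Min_le) auto
    then show "i \<in> upper t"
      using i sub by (auto simp: upper_def)
  next
    fix i assume "i \<in> upper t"
    then have i: "i \<in> {1..n}" "\<mu> k \<le> \<mu> i"
      by (auto simp: upper_def k)
    have kn: "1 \<le> k" "k \<le> n"
      using k sub by auto
    consider "i = k" | "i < k" | "k < i" "\<mu> k < \<mu> i" | "k < i" "\<mu> k = \<mu> i"
      using i by linarith
    then show "i \<in> D"
    proof cases
      case 2
      then show ?thesis
        using D i k kn by (auto simp: admissible_def)
    next
      case 3
      then show ?thesis
        using D i k kn by (auto simp: admissible_def)
    next
      case 4
      then show ?thesis
        using ties[of k i] i k kn by auto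
    qed (use k in simp)
  qed
  moreover have "lam n < t"
  proof -
    have kn: "k \<in> {1..<n}" "n \<notin> D"
      using k sub by auto
    \<comment> \<open>A tie between k and n would put n into D.\<close>
    then have "\<mu> k \<noteq> \<mu> n"
      using ties[of k n] k by auto
    then show ?thesis
      using mu_bounds(1)[of k] kn by (simp add: k mu_n)
  qed
  ultimately show ?thesis
    by blast
qed

text \<open>For \<open>\<mu> i = \<mu> j\<close> the value in \<open>alpha_vertex\<close> is
  \<open>b i j\<close> plus the difference of the indicators of D at i and j, so lying on these
  walls means that D separates no ties.\<close>

lemma Fil_simplex_eq_walls:
  assumes "0 < \<epsilon>" "\<epsilon> \<le> lam n"
  shows "Fil_simplex H \<epsilon> = {x \<in> alcove H n e (\<lambda>i j. int (b i j)).
    \<forall>i j. 1 \<le> i \<longrightarrow> i < j \<longrightarrow> j \<le> n \<longrightarrow> \<Lambda> i (b i j + 1) = lam j \<longrightarrow>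
      alpha H n e i j x = int (b i j)}"
  unfolding Fil_simplex_eq[OF assms] alcove_eq
proof (intro equalityI subsetI)
  fix x assume "x \<in> vertex ` upper ` {lam n<..}"
  then obtain t where t: "lam n < t" "x = vertex (upper t)"
    by auto
  then show "x \<in> {x \<in> vertex ` {D. admissible D}. \<forall>i j. 1 \<le> i \<longrightarrow> i < j \<longrightarrow> j \<le> n \<longrightarrow>
      \<Lambda> i (b i j + 1) = lam j \<longrightarrow> alpha H n e i j x = int (b i j)}"
    using admissible_upper[OF t(1)] by (auto simp: wall_iff[simplified] alpha_vertex upper_def)
next
  fix x assume x: "x \<in> {x \<in> vertex ` {D. admissible D}. \<forall>i j. 1 \<le> i \<longrightarrow> i < j \<longrightarrow> j \<le> n \<longrightarrow>
      \<Lambda> i (b i j + 1) = lam j \<longrightarrow> alpha H n e i j x = int (b i j)}"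
  then obtain D where D: "admissible D" "x = vertex D"
    by blast
  have "i \<in> D \<longleftrightarrow> j \<in> D" if ij: "1 \<le> i" "i < j" "j \<le> n" and "\<mu> i = \<mu> j" for i j
  proof -
    have "alpha H n e i j (vertex D) = int (b i j)"
      using x ij wall_iff[OF ij] that(4) unfolding D(2) by simp
    then show ?thesis
      using that by (simp add: alpha_vertex of_bool_def split: if_splits)
  qed
  then show "x \<in> vertex ` upper ` {lam n<..}"
    using eq_upper_if_ties[OF D(1)] D(2) by auto
qed

end

end


theorem proposition2p6:
  fixes p n :: nat
    and H :: "('k::{alg_closed_field, field_char_0}) formal_module"
    and lam :: "nat \<Rightarrow> real"
    and e :: "nat \<Rightarrow> int \<Rightarrow> 'k"
    and b :: "nat \<Rightarrow> nat \<Rightarrow> nat"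
    and \<epsilon> :: real
  assumes "pi_divisible_module p n H"
    and "is_slopes H n lam"
    and "adapted_basis H n lam e"
    and "\<And>i j. 1 \<le> i \<Longrightarrow> i < j \<Longrightarrow> j \<le> n \<Longrightarrow>
           lam j \<le> iter H n lam (b i j + 1) (lam i) \<and> iter H n lam (b i j + 2) (lam i) < lam j"
    and "0 < \<epsilon>" and "\<epsilon> \<le> lam n"
  shows "alcove_family n (\<lambda>i j. int (b i j)) \<and>
         maximal_simplex H n e (alcove H n e (\<lambda>i j. int (b i j))) \<and>
         face H (Fil_simplex H \<epsilon>) (alcove H n e (\<lambda>i j. int (b i j))) \<and>
         Fil_simplex H \<epsilon> =
           {x \<in> alcove H n e (\<lambda>i j. int (b i j)).
              \<forall>i j. 1 \<le> i \<longrightarrow> i < j \<longrightarrow> j \<le> n \<longrightarrow> iter H n lam (b i j + 1) (lam i) = lam j \<longrightarrow>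
                alpha H n e i j x = int (b i j)}"
proof -
  interpret adapted p n H lam e
    using assms(1-3) by (simp add: adapted_def adapted_axioms_def)
  show ?thesis
    using alcove_family_b[OF assms(4)] maximal_simplex_alcove[OF assms(4)]
      face_Fil_simplex[OF assms(4-6)] Fil_simplex_eq_walls[OF assms(4-6)]
    by blast
qed

end
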